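(* Let $\mathcal{G} = (\mathcal{M}, \psi, A, S)$ be an irreflexive quantum graph, and let $\chi(\mathcal{G})$ and $\chi_q(\mathcal{G})$ denote the classical and quantum chromatic numbers of $\mathcal{G}$ respectively. Then \[ 1 + \max \left\{ \frac{\lambda_{\max}}{|\lambda_{\min}|},\ \frac{\dim(S)}{\dim(S) - \dim(\mathcal{M})\, \gamma_{\min}},\ \frac{s^+}{s^-},\ \frac{s^-}{s^+},\ \frac{n^+}{n^-},\ \frac{n^-}{n^+},\ \frac{\lambda_{\max}}{\lambda_{\max} - \gamma_{\max} + \theta_{\max}} \right\} \le \chi_q(\mathcal{G}) \le \chi(\mathcal{G}). \] Here $\lambda_{\max}, \lambda_{\min}$ are the maximum and minimum eigenvalues of $A$; $s^+$ and $s^-$ are the sums of the squares of the positive and of the negative eigenvalues of $A$ respectively (counted with multiplicity); $n^+$ and $n^-$ are the numbers of positive and of negative eigenvalues of $A$ (counted with multiplicity); $\gamma_{\max}, \gamma_{\min}$ are the maximum and minimum eigenvalues of the signless Laplacian $Q$ of $\mathcal{G}$; and $\theta_{\max}$ is the maximum eigenvalue of the Laplacian $L$ of $\mathcal{G}$.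
   Context: Quantum graph. $\mathcal{M} \cong \bigoplus_{i=1}^N M_{n_i}$ is a finite dimensional C*-algebra with unit $\mathbb{1}$, equipped with its unique tracial $\delta$-form $\psi = \frac{1}{\dim \mathcal{M}} \bigoplus_{i=1}^N n_i \mathrm{Tr}(\cdot)$, for which $\delta^2 = \dim(\mathcal{M})$. $L^2(\mathcal{M})$ is $\mathcal{M}$ with inner product $\langle x, y\rangle = \psi(y^*x)$; $\mathcal{M} \subseteq B(L^2(\mathcal{M}))$ acts by left multiplication, and $\mathcal{M}'$ is its commutant in $B(L^2(\mathcal{M}))$. A quantum graph on $\mathcal{M}$ is a linear subspace $S \subseteq B(L^2(\mathcal{M}))$ closed under adjoint with $\mathcal{M}' S \mathcal{M}' \subseteq S$. It is irreflexive if $S \subseteq (\mathcal{M}')^\perp$ (orthogonality for the trace inner product on $B(L^2(\mathcal{M}))$). Quantum adjacency matrix. Let $P_S : B(L^2(\mathcal{M})) \to B(L^2(\mathcal{M}))$ be the orthogonal projection onto $S$ for the trace inner product; it is an $\mathcal{M}'$-$\mathcal{M}'$ bimodule map, so $P_S(X) = \sum_i x_i X y_i$ for some $x_i, y_i \in \mathcal{M}$, with $\sum_i x_i \otimes y_i^{op} \in \mathcal{M} \otimes \mathcal{M}^{op}$ uniquely determined. The quantum adjacency matrix associated with $S$ is the self-adjoint linear operator $A : L^2(\mathcal{M}) \to L^2(\mathcal{M})$, $A(x) = \delta^2 \sum_i \psi(x_i x)\, y_i$; equivalently $P_S(X) = \delta^{-2} m(A \otimes X) m^*$, where $m : \mathcal{M}\otimes\mathcal{M}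 \to \mathcal{M}$ is multiplication and $m^*$ is its adjoint as an operator $L^2(\mathcal{M}) \otimes L^2(\mathcal{M}) \to L^2(\mathcal{M})$. The notation $\mathcal{G} = (\mathcal{M}, \psi, A, S)$ means that $A$ is this operator. Degree matrix and Laplacians. The quantum degree matrix $D \in B(L^2(\mathcal{M}))$ is $D(x) = x\,(A\mathbb{1})$ (right multiplication by $A \mathbb{1}$). The Laplacian is $L = D - A$ and the signless Laplacian is $Q = D + A$. Coloring. A $c$-coloring of $\mathcal{G}$ consists of a finite von Neumann algebra $\mathcal{N}$ with a faithful normal trace and projections $P_1, \dots, P_c \in \mathcal{M} \otimes \mathcal{N}$ ($P_a = P_a^* = P_a^2$) with $\sum_{a=1}^c P_a = I_{\mathcal{M} \otimes \mathcal{N}}$ and $P_a (X \otimes I_{\mathcal{N}}) P_a = 0$ for all $X \in S$ and $1 \le a \le c$. It is a quantum coloring if $\dim(\mathcal{N}) < \infty$ and a classical coloring if $\dim(\mathcal{N}) = 1$. $\chi_q(\mathcal{G})$ (resp. $\chi(\mathcal{G})$) is the least $c$ for which a quantum (resp. classical) $c$-coloring exists, with value $\infty$ if none exists. *)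

theory Defs
  imports
    "Jordan_Normal_Form.Spectral_Radius"
    "Jordan_Normal_Form.Schur_Decomposition"
    "HOL-Library.Extended_Real"
begin

section \<open>Complex matrices\<close>

abbreviation mat_space :: "nat \<Rightarrow> (complex, complex mat) module" where
  "mat_space d \<equiv> module_mat TYPE(complex) d d"

abbreviation mat_sum_upto :: "nat \<Rightarrow> nat \<Rightarrow> (nat \<Rightarrow> complex mat) \<Rightarrow> complex mat" where
  "mat_sum_upto d r f \<equiv> finsum (mat_space d) f {..<r}"

definition mat_dim :: "nat \<Rightarrow> complex mat set \<Rightarrow> nat" where
  "mat_dim d S = vectorspace.dim class_ring ((mat_space d)\<lparr>carrier := S\<rparr>)"

definition mat_trace :: "complex mat \<Rightarrow> complex" where
  "mat_trace X = (\<Sum>i<dim_row X. X $$ (i, i))"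

definition kron :: "complex mat \<Rightarrow> complex mat \<Rightarrow> complex mat" where
  "kron X Y = mat (dim_row X * dim_row Y) (dim_col X * dim_col Y)
     (\<lambda>(i, j). X $$ (i div dim_row Y, j div dim_col Y) * Y $$ (i mod dim_row Y, j mod dim_col Y))"


section \<open>The algebra \<open>M\<close>, its tracial delta-form and \<open>L\<^sup>2(M)\<close>\<close>

text \<open>
  A list \<open>ns = [n\<^sub>1, \<dots>, n\<^sub>N]\<close> of positive numbers stands for the algebra
  \<open>M = M\<^bsub>n\<^sub>1\<^esub> \<oplus> \<dots> \<oplus> M\<^bsub>n\<^sub>N\<^esub>\<close>, realised as the block diagonal matrices of size
  \<open>n\<^sub>1 + \<dots> + n\<^sub>N\<close>. The number \<open>block ns p\<close> is the index of the summand containing position \<open>p\<close>.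
\<close>

definition alg_size :: "nat list \<Rightarrow> nat" where
  "alg_size ns = sum_list ns"

definition block :: "nat list \<Rightarrow> nat \<Rightarrow> nat" where
  "block ns p = concat (map (\<lambda>i. replicate (ns ! i) i) [0..<length ns]) ! p"

definition alg :: "nat list \<Rightarrow> complex mat set" where
  "alg ns = {x \<in> carrier_mat (alg_size ns) (alg_size ns).
     \<forall>p<alg_size ns. \<forall>q<alg_size ns. block ns p \<noteq> block ns q \<longrightarrow> x $$ (p, q) = 0}"

definition alg_one :: "nat list \<Rightarrow> complex mat" where
  "alg_one ns = 1\<^sub>m (alg_size ns)"

definition alg_dim :: "nat list \<Rightarrow> nat" where
  "alg_dim ns = sum_list (map (\<lambda>n. n\<^sup>2) ns)"

definition psi :: "nat list \<Rightarrow> complex mat \<Rightarrow> complex" where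
  "psi ns x = (\<Sum>p<alg_size ns. of_nat (ns ! block ns p) * x $$ (p, p)) / of_nat (alg_dim ns)"

definition L2_inner :: "nat list \<Rightarrow> complex mat \<Rightarrow> complex mat \<Rightarrow> complex" where
  "L2_inner ns x y = psi ns (mat_adjoint y * x)"

text \<open>
  The rescaled matrix units form an orthonormal basis of \<open>L\<^sup>2(M)\<close>. Through this basis
  \<open>B(L\<^sup>2(M))\<close> is identified with the matrices of size \<open>dim M\<close>, so that the operator adjoint becomes
  \<open>mat_adjoint\<close> and the operator trace becomes \<open>mat_trace\<close>.
\<close>

definition L2_index :: "nat list \<Rightarrow> (nat \<times> nat) list" where
  "L2_index ns = filter (\<lambda>(p, q). block ns p = block ns q)
     (List.product [0..<alg_size ns] [0..<alg_size ns])"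

definition L2_basis :: "nat list \<Rightarrow> nat \<Rightarrow> complex mat" where
  "L2_basis ns r = mat (alg_size ns) (alg_size ns)
     (\<lambda>pq. if pq = L2_index ns ! r
       then complex_of_real (sqrt (real (alg_dim ns) / real (ns ! block ns (fst pq)))) else 0)"

lemma concat_labels_length:
  "length (concat (map (\<lambda>i. replicate (ns ! i) i) [0..<length ns])) = alg_size ns"
  by (simp add: alg_size_def length_concat comp_def map_nth)

lemma length_L2_index: "length (L2_index ns) = alg_dim ns"
proof -
  define L where "L = concat (map (\<lambda>i. replicate (ns ! i) i) [0..<length ns])"
  have len: "length L = alg_size ns"
    unfolding L_def by (rule concat_labels_length)
  have prod: "List.product L L = map (map_prod (\<lambda>p. L ! p) (\<lambda>p. L ! p)) (List.product [0..<length L] [0..<length L])"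
    by (subst (1 2) map_nth[of L, symmetric]) (simp add: product_concat_map map_concat comp_def)
  have flt: "length (L2_index ns) = length (filter (\<lambda>(x, y). x = y) (List.product L L))"
    unfolding prod L2_index_def block_def len L_def[symmetric]
    by (simp add: filter_map comp_def case_prod_unfold)
  have gen: "length (filter (\<lambda>(x, y). x = y) (List.product K L)) = (\<Sum>x\<leftarrow>K. count_list L x)" for K
    by (induction K) (auto simp: filter_map comp_def count_list_eq_length_filter)
  have cnt: "count_list L i = ns ! i" if "i < length ns" for i
  proof -
    have "count_list (concat (map (\<lambda>i. replicate (ns ! i) i) [0..<m])) i = (if i < m then ns ! i else 0)" for m
      by (induction m) (auto simp: count_list_eq_length_filter less_Suc_eq)
    then show ?thesis using that unfolding L_def by simp
  qed
  have "(\<Sum>x\<leftarrow>L. f x) = (\<Sum>i\<leftarrow>[0..<length ns]. ns ! i * f i)" for f :: "nat \<Rightarrow> nat"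
  proof -
    have "(\<Sum>x\<leftarrow>concat (map (\<lambda>i. replicate (ns ! i) i) [0..<m]). f x) = (\<Sum>i\<leftarrow>[0..<m]. ns ! i * f i)" for m
      by (induction m) (auto simp: sum_list_replicate)
    then show ?thesis unfolding L_def by simp
  qed
  then have "length (L2_index ns) = (\<Sum>i\<leftarrow>[0..<length ns]. ns ! i * count_list L i)"
    unfolding flt gen by simp
  also have "\<dots> = (\<Sum>i\<leftarrow>[0..<length ns]. (ns ! i)\<^sup>2)"
    by (intro arg_cong[where f = sum_list] map_cong) (auto simp: cnt power2_eq_square)
  also have "\<dots> = alg_dim ns"
    by (simp add: alg_dim_def sum_list_sum_nth)
  finally show ?thesis .
qed

lemma block_less: "p < alg_size ns \<Longrightarrow> block ns p < length ns"
proof -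
  assume "p < alg_size ns"
  then have "block ns p \<in> set (concat (map (\<lambda>i. replicate (ns ! i) i) [0..<length ns]))"
    unfolding block_def by (intro nth_mem) (simp only: concat_labels_length)
  then show ?thesis by auto
qed

lemma L2_basis_in_alg: "r < alg_dim ns \<Longrightarrow> L2_basis ns r \<in> alg ns"
proof -
  assume "r < alg_dim ns"
  then have "L2_index ns ! r \<in> set (L2_index ns)" by (simp add: length_L2_index)
  then show ?thesis unfolding L2_index_def alg_def L2_basis_def by auto
qed

lemma L2_basis_orthonormal:
  assumes pos: "\<forall>n\<in>set ns. n > 0" and r: "r < alg_dim ns" and s: "s < alg_dim ns"
  shows "L2_inner ns (L2_basis ns r) (L2_basis ns s) = (if r = s then 1 else 0)"
proof -
  let ?n = "alg_size ns"
  define c where "c t = complex_of_real (sqrt (real (alg_dim ns) / real (ns ! block ns t)))" for t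
  obtain p q where pq: "L2_index ns ! r = (p, q)" by force
  obtain p' q' where pq': "L2_index ns ! s = (p', q')" by force
  have "(p, q) \<in> set (L2_index ns)" "(p', q') \<in> set (L2_index ns)"
    using r s pq pq' length_L2_index nth_mem by metis+
  then have b: "p < ?n" "q < ?n" "block ns p = block ns q" "p' < ?n" "q' < ?n"
    by (auto simp: L2_index_def)
  have "distinct (L2_index ns)"
    by (simp add: L2_index_def distinct_product)
  then have rs: "r = s \<longleftrightarrow> (p, q) = (p', q')"
    using r s pq pq' by (metis length_L2_index nth_eq_iff_index_eq)
  have npos: "ns ! block ns p > 0"
    using pos block_less[OF b(1)] by auto
  have dpos: "alg_dim ns > 0" using r by simp
  have diag: "(mat_adjoint (L2_basis ns s) * L2_basis ns r) $$ (t, t)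
      = (if t = q \<and> (p, q) = (p', q') then c p * c p else 0)" if t: "t < ?n" for t
  proof -
    have "(mat_adjoint (L2_basis ns s) * L2_basis ns r) $$ (t, t)
      = (\<Sum>u<?n. cnj (L2_basis ns s $$ (u, t)) * L2_basis ns r $$ (u, t))"
      using t by (simp add: mat_adjoint_def L2_basis_def scalar_prod_def mat_of_rows_def
        atLeast0LessThan)
    also have "\<dots> = (\<Sum>u<?n. if u = p then (if t = q \<and> (p, q) = (p', q') then c p * c p else 0) else 0)"
      using t by (intro sum.cong) (auto simp: L2_basis_def pq pq' c_def)
    finally show ?thesis using b by (simp split: if_splits)
  qed
  have "L2_inner ns (L2_basis ns r) (L2_basis ns s) =
     (\<Sum>t<?n. if t = q then (if (p, q) = (p', q') then of_nat (ns ! block ns q) * (c p * c p) else 0) else 0)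
       / of_nat (alg_dim ns)"
    unfolding L2_inner_def psi_def
    by (intro arg_cong2[where f = "(/)"] sum.cong refl) (auto simp: diag simp del: index_mult_mat)
  also have "\<dots> = (if r = s then of_nat (ns ! block ns p) * (c p * c p) / of_nat (alg_dim ns) else 0)"
    using b(1-3) rs by (cases "(p, q) = (p', q')") (simp_all only: if_True if_False sum.delta finite_lessThan, simp_all)
  also have "c p * c p = of_nat (alg_dim ns) / of_nat (ns ! block ns p)"
    unfolding c_def by (simp flip: of_real_mult)
  finally show ?thesis using npos dpos by simp
qed

definition L2_op :: "nat list \<Rightarrow> (complex mat \<Rightarrow> complex mat) \<Rightarrow> complex mat" where
  "L2_op ns f = mat (alg_dim ns) (alg_dim ns)
     (\<lambda>(r, s). L2_inner ns (f (L2_basis ns s)) (L2_basis ns r))"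

definition left_mult :: "nat list \<Rightarrow> complex mat \<Rightarrow> complex mat" where
  "left_mult ns x = L2_op ns (\<lambda>y. x * y)"

definition commutant :: "nat list \<Rightarrow> complex mat set" where
  "commutant ns = {T \<in> carrier_mat (alg_dim ns) (alg_dim ns).
     \<forall>x\<in>alg ns. T * left_mult ns x = left_mult ns x * T}"


section \<open>Quantum graphs\<close>

definition quantum_graph :: "nat list \<Rightarrow> complex mat set \<Rightarrow> bool" where
  "quantum_graph ns S \<longleftrightarrow>
     VectorSpace.subspace class_ring S (mat_space (alg_dim ns)) \<and>
     (\<forall>X\<in>S. mat_adjoint X \<in> S) \<and>
     (\<forall>T\<in>commutant ns. \<forall>X\<in>S. \<forall>T'\<in>commutant ns. T * X * T' \<in> S)"

definition irreflexive :: "nat list \<Rightarrow> complex mat set \<Rightarrow> bool" where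
  "irreflexive ns S \<longleftrightarrow> (\<forall>X\<in>S. \<forall>T\<in>commutant ns. mat_trace (mat_adjoint T * X) = 0)"

definition orth_projection :: "nat \<Rightarrow> complex mat set \<Rightarrow> (complex mat \<Rightarrow> complex mat) \<Rightarrow> bool" where
  "orth_projection d S P \<longleftrightarrow>
     (\<forall>X\<in>carrier_mat d d. P X \<in> S \<and> (\<forall>Y\<in>S. mat_trace (mat_adjoint Y * (X - P X)) = 0))"

text \<open>
  \<open>A\<close> acts on elements of \<open>alg ns\<close>; its values elsewhere are irrelevant. The tensor
  \<open>\<Sum> x\<^sub>i \<otimes> y\<^sub>i\<^sup>o\<^sup>p\<close> is uniquely determined by \<open>P\<close>, so \<open>A\<close> does not depend on the chosen \<open>x\<close>, \<open>y\<close>.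
  Here \<open>\<delta>\<^sup>2 = dim M\<close>.
\<close>

definition quantum_adjacency ::
    "nat list \<Rightarrow> complex mat set \<Rightarrow> (complex mat \<Rightarrow> complex mat) \<Rightarrow> bool" where
  "quantum_adjacency ns S A \<longleftrightarrow>
     (\<exists>P r x y. orth_projection (alg_dim ns) S P \<and>
        (\<forall>i<r. x i \<in> alg ns \<and> y i \<in> alg ns) \<and>
        (\<forall>X\<in>carrier_mat (alg_dim ns) (alg_dim ns).
           P X = mat_sum_upto (alg_dim ns) r (\<lambda>i. left_mult ns (x i) * X * left_mult ns (y i))) \<and>
        (\<forall>z\<in>alg ns. A z = of_nat (alg_dim ns) \<cdot>\<^sub>m
           mat_sum_upto (alg_size ns) r (\<lambda>i. psi ns (x i * z) \<cdot>\<^sub>m y i)))"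

definition degree_op :: "nat list \<Rightarrow> (complex mat \<Rightarrow> complex mat) \<Rightarrow> complex mat \<Rightarrow> complex mat" where
  "degree_op ns A z = z * A (alg_one ns)"

definition adjacency_matrix :: "nat list \<Rightarrow> (complex mat \<Rightarrow> complex mat) \<Rightarrow> complex mat" where
  "adjacency_matrix ns A = L2_op ns A"

definition degree_matrix :: "nat list \<Rightarrow> (complex mat \<Rightarrow> complex mat) \<Rightarrow> complex mat" where
  "degree_matrix ns A = L2_op ns (degree_op ns A)"

definition laplacian :: "nat list \<Rightarrow> (complex mat \<Rightarrow> complex mat) \<Rightarrow> complex mat" where
  "laplacian ns A = degree_matrix ns A - adjacency_matrix ns A"

definition signless_laplacian :: "nat list \<Rightarrow> (complex mat \<Rightarrow> complex mat) \<Rightarrow> complex mat" where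
  "signless_laplacian ns A = degree_matrix ns A + adjacency_matrix ns A"


section \<open>Eigenvalues of self-adjoint matrices\<close>

definition real_eigenvalues :: "complex mat \<Rightarrow> real set" where
  "real_eigenvalues T = {t. eigenvalue T (complex_of_real t)}"

definition eig_max :: "complex mat \<Rightarrow> real" where
  "eig_max T = Max (real_eigenvalues T)"

definition eig_min :: "complex mat \<Rightarrow> real" where
  "eig_min T = Min (real_eigenvalues T)"

definition eig_mult :: "complex mat \<Rightarrow> real \<Rightarrow> nat" where
  "eig_mult T t = order (complex_of_real t) (char_poly T)"

definition pos_square_sum :: "complex mat \<Rightarrow> real" where
  "pos_square_sum T = (\<Sum>t\<in>{t\<in>real_eigenvalues T. t > 0}. real (eig_mult T t) * t\<^sup>2)"

definition neg_square_sum :: "complex mat \<Rightarrow> real" where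
  "neg_square_sum T = (\<Sum>t\<in>{t\<in>real_eigenvalues T. t < 0}. real (eig_mult T t) * t\<^sup>2)"

definition pos_count :: "complex mat \<Rightarrow> nat" where
  "pos_count T = (\<Sum>t\<in>{t\<in>real_eigenvalues T. t > 0}. eig_mult T t)"

definition neg_count :: "complex mat \<Rightarrow> nat" where
  "neg_count T = (\<Sum>t\<in>{t\<in>real_eigenvalues T. t < 0}. eig_mult T t)"


section \<open>Colorings and chromatic numbers\<close>

text \<open>
  Only finite-dimensional \<open>N\<close> enter \<open>\<chi>\<^sub>q\<close> and \<open>\<chi>\<close>. Up to isomorphism, a nonzero finite-dimensional
  von Neumann algebra is a unital *-subalgebra of the \<open>k \<times> k\<close> matrices with \<open>k > 0\<close>; weak closedness
  of \<open>N\<close> and normality of the trace \<open>\<tau>\<close> are automatic.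
\<close>

definition faithful_trace :: "complex mat set \<Rightarrow> (complex mat \<Rightarrow> complex) \<Rightarrow> bool" where
  "faithful_trace N \<tau> \<longleftrightarrow>
     (\<forall>x\<in>N. \<forall>y\<in>N. \<tau> (x + y) = \<tau> x + \<tau> y \<and> \<tau> (x * y) = \<tau> (y * x)) \<and>
     (\<forall>c. \<forall>x\<in>N. \<tau> (c \<cdot>\<^sub>m x) = c * \<tau> x) \<and>
     (\<forall>x\<in>N. \<tau> (mat_adjoint x * x) \<in> \<real> \<and> Re (\<tau> (mat_adjoint x * x)) \<ge> 0 \<and>
        (\<tau> (mat_adjoint x * x) = 0 \<longrightarrow> x = 0\<^sub>m (dim_row x) (dim_col x)))"

definition fin_dim_vN_algebra :: "nat \<Rightarrow> complex mat set \<Rightarrow> bool" where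
  "fin_dim_vN_algebra k N \<longleftrightarrow>
     k > 0 \<and> VectorSpace.subspace class_ring N (mat_space k) \<and> 1\<^sub>m k \<in> N \<and>
     (\<forall>x\<in>N. \<forall>y\<in>N. x * y \<in> N) \<and> (\<forall>x\<in>N. mat_adjoint x \<in> N)"

text \<open>\<open>M \<otimes> N\<close> acting on \<open>L\<^sup>2(M) \<otimes> \<complex>\<^sup>k\<close>:\<close>

definition alg_tensor :: "nat list \<Rightarrow> nat \<Rightarrow> complex mat set \<Rightarrow> complex mat set" where
  "alg_tensor ns k N = module.span class_ring (mat_space (alg_dim ns * k))
     {kron (left_mult ns x) y | x y. x \<in> alg ns \<and> y \<in> N}"

definition is_coloring ::
    "nat list \<Rightarrow> complex mat set \<Rightarrow> nat \<Rightarrow> nat \<Rightarrow> complex mat set \<Rightarrow> (nat \<Rightarrow> complex mat) \<Rightarrow> bool" where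
  "is_coloring ns S c k N P \<longleftrightarrow>
     fin_dim_vN_algebra k N \<and> (\<exists>\<tau>. faithful_trace N \<tau>) \<and>
     (\<forall>a<c. P a \<in> alg_tensor ns k N \<and> mat_adjoint (P a) = P a \<and> P a * P a = P a) \<and>
     mat_sum_upto (alg_dim ns * k) c P = 1\<^sub>m (alg_dim ns * k) \<and>
     (\<forall>X\<in>S. \<forall>a<c. P a * kron X (1\<^sub>m k) * P a = 0\<^sub>m (alg_dim ns * k) (alg_dim ns * k))"

definition quantum_colorable :: "nat list \<Rightarrow> complex mat set \<Rightarrow> nat \<Rightarrow> bool" where
  "quantum_colorable ns S c \<longleftrightarrow> (\<exists>k N P. is_coloring ns S c k N P)"

definition classically_colorable :: "nat list \<Rightarrow> complex mat set \<Rightarrow> nat \<Rightarrow> bool" where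
  "classically_colorable ns S c \<longleftrightarrow> (\<exists>k N P. is_coloring ns S c k N P \<and> mat_dim k N = 1)"

text \<open>The infimum of the empty set of extended naturals is \<open>\<infinity>\<close>.\<close>

definition quantum_chromatic_number :: "nat list \<Rightarrow> complex mat set \<Rightarrow> enat" where
  "quantum_chromatic_number ns S = (INF c\<in>{c. quantum_colorable ns S c}. enat c)"

definition chromatic_number :: "nat list \<Rightarrow> complex mat set \<Rightarrow> enat" where
  "chromatic_number ns S = (INF c\<in>{c. classically_colorable ns S c}. enat c)"

end

theory Submission
  imports Defs
begin

text \<open>
  The bounds rest on three facts about a quantum graph with adjacency matrix \<open>A\<close> and projections \<open>P\<^sub>a\<close>
  (\<open>a < c\<close>) that form a quantum coloring.

  First, \<open>A\<close> itself belongs to \<open>S\<close>. The tensor \<open>\<Sum>\<^sub>i x\<^sub>i \<otimes> y\<^sub>i\<close> of the projection onto \<open>S\<close> is invariant under the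
  flip (lemma \<open>F_symmetric\<close>), and \<open>A\<close> is, up to this flip, \<open>\<delta>\<^sup>2\<close> times the projection applied to the rank-one
  operator \<open>\<bar>1\<rangle>\<langle>1\<bar>\<close> (lemma \<open>Adj_eq\<close>). Hence \<open>A\<close> is self-adjoint and \<open>P\<^sub>a (A \<otimes> 1) P\<^sub>a = 0\<close>.
  Second, the degree matrix \<open>D\<close> is a self-adjoint right multiplication, so \<open>D \<otimes> 1\<close> commutes with every
  \<open>P\<^sub>a\<close>. Third, \<open>dim S\<close> is the trace of the projection onto \<open>S\<close>, which makes \<open>dim S / dim M\<close> the common value of
  the forms of \<open>A\<close> and \<open>D\<close> at the unit vector \<open>1 \<in> L\<^sup>2(M)\<close> (lemmas \<open>dim_S\<close>, \<open>Adj_form\<close>, \<open>Deg_form\<close>).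

  Pinching \<open>X \<mapsto> \<Sum>\<^sub>a P\<^sub>a X P\<^sub>a\<close> therefore kills \<open>A \<otimes> 1\<close> and fixes scalars and \<open>D \<otimes> 1\<close>. A positive operator is at most
  \<open>c\<close> times its pinching (lemma \<open>pinching_inequality\<close>). Applied to \<open>A - \<lambda>\<^sub>m\<^sub>i\<^sub>n\<close>, to \<open>Q - \<gamma>\<^sub>m\<^sub>i\<^sub>n\<close> and to
  \<open>\<theta>\<^sub>m\<^sub>a\<^sub>x - L\<close>, with suitable test vectors, this gives the three bounds that involve extreme eigenvalues
  (lemma \<open>eigenvalue_bounds\<close>).

  The other bounds come from writing the \<open>P\<^sub>a\<close> in an eigenbasis of \<open>A \<otimes> 1\<close>. The sums of the squared moduli of their
  entries form a symmetric stochastic matrix that annihilates the eigenvalues and has diagonal at least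
  \<open>1 / c\<close>; this suffices for the sums of squares (lemma \<open>square_sum_le\<close>). The numbers of eigenvalues of each
  sign are compared by counting linear conditions (lemma \<open>inertia_bound\<close>). Passing from \<open>A\<close> to
  \<open>A \<otimes> 1\<close> multiplies both sides of these inequalities by the same factor.
\<close>

section \<open>Adjoints and the spectral theorem\<close>

lemma mat_adjoint_dim [simp]:
  "dim_row (mat_adjoint T) = dim_col T" "dim_col (mat_adjoint T) = dim_row T"
  by (simp_all add: mat_adjoint_def)

lemma mat_adjoint_carrier [simp]: "T \<in> carrier_mat m n \<Longrightarrow> mat_adjoint T \<in> carrier_mat n m"
  by (rule carrier_matI) auto

lemma mat_adjoint_index [simp]:
  fixes T :: "complex mat"
  shows "i < dim_col T \<Longrightarrow> j < dim_row T \<Longrightarrow> mat_adjoint T $$ (i, j) = cnj (T $$ (j, i))"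
  by (simp add: mat_adjoint_def mat_of_rows_def)

lemma mat_mult_index:
  "A \<in> carrier_mat m n \<Longrightarrow> B \<in> carrier_mat n l \<Longrightarrow> i < m \<Longrightarrow> j < l \<Longrightarrow>
    (A * B) $$ (i, j) = (\<Sum>k<n. A $$ (i, k) * B $$ (k, j))"
  by (simp add: scalar_prod_def atLeast0LessThan)

lemma mat_adjoint_mult:
  fixes A :: "complex mat"
  assumes "A \<in> carrier_mat m n" "B \<in> carrier_mat n l"
  shows "mat_adjoint (A * B) = mat_adjoint B * mat_adjoint A"
proof (rule eq_matI)
  fix i j assume "i < dim_row (mat_adjoint B * mat_adjoint A)" "j < dim_col (mat_adjoint B * mat_adjoint A)"
  then have ij: "i < l" "j < m" using assms by auto
  have "(mat_adjoint B * mat_adjoint A) $$ (i, j)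
      = (\<Sum>k<n. mat_adjoint B $$ (i, k) * mat_adjoint A $$ (k, j))"
    using mat_mult_index[of "mat_adjoint B" l n "mat_adjoint A" m] assms ij by simp
  also have "\<dots> = (\<Sum>k<n. cnj (A $$ (j, k) * B $$ (k, i)))"
    using assms ij by (intro sum.cong) (auto simp: mult.commute)
  also have "\<dots> = mat_adjoint (A * B) $$ (i, j)"
    using assms ij by (subst mat_adjoint_index)
      (auto simp: mat_mult_index[OF assms] simp del: index_mult_mat(1))
  finally show "mat_adjoint (A * B) $$ (i, j) = (mat_adjoint B * mat_adjoint A) $$ (i, j)" by simp
qed (use assms in auto)

lemma mat_adjoint_adjoint [simp]: "mat_adjoint (mat_adjoint (T :: complex mat)) = T"
  by (rule eq_matI) auto

lemma mat_adjoint_one [simp]: "mat_adjoint (1\<^sub>m n :: complex mat) = 1\<^sub>m n"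
  by (rule eq_matI) auto

text \<open>
  Complete \<open>v\<close> to a basis, orthogonalize by Gram--Schmidt, which keeps the direction of the first
  vector, and normalize the columns.
\<close>

lemma unitary_with_first_column:
  fixes v :: "complex vec"
  assumes v: "v \<in> carrier_vec n" "v \<noteq> 0\<^sub>v n"
  obtains W b where "W \<in> carrier_mat n n" "mat_adjoint W * W = 1\<^sub>m n" "b \<noteq> 0" "col W 0 = b \<cdot>\<^sub>v v"
proof -
  interpret cof_vec_space n "TYPE(complex)" .
  note bc = basis_completion[OF v]
  define ws where "ws = gram_schmidt n (basis_completion v)"
  note gs = gram_schmidt_result[OF bc(2,4,5) ws_def]
  have n: "n > 0" using v by (cases n) auto
  have len: "length ws = n" using gs bc by simp
  have carr: "ws ! i \<in> carrier_vec n" if "i < n" for i using that gs(3) len by auto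
  have hd: "ws ! 0 = v"
  proof -
    from bc(6,7) n obtain vs where "basis_completion v = v # vs"
      by (cases "basis_completion v") auto
    then show ?thesis using gram_schmidt_hd[OF v(1), of vs] len n ws_def
      by (simp add: hd_conv_nth[symmetric] flip: length_greater_0_conv)
  qed
  define nr where "nr i = sqrt (Re (ws ! i \<bullet>c ws ! i))" for i
  have sp: "ws ! i \<bullet>c ws ! j = (if i = j then of_real (nr i)^2 else 0) \<and> (i = j \<longrightarrow> nr i > 0)"
    if ij: "i < n" "j < n" for i j
  proof (cases "i = j")
    case True
    have "ws ! i \<bullet>c ws ! i \<ge> 0" by (rule conjugate_square_ge_0_vec)
    moreover have "ws ! i \<bullet>c ws ! i \<noteq> 0"
      using gs(2) ij len unfolding corthogonal_def by auto
    ultimately have "Re (ws ! i \<bullet>c ws ! i) > 0" "Im (ws ! i \<bullet>c ws ! i) = 0"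
      by (auto simp: less_eq_complex_def complex_eq_iff)
    then show ?thesis using True by (auto simp: nr_def complex_eq_iff simp flip: of_real_power)
  next
    case False then show ?thesis using gs(2) ij len unfolding corthogonal_def by auto
  qed
  define W where "W = mat n n (\<lambda>(i, j). ws ! j $ i / of_real (nr j))"
  have W: "W \<in> carrier_mat n n" by (simp add: W_def)
  have "mat_adjoint W * W = 1\<^sub>m n"
  proof (rule eq_matI)
    fix i j assume "i < dim_row (1\<^sub>m n :: complex mat)" "j < dim_col (1\<^sub>m n :: complex mat)"
    then have ij: "i < n" "j < n" by auto
    have "(mat_adjoint W * W) $$ (i, j) = (\<Sum>k<n. cnj (W $$ (k, i)) * W $$ (k, j))"
      using mat_mult_index[of "mat_adjoint W" n n W n i j] W ij by simp
    also have "\<dots> = (\<Sum>k<n. (ws ! j $ k * cnj (ws ! i $ k)) / (of_real (nr i) * of_real (nr j)))"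
      using ij by (intro sum.cong) (auto simp: W_def)
    also have "\<dots> = (ws ! j \<bullet>c ws ! i) / (of_real (nr i) * of_real (nr j))"
      using carr[OF ij(1)] carr[OF ij(2)]
      by (simp add: scalar_prod_def atLeast0LessThan sum_divide_distrib)
    also have "\<dots> = 1\<^sub>m n $$ (i, j)" using sp[OF ij(2,1)] ij
      by (auto simp: power2_eq_square)
    finally show "(mat_adjoint W * W) $$ (i, j) = 1\<^sub>m n $$ (i, j)" .
  qed (use W in auto)
  moreover have "col W 0 = (1 / of_real (nr 0)) \<cdot>\<^sub>v v"
    using n v hd by (intro eq_vecI) (auto simp: W_def)
  ultimately show ?thesis using that[of W "1 / of_real (nr 0)"] W sp[OF n n] by auto
qed

lemma unitary_right_inverse:
  fixes W :: "complex mat"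
  assumes "W \<in> carrier_mat n n" "mat_adjoint W * W = 1\<^sub>m n"
  shows "W * mat_adjoint W = 1\<^sub>m n"
  using mat_mult_left_right_inverse[of "mat_adjoint W" n W] assms by simp

definition diag_matrix :: "nat \<Rightarrow> (nat \<Rightarrow> complex) \<Rightarrow> complex mat" where
  "diag_matrix n f = mat n n (\<lambda>(i, j). if i = j then f i else 0)"

lemma diag_matrix_carrier [simp]: "diag_matrix n f \<in> carrier_mat n n"
  by (simp add: diag_matrix_def)

lemma four_block_adjoint_11:
  assumes "A \<in> carrier_mat 1 1" "B \<in> carrier_mat m m"
  shows "mat_adjoint (four_block_mat A (0\<^sub>m 1 m) (0\<^sub>m m 1) B :: complex mat)
    = four_block_mat (mat_adjoint A) (0\<^sub>m 1 m) (0\<^sub>m m 1) (mat_adjoint B)"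
  using assms by (intro eq_matI) auto

text \<open>
  The usual induction on the size: a unitary whose first column is an eigenvector conjugates \<open>T\<close> to a
  matrix with first column \<open>(e, 0, \<dots>, 0)\<close>; being Hermitian, that matrix is block diagonal, and the
  remaining block is Hermitian again.
\<close>

theorem hermitian_diagonalization:
  fixes T :: "complex mat"
  assumes "T \<in> carrier_mat n n" "mat_adjoint T = T"
  obtains V lam where "V \<in> carrier_mat n n" "mat_adjoint V * V = 1\<^sub>m n"
    "mat_adjoint V * T * V = diag_matrix n (\<lambda>i. complex_of_real (lam i))"
  using assms
proof (induction n arbitrary: T thesis)
  case 0
  show ?case by (rule 0(1)[of "1\<^sub>m 0" "\<lambda>_. 0"]) (simp_all add: diag_matrix_def mat_eq_iff)
next
  case (Suc m)
  note T = Suc.prems(2) and herm = Suc.prems(3)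
  obtain e v where ev: "v \<in> carrier_vec (Suc m)" "v \<noteq> 0\<^sub>v (Suc m)" "T *\<^sub>v v = e \<cdot>\<^sub>v v"
    using spectrum_non_empty[OF T] T unfolding spectrum_def eigenvalue_def eigenvector_def by auto
  obtain W b where W: "W \<in> carrier_mat (Suc m) (Suc m)" "mat_adjoint W * W = 1\<^sub>m (Suc m)"
    and b: "b \<noteq> 0" "col W 0 = b \<cdot>\<^sub>v v"
    using unitary_with_first_column[OF ev(1,2)] by blast
  define T' where "T' = mat_adjoint W * T * W"
  have T': "T' \<in> carrier_mat (Suc m) (Suc m)" 
    using W T unfolding T'_def by (intro mult_carrier_mat[of _ _ "Suc m"]) auto
  have herm': "mat_adjoint T' = T'"
    using W T herm unfolding T'_def
    by (simp add: mat_adjoint_mult[of _ "Suc m" "Suc m" _ "Suc m"] assoc_mult_mat[of _ "Suc m" "Suc m" _ "Suc m" _ "Suc m"])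
  have herm_ix: "T' $$ (j, i) = cnj (T' $$ (i, j))" if "i < Suc m" "j < Suc m" for i j
    using that T' by (subst herm'[symmetric]) simp
  have col0: "T' $$ (i, 0) = (if i = 0 then e else 0)" if i: "i < Suc m" for i
  proof -
    have "col T' 0 = (mat_adjoint W * T) *\<^sub>v col W 0"
      using W T unfolding T'_def by (intro col_mult2[of _ "Suc m" "Suc m" _ "Suc m"]) auto
    also have "\<dots> = mat_adjoint W *\<^sub>v (T *\<^sub>v col W 0)"
      using W T by (intro assoc_mult_mat_vec[of _ "Suc m" "Suc m" _ "Suc m"]) (auto intro!: carrier_vecI)
    finally have 1: "col T' 0 = mat_adjoint W *\<^sub>v (T *\<^sub>v col W 0)" .
    have 2: "T *\<^sub>v col W 0 = e \<cdot>\<^sub>v col W 0"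
      using T ev b by (simp add: mult_mat_vec smult_smult_assoc mult.commute)
    have 3: "mat_adjoint W *\<^sub>v (e \<cdot>\<^sub>v col W 0) = e \<cdot>\<^sub>v (mat_adjoint W *\<^sub>v col W 0)"
      using W by (intro mult_mat_vec) auto
    have 4: "col (mat_adjoint W * W) 0 = mat_adjoint W *\<^sub>v col W 0"
      using W by (intro col_mult2[of _ "Suc m" "Suc m" _ "Suc m"]) auto
    have "col T' 0 = e \<cdot>\<^sub>v unit_vec (Suc m) 0"
      unfolding 1 2 3 4[symmetric] using W by simp
    then have "col T' 0 $ i = (e \<cdot>\<^sub>v unit_vec (Suc m) 0) $ i" by simp
    then show ?thesis using i T' by auto
  qed
  define e' where "e' = mat 1 1 (\<lambda>_. e)"
  define T2 where "T2 = mat m m (\<lambda>(i, j). T' $$ (Suc i, Suc j))"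
  have e_real: "e = complex_of_real (Re e)"
    using herm_ix[of 0 0] col0[of 0] by (simp add: complex_eq_iff)
  have row0: "T' $$ (0, i) = (if i = 0 then e else 0)" if i: "i < Suc m" for i
    using col0[OF i] herm_ix[OF i, of 0] herm_ix[of 0 0] by (auto split: if_splits)
  have block: "T' = four_block_mat e' (0\<^sub>m 1 m) (0\<^sub>m m 1) T2"
    using T' row0 col0 by (intro eq_matI) (auto simp: e'_def T2_def)
  have T2: "T2 \<in> carrier_mat m m" by (simp add: T2_def)
  have "mat_adjoint T2 = T2"
    by (intro eq_matI) (auto simp: T2_def herm_ix[symmetric])
  then obtain V2 mu where V2: "V2 \<in> carrier_mat m m" "mat_adjoint V2 * V2 = 1\<^sub>m m"
    "mat_adjoint V2 * T2 * V2 = diag_matrix m (\<lambda>i. complex_of_real (mu i))"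
    using Suc.IH[OF _ T2] by blast
  define U where "U = four_block_mat (1\<^sub>m 1) (0\<^sub>m 1 m) (0\<^sub>m m 1) V2"
  have U: "U \<in> carrier_mat (Suc m) (Suc m)"
    using V2 unfolding U_def by (metis four_block_carrier_mat one_carrier_mat plus_1_eq_Suc)
  have U_adj: "mat_adjoint U = four_block_mat (1\<^sub>m 1) (0\<^sub>m 1 m) (0\<^sub>m m 1) (mat_adjoint V2)"
    unfolding U_def using four_block_adjoint_11[of "1\<^sub>m 1" V2 m] V2 by simp
  have UU: "mat_adjoint U * U = 1\<^sub>m (Suc m)"
  proof -
    have "mat_adjoint U * U = four_block_mat (1\<^sub>m 1) (0\<^sub>m 1 m) (0\<^sub>m m 1) (1\<^sub>m m)"
      unfolding U_adj unfolding U_def using V2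
      by (subst mult_four_block_mat[of _ 1 1 _ m _ m _ _ 1 _ m]) auto
    then show ?thesis by (auto intro!: eq_matI)
  qed
  have UTU: "mat_adjoint U * T' * U
      = diag_matrix (Suc m) (\<lambda>i. complex_of_real (case i of 0 \<Rightarrow> Re e | Suc j \<Rightarrow> mu j))"
  proof -
    have e': "e' \<in> carrier_mat 1 1" by (simp add: e'_def)
    have "mat_adjoint U * T' = four_block_mat e' (0\<^sub>m 1 m) (0\<^sub>m m 1) (mat_adjoint V2 * T2)"
      unfolding U_adj block using V2 T2 e'
      by (subst mult_four_block_mat[of _ 1 1 _ m _ m _ _ 1 _ m]) auto
    also have "\<dots> * U = four_block_mat e' (0\<^sub>m 1 m) (0\<^sub>m m 1) (mat_adjoint V2 * T2 * V2)"
      unfolding U_def using V2 T2 e'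
      by (subst mult_four_block_mat[of _ 1 1 _ m _ m _ _ 1 _ m]) auto
    finally show ?thesis unfolding V2(3) using e_real
      by (intro eq_matI) (auto simp: e'_def diag_matrix_def split: nat.splits)
  qed
  show ?case
  proof (rule Suc.prems(1)[of "W * U" "\<lambda>i. case i of 0 \<Rightarrow> Re e | Suc j \<Rightarrow> mu j"])
    show "W * U \<in> carrier_mat (Suc m) (Suc m)" using W U by simp
    have adj: "mat_adjoint (W * U) = mat_adjoint U * mat_adjoint W"
      using W U by (rule_tac mat_adjoint_mult) auto
    have "mat_adjoint (W * U) * (W * U) = mat_adjoint U * (mat_adjoint W * W) * U"
      unfolding adj using W(1) U T
      by (simp add: assoc_mult_mat[of _ "Suc m" "Suc m" _ "Suc m" _ "Suc m"] mult_carrier_mat[of _ "Suc m" "Suc m" _ "Suc m"])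
    then show "mat_adjoint (W * U) * (W * U) = 1\<^sub>m (Suc m)" using W U UU by simp
    have "mat_adjoint (W * U) * T * (W * U) = mat_adjoint U * T' * U"
      unfolding adj T'_def using W(1) U T
      by (simp add: assoc_mult_mat[of _ "Suc m" "Suc m" _ "Suc m" _ "Suc m"] mult_carrier_mat[of _ "Suc m" "Suc m" _ "Suc m"])
    then show "mat_adjoint (W * U) * T * (W * U)
      = diag_matrix (Suc m) (\<lambda>i. complex_of_real (case i of 0 \<Rightarrow> Re e | Suc j \<Rightarrow> mu j))"
      unfolding UTU .
  qed
qed

section \<open>Eigenvalues of a diagonalized matrix\<close>

lemma order_prod_linear:
  fixes a :: "'b \<Rightarrow> 'a :: idom"
  assumes "finite I"
  shows "order t (\<Prod>i\<in>I. [:- a i, 1:]) = card {i\<in>I. a i = t}"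
  using assms
proof (induction I)
  case (insert i I)
  have "order t ([:- a i, 1:] * (\<Prod>i\<in>I. [:- a i, 1:]))
      = order t [:- a i, 1:] + order t (\<Prod>i\<in>I. [:- a i, 1:])"
    using insert(1) by (intro order_mult) (simp del: mult_pCons_left add: prod_zero_iff)
  moreover have "order t [:- a i, 1:] = (if a i = t then 1 else 0)"
    using order_linear_power[of t "- a i" 1] by (auto simp: minus_equation_iff[of "a i"])
  moreover have "{j\<in>insert i I. a j = t} = (if a i = t then insert i {j\<in>I. a j = t} else {j\<in>I. a j = t})"
    by auto
  ultimately show ?case using insert by simp
qed simp

text \<open>
  All eigenvalue data of \<open>T\<close> that occur in the bounds are read off from the sequence \<open>lam\<close>: the
  characteristic polynomial is the product of its linear factors, so algebraic multiplicities count
  repetitions in \<open>lam\<close>.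
\<close>

locale diagonalized =
  fixes n :: nat and T V :: "complex mat" and lam :: "nat \<Rightarrow> real"
  assumes T [simp]: "T \<in> carrier_mat n n" and V [simp]: "V \<in> carrier_mat n n"
    and unitary: "mat_adjoint V * V = 1\<^sub>m n"
    and diagonal: "mat_adjoint V * T * V = diag_matrix n (\<lambda>i. complex_of_real (lam i))"
begin

lemma reconstruct: "T = V * diag_matrix n (\<lambda>i. complex_of_real (lam i)) * mat_adjoint V"
proof -
  have "V * (mat_adjoint V * T * V) * mat_adjoint V = (V * mat_adjoint V) * T * (V * mat_adjoint V)"
    by (simp add: assoc_mult_mat[of _ n n _ n _ n] mult_carrier_mat[of _ n n _ n])
  then show ?thesis
    unfolding diagonal unitary_right_inverse[OF V unitary]
    using left_mult_one_mat[OF T] right_mult_one_mat[OF T] by simp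
qed

lemma char_poly_eq: "char_poly T = (\<Prod>i<n. [:- complex_of_real (lam i), 1:])"
proof -
  let ?D = "diag_matrix n (\<lambda>i. complex_of_real (lam i))"
  have "similar_mat T ?D"
    unfolding similar_mat_def similar_mat_wit_def Let_def
    by (rule exI[of _ V], rule exI[of _ "mat_adjoint V"])
      (use unitary unitary_right_inverse[OF V unitary] reconstruct carrier_matD[OF T] carrier_matD[OF V]
         mat_adjoint_carrier[OF V] in auto)
  then have "char_poly T = char_poly ?D" by (rule char_poly_similar)
  also have "\<dots> = (\<Prod>a\<leftarrow>diag_mat ?D. [:- a, 1:])"
    by (rule char_poly_upper_triangular[of _ n]) (auto simp: diag_matrix_def)
  also have "diag_mat ?D = map (\<lambda>i. complex_of_real (lam i)) [0..<n]"
    by (auto simp: diag_mat_def diag_matrix_def)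
  finally show ?thesis
    by (simp add: comp_def prod.distinct_set_conv_list[symmetric] atLeast0LessThan)
qed

lemma eig_mult_eq: "eig_mult T t = card {i\<in>{..<n}. lam i = t}"
  unfolding eig_mult_def char_poly_eq by (subst order_prod_linear) auto

lemma real_eigenvalues_eq: "real_eigenvalues T = lam ` {..<n}"
  unfolding real_eigenvalues_def eigenvalue_root_char_poly[OF T] char_poly_eq
  by (auto simp: poly_prod)

lemma eig_max_ge: "i < n \<Longrightarrow> lam i \<le> eig_max T"
  unfolding eig_max_def real_eigenvalues_eq by (intro Max_ge) auto

lemma eig_min_le: "i < n \<Longrightarrow> eig_min T \<le> lam i"
  unfolding eig_min_def real_eigenvalues_eq by (intro Min_le) auto

lemma eig_max_attained:
  assumes "n > 0"
  shows "\<exists>i<n. lam i = eig_max T"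
proof -
  have "Max (lam ` {..<n}) \<in> lam ` {..<n}" using assms by (intro Max_in) auto
  then show ?thesis unfolding eig_max_def real_eigenvalues_eq by auto
qed

lemma eig_min_attained:
  assumes "n > 0"
  shows "\<exists>i<n. lam i = eig_min T"
proof -
  have "Min (lam ` {..<n}) \<in> lam ` {..<n}" using assms by (intro Min_in) auto
  then show ?thesis unfolding eig_min_def real_eigenvalues_eq by auto
qed

lemma sum_by_multiplicity:
  fixes g :: "real \<Rightarrow> 'c :: comm_semiring_1"
  shows "(\<Sum>t\<in>{t\<in>real_eigenvalues T. Q t}. of_nat (eig_mult T t) * g t) = (\<Sum>i | i < n \<and> Q (lam i). g (lam i))"
proof -
  let ?I = "{i. i < n \<and> Q (lam i)}"
  have "(\<Sum>i\<in>?I. g (lam i)) = (\<Sum>t\<in>lam ` ?I. \<Sum>i\<in>{i\<in>?I. lam i = t}. g (lam i))"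
    by (rule sum.image_gen) simp
  also have "\<dots> = (\<Sum>t\<in>lam ` ?I. of_nat (eig_mult T t) * g t)"
  proof (rule sum.cong)
    fix t assume "t \<in> lam ` ?I"
    then have "{i\<in>?I. lam i = t} = {i\<in>{..<n}. lam i = t}" by auto
    then show "(\<Sum>i\<in>{i\<in>?I. lam i = t}. g (lam i)) = of_nat (eig_mult T t) * g t"
      by (simp add: eig_mult_eq)
  qed simp
  also have "lam ` ?I = {t\<in>real_eigenvalues T. Q t}"
    by (auto simp: real_eigenvalues_eq)
  finally show ?thesis by simp
qed

lemma pos_square_sum_eq: "pos_square_sum T = (\<Sum>i | i < n \<and> lam i > 0. (lam i)\<^sup>2)"
  unfolding pos_square_sum_def by (rule sum_by_multiplicity)

lemma neg_square_sum_eq: "neg_square_sum T = (\<Sum>i | i < n \<and> lam i < 0. (lam i)\<^sup>2)"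
  unfolding neg_square_sum_def by (rule sum_by_multiplicity)

lemma pos_count_eq: "pos_count T = card {i. i < n \<and> lam i > 0}"
  using sum_by_multiplicity[where Q = "\<lambda>t. t > 0" and g = "\<lambda>_. 1 :: nat"] by (simp add: pos_count_def)

lemma neg_count_eq: "neg_count T = card {i. i < n \<and> lam i < 0}"
  using sum_by_multiplicity[where Q = "\<lambda>t. t < 0" and g = "\<lambda>_. 1 :: nat"] by (simp add: neg_count_def)

end

lemma hermitian_diagonalized:
  assumes "T \<in> carrier_mat n n" "mat_adjoint T = T"
  obtains V lam where "diagonalized n T V lam"
proof -
  obtain V lam where "V \<in> carrier_mat n n" "mat_adjoint V * V = 1\<^sub>m n"
    "mat_adjoint V * T * V = diag_matrix n (\<lambda>i. complex_of_real (lam i))"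
    by (rule hermitian_diagonalization[OF assms])
  then show ?thesis by (intro that[of V lam] diagonalized.intro assms(1))
qed

section \<open>Quadratic forms and the pinching inequality\<close>

text \<open>
  \<open>sesq n T u w\<close> is \<open>u\<^sup>* T w\<close>. Vectors are functions, so that no dimension conditions arise when they
  are restricted, embedded into \<open>\<complex>\<^sup>d \<otimes> \<complex>\<^sup>k\<close> or summed.
\<close>

definition sesq :: "nat \<Rightarrow> complex mat \<Rightarrow> (nat \<Rightarrow> complex) \<Rightarrow> (nat \<Rightarrow> complex) \<Rightarrow> complex" where
  "sesq n T u w = (\<Sum>i<n. \<Sum>j<n. cnj (u i) * T $$ (i, j) * w j)"

lemma sesq_diff_square:
  "sesq n T (\<lambda>i. u i - w i) (\<lambda>i. u i - w i) = sesq n T u u - sesq n T u w - sesq n T w u + sesq n T w w"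
  unfolding sesq_def sum.distrib[symmetric] sum_subtractf[symmetric]
  by (intro sum.cong refl) (simp add: algebra_simps)

lemma sesq_sum:
  "sesq n T (\<lambda>i. \<Sum>a\<in>I. u a i) (\<lambda>i. \<Sum>b\<in>J. w b i) = (\<Sum>a\<in>I. \<Sum>b\<in>J. sesq n T (u a) (w b))"
proof -
  have "sesq n T (\<lambda>i. \<Sum>a\<in>I. u a i) (\<lambda>i. \<Sum>b\<in>J. w b i)
      = (\<Sum>i<n. \<Sum>j<n. \<Sum>a\<in>I. \<Sum>b\<in>J. cnj (u a i) * T $$ (i, j) * w b j)"
    by (simp add: sesq_def sum_distrib_left sum_distrib_right sum.swap[of _ I J])
  also have "\<dots> = (\<Sum>a\<in>I. \<Sum>b\<in>J. \<Sum>i<n. \<Sum>j<n. cnj (u a i) * T $$ (i, j) * w b j)"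
    by (simp only: sum.swap[of _ "{..<n}" I] sum.swap[of _ "{..<n}" J])
  finally show ?thesis by (simp add: sesq_def)
qed

lemma sesq_congruence:
  assumes T: "T \<in> carrier_mat n n" and P: "P \<in> carrier_mat n n"
  shows "sesq n T (\<lambda>i. \<Sum>k<n. P $$ (i, k) * w k) (\<lambda>i. \<Sum>k<n. P $$ (i, k) * w k)
    = sesq n (mat_adjoint P * T * P) w w"
proof -
  have ix: "(mat_adjoint P * T * P) $$ (k, l) = (\<Sum>j<n. (\<Sum>i<n. cnj (P $$ (i, k)) * T $$ (i, j)) * P $$ (j, l))"
    if "k < n" "l < n" for k l
  proof -
    have "(mat_adjoint P * T * P) $$ (k, l) = (\<Sum>j<n. (mat_adjoint P * T) $$ (k, j) * P $$ (j, l))"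
      by (rule mat_mult_index) (use T P that in \<open>auto intro: mult_carrier_mat[of _ n n]\<close>)
    also have "\<dots> = (\<Sum>j<n. (\<Sum>i<n. mat_adjoint P $$ (k, i) * T $$ (i, j)) * P $$ (j, l))"
      by (intro sum.cong refl) (subst mat_mult_index[OF mat_adjoint_carrier[OF P] T], use that in auto)
    also have "\<dots> = (\<Sum>j<n. (\<Sum>i<n. cnj (P $$ (i, k)) * T $$ (i, j)) * P $$ (j, l))"
      using P that by (intro sum.cong refl arg_cong2[where f = "(*)"]) auto
    finally show ?thesis .
  qed
  have "sesq n T (\<lambda>i. \<Sum>k<n. P $$ (i, k) * w k) (\<lambda>i. \<Sum>k<n. P $$ (i, k) * w k)
     = (\<Sum>k<n. \<Sum>l<n. sesq n T (\<lambda>i. P $$ (i, k) * w k) (\<lambda>i. P $$ (i, l) * w l))"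
    by (rule sesq_sum)
  also have "\<dots> = (\<Sum>k<n. \<Sum>l<n. cnj (w k) * (mat_adjoint P * T * P) $$ (k, l) * w l)"
  proof (intro sum.cong refl)
    fix k l assume "k \<in> {..<n}" "l \<in> {..<n}"
    then have kl: "k < n" "l < n" by auto
    have "sesq n T (\<lambda>i. P $$ (i, k) * w k) (\<lambda>i. P $$ (i, l) * w l)
       = (\<Sum>i<n. \<Sum>j<n. cnj (w k) * (cnj (P $$ (i, k)) * T $$ (i, j) * P $$ (j, l)) * w l)"
      unfolding sesq_def by (intro sum.cong refl) simp
    also have "\<dots> = (\<Sum>j<n. \<Sum>i<n. cnj (w k) * (cnj (P $$ (i, k)) * T $$ (i, j) * P $$ (j, l)) * w l)"
      by (rule sum.swap)
    also have "\<dots> = cnj (w k) * (mat_adjoint P * T * P) $$ (k, l) * w l"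
      unfolding ix[OF kl] by (simp add: sum_distrib_left sum_distrib_right mult.assoc)
    finally show "sesq n T (\<lambda>i. P $$ (i, k) * w k) (\<lambda>i. P $$ (i, l) * w l)
        = cnj (w k) * (mat_adjoint P * T * P) $$ (k, l) * w l" .
  qed
  finally show ?thesis by (simp add: sesq_def)
qed

lemma sesq_diag: "sesq n (diag_matrix n f) u u = (\<Sum>i<n. f i * (u i * cnj (u i)))"
proof -
  have "sesq n (diag_matrix n f) u u = (\<Sum>i<n. \<Sum>j<n. if j = i then f i * (u i * cnj (u i)) else 0)"
    unfolding sesq_def by (intro sum.cong refl) (auto simp: diag_matrix_def)
  then show ?thesis by simp
qed

lemma sesq_one: "sesq n (1\<^sub>m n) u u = (\<Sum>i<n. u i * cnj (u i))"
proof -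
  have "1\<^sub>m n = diag_matrix n (\<lambda>_. 1)" by (rule eq_matI) (auto simp: diag_matrix_def)
  then show ?thesis by (simp add: sesq_diag)
qed

lemma sesq_add:
  "T \<in> carrier_mat n n \<Longrightarrow> T' \<in> carrier_mat n n \<Longrightarrow> sesq n (T + T') u w = sesq n T u w + sesq n T' u w"
  unfolding sesq_def sum.distrib[symmetric] by (intro sum.cong refl) (simp add: algebra_simps)

lemma sesq_smult: "T \<in> carrier_mat n n \<Longrightarrow> sesq n (s \<cdot>\<^sub>m T) u w = s * sesq n T u w"
  by (simp add: sesq_def sum_distrib_left algebra_simps)

context diagonalized
begin

text \<open>
  Conjugating by \<open>V\<close> turns the form of \<open>s + t T\<close> into a weighted sum of squares. Hence the extreme
  eigenvalues bound the form, which is how \<open>\<lambda>\<^sub>m\<^sub>a\<^sub>x - T\<close> and \<open>T - \<lambda>\<^sub>m\<^sub>i\<^sub>n\<close> become positive.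
\<close>

lemma sesq_shifted:
  "Re (sesq n (complex_of_real s \<cdot>\<^sub>m 1\<^sub>m n + complex_of_real t \<cdot>\<^sub>m T) u u)
    = (\<Sum>i<n. (s + t * lam i) * (cmod (\<Sum>k<n. cnj (V $$ (k, i)) * u k))\<^sup>2)"
proof -
  define y where "y = (\<lambda>i. \<Sum>k<n. mat_adjoint V $$ (i, k) * u k)"
  have y: "y i = (\<Sum>k<n. cnj (V $$ (k, i)) * u k)" if "i < n" for i
    unfolding y_def using that carrier_matD[OF V] by (intro sum.cong) auto
  have "sesq n T u u = sesq n (diag_matrix n (\<lambda>i. complex_of_real (lam i))) y y"
    using sesq_congruence[OF diag_matrix_carrier mat_adjoint_carrier[OF V], of "\<lambda>i. complex_of_real (lam i)" u]
    unfolding y_def mat_adjoint_adjoint reconstruct[symmetric] by (rule sym)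
  moreover have "sesq n (1\<^sub>m n) u u = sesq n (1\<^sub>m n) y y"
    using sesq_congruence[OF one_carrier_mat mat_adjoint_carrier[OF V], of u]
    unfolding y_def mat_adjoint_adjoint right_mult_one_mat[OF V] unitary_right_inverse[OF V unitary]
    by (rule sym)
  ultimately have "sesq n (complex_of_real s \<cdot>\<^sub>m 1\<^sub>m n + complex_of_real t \<cdot>\<^sub>m T) u u
      = (\<Sum>i<n. complex_of_real ((s + t * lam i) * (cmod (y i))\<^sup>2))"
    unfolding sesq_add[OF smult_carrier_mat[OF one_carrier_mat] smult_carrier_mat[OF T]]
      sesq_smult[OF one_carrier_mat] sesq_smult[OF T]
    by (simp only: sesq_one sesq_diag sum_distrib_left sum.distrib[symmetric]
        complex_norm_square distrib_right mult.assoc of_real_mult of_real_add)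
  then have "Re (sesq n (complex_of_real s \<cdot>\<^sub>m 1\<^sub>m n + complex_of_real t \<cdot>\<^sub>m T) u u)
      = (\<Sum>i<n. (s + t * lam i) * (cmod (y i))\<^sup>2)" by simp
  also have "\<dots> = (\<Sum>i<n. (s + t * lam i) * (cmod (\<Sum>k<n. cnj (V $$ (k, i)) * u k))\<^sup>2)"
    by (intro sum.cong refl) (simp add: y)
  finally show ?thesis .
qed

lemma sesq_shifted_nonneg:
  assumes "\<And>i. i < n \<Longrightarrow> s + t * lam i \<ge> 0"
  shows "Re (sesq n (complex_of_real s \<cdot>\<^sub>m 1\<^sub>m n + complex_of_real t \<cdot>\<^sub>m T) u u) \<ge> 0"
  unfolding sesq_shifted using assms by (intro sum_nonneg) auto

lemma eigenvector_form:
  assumes "l < n"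
  shows "sesq n T (\<lambda>i. V $$ (i, l)) (\<lambda>i. V $$ (i, l)) = complex_of_real (lam l)"
    "sesq n (1\<^sub>m n) (\<lambda>i. V $$ (i, l)) (\<lambda>i. V $$ (i, l)) = 1"
proof -
  define e :: "nat \<Rightarrow> complex" where "e k = (if k = l then 1 else 0)" for k
  have V_e: "(\<lambda>i. \<Sum>k<n. V $$ (i, k) * e k) = (\<lambda>i. V $$ (i, l))"
  proof
    fix i
    have "(\<Sum>k<n. V $$ (i, k) * e k) = (\<Sum>k<n. if k = l then V $$ (i, k) else 0)"
      by (intro sum.cong) (auto simp: e_def)
    then show "(\<Sum>k<n. V $$ (i, k) * e k) = V $$ (i, l)" using assms by simp
  qed
  have e_sum: "(\<Sum>i<n. f i * (e i * cnj (e i))) = f l" for f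
  proof -
    have "(\<Sum>i<n. f i * (e i * cnj (e i))) = (\<Sum>i<n. if i = l then f i else 0)"
      by (intro sum.cong) (auto simp: e_def)
    then show ?thesis using assms by simp
  qed
  show "sesq n T (\<lambda>i. V $$ (i, l)) (\<lambda>i. V $$ (i, l)) = complex_of_real (lam l)"
    using sesq_congruence[OF T V, of e] unfolding V_e diagonal sesq_diag e_sum .
  show "sesq n (1\<^sub>m n) (\<lambda>i. V $$ (i, l)) (\<lambda>i. V $$ (i, l)) = 1"
    using sesq_congruence[OF one_carrier_mat V, of e] unfolding V_e
    unfolding right_mult_one_mat[OF mat_adjoint_carrier[OF V]] unitary
    using e_sum[of "\<lambda>_. 1"] by (simp add: sesq_one)
qed

end

text \<open>
  A positive form satisfies \<open>q (\<Sum>\<^sub>a w\<^sub>a) \<le> c \<Sum>\<^sub>a q (w\<^sub>a)\<close> for \<open>c\<close> summands, because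
  \<open>\<Sum>\<^sub>a\<^sub>b q (w\<^sub>a - w\<^sub>b) \<ge> 0\<close>. Taking \<open>w\<^sub>a = P\<^sub>a w\<close> compares \<open>T\<close> with its pinching \<open>\<Sum>\<^sub>a P\<^sub>a T P\<^sub>a\<close>.
\<close>

lemma pinching_inequality:
  assumes T: "T \<in> carrier_mat n n" and psd: "\<And>u. Re (sesq n T u u) \<ge> 0"
    and P: "\<And>a. a < c \<Longrightarrow> P a \<in> carrier_mat n n" "\<And>a. a < c \<Longrightarrow> mat_adjoint (P a) = P a"
    and one: "\<And>i j. i < n \<Longrightarrow> j < n \<Longrightarrow> (\<Sum>a<c. P a $$ (i, j)) = (if i = j then 1 else 0)"
  shows "Re (sesq n T w w) \<le> real c * (\<Sum>a<c. Re (sesq n (P a * T * P a) w w))"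
proof -
  define u where "u a i = (\<Sum>k<n. P a $$ (i, k) * w k)" for a i
  define f where "f a b = Re (sesq n T (u a) (u b))" for a b
  have total: "(\<Sum>a<c. u a i) = w i" if "i < n" for i
  proof -
    have "(\<Sum>a<c. u a i) = (\<Sum>k<n. (\<Sum>a<c. P a $$ (i, k)) * w k)"
      unfolding u_def by (subst sum.swap) (simp add: sum_distrib_right)
    also have "\<dots> = (\<Sum>k<n. if i = k then w k else 0)"
      using one[OF that] by (intro sum.cong refl) auto
    finally show ?thesis using that by simp
  qed
  have "sesq n T w w = sesq n T (\<lambda>i. \<Sum>a<c. u a i) (\<lambda>i. \<Sum>a<c. u a i)"
    unfolding sesq_def by (intro sum.cong refl) (simp add: total)
  then have w: "Re (sesq n T w w) = (\<Sum>a<c. \<Sum>b<c. f a b)"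
    by (simp add: sesq_sum f_def)
  have "0 \<le> (\<Sum>a<c. \<Sum>b<c. f a a - f a b - f b a + f b b)"
  proof (intro sum_nonneg)
    fix a b
    show "0 \<le> f a a - f a b - f b a + f b b"
      using psd[of "\<lambda>i. u a i - u b i"] unfolding sesq_diff_square by (simp add: f_def)
  qed
  also have "\<dots> = 2 * (real c * (\<Sum>a<c. f a a)) - 2 * (\<Sum>a<c. \<Sum>b<c. f a b)"
    using sum.swap[of "\<lambda>a b. f b a" "{..<c}" "{..<c}"]
    by (simp add: sum.distrib sum_subtractf sum_distrib_left sum_negf)
  finally have "(\<Sum>a<c. \<Sum>b<c. f a b) \<le> real c * (\<Sum>a<c. f a a)" by simp
  moreover have "f a a = Re (sesq n (P a * T * P a) w w)" if "a < c" for a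
    unfolding f_def u_def using sesq_congruence[OF T P(1)[OF that]] P(2)[OF that] by simp
  ultimately show ?thesis unfolding w by simp
qed

section \<open>Symmetric stochastic weights\<close>

text \<open>
  Suppose that Hermitian idempotents \<open>P\<^sub>a\<close> sum to \<open>1\<close> and that \<open>P\<^sub>a H P\<^sub>a = 0\<close>. In an eigenbasis of \<open>H\<close>
  the numbers \<open>W\<^sub>i\<^sub>j = \<Sum>\<^sub>a \<bar>(P\<^sub>a)\<^sub>i\<^sub>j\<bar>\<^sup>2\<close> form a symmetric doubly stochastic matrix that annihilates the
  vector \<open>lam\<close> of eigenvalues. Its diagonal is bounded below by \<open>1 / c\<close>, since the \<open>c\<close> numbers
  \<open>(P\<^sub>a)\<^sub>i\<^sub>i\<close> sum to \<open>1\<close>. These properties alone give the bound on the sums of squares.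
\<close>

locale pinching_weights =
  fixes n :: nat and c :: real and W :: "nat \<Rightarrow> nat \<Rightarrow> real" and lam :: "nat \<Rightarrow> real"
  assumes c: "c \<ge> 1"
    and nonneg: "\<And>i j. i < n \<Longrightarrow> j < n \<Longrightarrow> W i j \<ge> 0"
    and sym: "\<And>i j. i < n \<Longrightarrow> j < n \<Longrightarrow> W i j = W j i"
    and row: "\<And>i. i < n \<Longrightarrow> (\<Sum>j<n. W i j) = 1"
    and diag: "\<And>i. i < n \<Longrightarrow> 1 \<le> c * W i i"
    and null: "\<And>i. i < n \<Longrightarrow> (\<Sum>j<n. W i j * lam j) = 0"
begin

lemma le_weighted_sum:
  assumes "i < n" "\<And>j. j < n \<Longrightarrow> f j \<ge> 0"
  shows "f i \<le> c * (\<Sum>j<n. W i j * f j)"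
proof -
  have "f i \<le> c * W i i * f i"
    using mult_right_mono[OF diag[OF assms(1)] assms(2)[OF assms(1)]] by simp
  also have "W i i * f i \<le> (\<Sum>j<n. W i j * f j)"
    by (rule member_le_sum) (use assms nonneg in auto)
  then have "c * W i i * f i \<le> c * (\<Sum>j<n. W i j * f j)"
    using c by (simp add: mult.assoc)
  finally show ?thesis .
qed

text \<open>
  A symmetric stochastic matrix is a contraction, by \<open>2 f\<^sub>i f\<^sub>j \<le> f\<^sub>i\<^sup>2 + f\<^sub>j\<^sup>2\<close>.
\<close>

lemma form_le: "(\<Sum>i<n. f i * (\<Sum>j<n. W i j * f j)) \<le> (\<Sum>i<n. (f i)\<^sup>2)"
proof -
  have "(\<Sum>i<n. f i * (\<Sum>j<n. W i j * f j)) = (\<Sum>i<n. \<Sum>j<n. W i j * (f i * f j))"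
    by (simp add: sum_distrib_left mult_ac)
  also have "\<dots> \<le> (\<Sum>i<n. \<Sum>j<n. W i j * (((f i)\<^sup>2 + (f j)\<^sup>2) / 2))"
  proof (intro sum_mono mult_left_mono)
    fix i j
    have "0 \<le> (f i - f j)\<^sup>2" by simp
    then show "f i * f j \<le> ((f i)\<^sup>2 + (f j)\<^sup>2) / 2"
      by (simp add: power2_diff)
  qed (use nonneg in auto)
  also have "\<dots> = ((\<Sum>i<n. \<Sum>j<n. W i j * (f i)\<^sup>2) + (\<Sum>i<n. \<Sum>j<n. W i j * (f j)\<^sup>2)) / 2"
    by (simp add: add_divide_distrib sum.distrib distrib_left sum_divide_distrib[symmetric])
  also have "(\<Sum>i<n. \<Sum>j<n. W i j * (f j)\<^sup>2) = (\<Sum>i<n. \<Sum>j<n. W i j * (f i)\<^sup>2)"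
    by (subst sum.swap) (intro sum.cong refl, use sym in auto)
  also have "(\<Sum>i<n. \<Sum>j<n. W i j * (f i)\<^sup>2) = (\<Sum>i<n. (f i)\<^sup>2)"
    using row by (simp add: sum_distrib_right[symmetric])
  finally show ?thesis by simp
qed

lemma trivial_if_one:
  assumes "c = 1" "i < n"
  shows "lam i = 0"
proof -
  have "(\<Sum>j\<in>{..<n} - {i}. W i j) = 1 - W i i"
    using row[OF assms(2)] sum.remove[of "{..<n}" i "W i"] assms by simp
  moreover have "(\<Sum>j\<in>{..<n} - {i}. W i j) \<ge> 0" using nonneg assms by (intro sum_nonneg) auto
  ultimately have s: "W i i = 1" "(\<Sum>j\<in>{..<n} - {i}. W i j) = 0"
    using diag[OF assms(2)] assms(1) by auto
  from s(2) have "\<forall>j\<in>{..<n} - {i}. W i j = 0"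
    using nonneg assms by (subst (asm) sum_nonneg_eq_0_iff) auto
  then have "(\<Sum>j\<in>{..<n} - {i}. W i j * lam j) = 0" by (intro sum.neutral) auto
  then show ?thesis
    using null[OF assms(2)] sum.remove[of "{..<n}" i "\<lambda>j. W i j * lam j"] assms s by simp
qed

text \<open>
  Split \<open>lam = b - g\<close> into positive and negative parts and let \<open>d = b\<^sup>T W b\<close>. Since \<open>W b = W g\<close>, also
  \<open>b\<^sup>T W g = g\<^sup>T W g = d\<close>. The diagonal bound gives \<open>\<parallel>b\<parallel>\<^sup>2 \<le> c d\<close>. As \<open>W\<close> is a contraction and
  \<open>b\<close>, \<open>g\<close> have disjoint supports, \<open>c\<^sup>2 d = (b + (c - 1) g)\<^sup>T W (b + (c - 1) g) \<le> \<parallel>b\<parallel>\<^sup>2 + (c - 1)\<^sup>2 \<parallel>g\<parallel>\<^sup>2\<close>.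
  Eliminating \<open>d\<close> leaves \<open>\<parallel>b\<parallel>\<^sup>2 \<le> (c - 1) \<parallel>g\<parallel>\<^sup>2\<close>, provided that \<open>c > 1\<close>; for \<open>c = 1\<close> the matrix
  \<open>W\<close> is the identity and \<open>lam\<close> vanishes.
\<close>

lemma square_sum_le:
  "(\<Sum>i | i < n \<and> lam i > 0. (lam i)\<^sup>2) \<le> (c - 1) * (\<Sum>i | i < n \<and> lam i < 0. (lam i)\<^sup>2)"
proof (cases "c = 1")
  case True
  then show ?thesis using trivial_if_one by (simp cong: conj_cong)
next
  case False
  define b where "b i = max (lam i) 0" for i
  define g where "g i = max (- lam i) 0" for i
  define ip where "ip f h = (\<Sum>i<n. f i * (\<Sum>j<n. W i j * h j))" for f h :: "nat \<Rightarrow> real"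
  have lam: "lam i = b i - g i" and bg: "b i * g i = 0" for i
    by (auto simp: b_def g_def max_def)
  have eqW: "(\<Sum>j<n. W i j * b j) = (\<Sum>j<n. W i j * g j)" if "i < n" for i
    using null[OF that] by (simp add: lam right_diff_distrib sum_subtractf)
  have ip_eq: "ip f b = ip f g" for f
    unfolding ip_def by (intro sum.cong refl) (use eqW in auto)
  have ip_sym: "ip f h = ip h f" for f h
  proof -
    have "ip f h = (\<Sum>i<n. \<Sum>j<n. W i j * f i * h j)"
      by (simp add: ip_def sum_distrib_left mult_ac)
    also have "\<dots> = (\<Sum>j<n. \<Sum>i<n. W i j * f i * h j)" by (rule sum.swap)
    also have "\<dots> = (\<Sum>j<n. \<Sum>i<n. W j i * f i * h j)"
      by (intro sum.cong refl) (use sym in auto)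
    finally show ?thesis by (simp add: ip_def sum_distrib_left mult_ac)
  qed
  define d where "d = ip b b"
  have d: "ip b g = d" "ip g b = d" "ip g g = d"
    using ip_eq[of b] ip_eq[of g] ip_sym[of b g] by (simp_all add: d_def)
  have pos: "(\<Sum>i | i < n \<and> lam i > 0. (lam i)\<^sup>2) = (\<Sum>i<n. (b i)\<^sup>2)"
    by (intro sum.mono_neutral_cong_left) (auto simp: b_def max_def)
  have neg: "(\<Sum>i | i < n \<and> lam i < 0. (lam i)\<^sup>2) = (\<Sum>i<n. (g i)\<^sup>2)"
    by (intro sum.mono_neutral_cong_left) (auto simp: g_def max_def)
  let ?B = "\<Sum>i<n. (b i)\<^sup>2" and ?G = "\<Sum>i<n. (g i)\<^sup>2"
  have B: "?B \<le> c * d"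
  proof -
    have "?B = (\<Sum>i<n. b i * b i)" by (simp add: power2_eq_square)
    also have "\<dots> \<le> (\<Sum>i<n. b i * (c * (\<Sum>j<n. W i j * b j)))"
      by (intro sum_mono mult_left_mono le_weighted_sum) (auto simp: b_def)
    also have "\<dots> = c * d" by (simp add: d_def ip_def sum_distrib_left mult_ac)
    finally show ?thesis .
  qed
  have "c\<^sup>2 * d = ip (\<lambda>i. b i + (c - 1) * g i) (\<lambda>i. b i + (c - 1) * g i)"
  proof -
    have add: "ip f (\<lambda>i. h i + (c - 1) * k i) = ip f h + (c - 1) * ip f k" for f h k
      by (simp add: ip_def distrib_left sum.distrib sum_distrib_left mult_ac)
    have "ip (\<lambda>i. b i + (c - 1) * g i) (\<lambda>i. b i + (c - 1) * g i)
        = ip (\<lambda>i. b i + (c - 1) * g i) b + (c - 1) * ip (\<lambda>i. b i + (c - 1) * g i) g"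
      by (rule add)
    also have "ip (\<lambda>i. b i + (c - 1) * g i) b = ip b b + (c - 1) * ip b g"
      unfolding ip_sym[of "\<lambda>i. b i + (c - 1) * g i"] by (rule add)
    also have "ip (\<lambda>i. b i + (c - 1) * g i) g = ip g b + (c - 1) * ip g g"
      unfolding ip_sym[of "\<lambda>i. b i + (c - 1) * g i"] by (rule add)
    finally show ?thesis unfolding d d_def[symmetric] by (simp add: power2_eq_square algebra_simps)
  qed
  also have "\<dots> \<le> (\<Sum>i<n. (b i + (c - 1) * g i)\<^sup>2)"
    unfolding ip_def by (rule form_le)
  also have "\<dots> = ?B + (c - 1)\<^sup>2 * ?G"
  proof -
    have "(b i + (c - 1) * g i)\<^sup>2 = (b i)\<^sup>2 + (c - 1)\<^sup>2 * (g i)\<^sup>2" for i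
      using bg[of i] by (auto simp: power2_eq_square algebra_simps)
    then show ?thesis by (simp add: sum.distrib sum_distrib_left)
  qed
  finally have "c\<^sup>2 * d \<le> ?B + (c - 1)\<^sup>2 * ?G" .
  moreover have "c * ?B \<le> c\<^sup>2 * d"
    using mult_left_mono[OF B, of c] c by (simp add: power2_eq_square mult.assoc)
  ultimately have "(c - 1) * ?B \<le> (c - 1) * ((c - 1) * ?G)"
    by (simp add: power2_eq_square algebra_simps)
  then show ?thesis unfolding pos neg using c False by simp
qed

end

section \<open>Inertia\<close>

text \<open>
  Fewer homogeneous linear equations than unknowns: padding the system with zero rows gives a singular
  square matrix.
\<close>

lemma nontrivial_solution:
  fixes r :: "'b \<Rightarrow> nat \<Rightarrow> complex"
  assumes "finite R" "card R < n"
  obtains z where "\<exists>i<n. z i \<noteq> 0" "\<And>b. b \<in> R \<Longrightarrow> (\<Sum>j<n. r b j * z j) = 0"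
proof -
  obtain bs where bs: "set bs = R" "length bs = card R"
    using finite_distinct_list[OF assms(1)] distinct_card by metis
  define M where "M = mat n n (\<lambda>(i, j). if i < length bs then r (bs ! i) j else 0)"
  have M: "M \<in> carrier_mat n n" by (simp add: M_def)
  have "M = mat\<^sub>r n n (\<lambda>i. if i = n - 1 then 0\<^sub>v n else row M i)"
    using assms bs by (intro eq_matI) (auto simp: M_def)
  moreover have "det (mat\<^sub>r n n (\<lambda>i. if i = n - 1 then 0\<^sub>v n else row M i)) = 0"
    using assms M by (intro det_row_0) auto
  ultimately have "det M = 0" by simp
  then obtain v where v: "v \<in> carrier_vec n" "v \<noteq> 0\<^sub>v n" "M *\<^sub>v v = 0\<^sub>v n"
    using det_0_iff_vec_prod_zero_field[OF M] by auto
  show ?thesis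
  proof (rule that[of "\<lambda>i. v $ i"])
    show "\<exists>i<n. v $ i \<noteq> 0" using v by (metis carrier_vecD eq_vecI index_zero_vec)
    fix b assume "b \<in> R"
    then obtain i where i: "i < length bs" "bs ! i = b" using bs by (metis in_set_conv_nth)
    have "i < n" using i(1) bs assms by simp
    have "(M *\<^sub>v v) $ i = (\<Sum>j<n. M $$ (i, j) * v $ j)"
      using v(1) M \<open>i < n\<close> by (auto simp: scalar_prod_def atLeast0LessThan)
    also have "\<dots> = (\<Sum>j<n. r b j * v $ j)"
      using i \<open>i < n\<close> by (intro sum.cong) (auto simp: M_def)
    finally show "(\<Sum>j<n. r b j * v $ j) = 0" using v(3) \<open>i < n\<close> by simp
  qed
qed

text \<open>
  If the inequality failed, fewer than \<open>n\<close> linear conditions would force some \<open>z \<noteq> 0\<close> to be supported on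
  the positive indices while the negative coordinates of \<open>y\<^sub>a = p\<^sub>a z\<close> are the same for all \<open>a\<close>. As the
  \<open>y\<^sub>a\<close> sum to \<open>z\<close>, these common coordinates are zero. Then \<open>0 = y\<^sub>a\<^sup>* \<Lambda> y\<^sub>a\<close> is a sum of nonnegative terms,
  so the positive coordinates of every \<open>y\<^sub>a\<close> vanish too, and \<open>z = \<Sum>\<^sub>a y\<^sub>a = 0\<close>.
\<close>

lemma inertia_bound:
  fixes p :: "nat \<Rightarrow> nat \<Rightarrow> nat \<Rightarrow> complex" and lam :: "nat \<Rightarrow> real"
  assumes herm: "\<And>a i j. a < c \<Longrightarrow> i < n \<Longrightarrow> j < n \<Longrightarrow> p a j i = cnj (p a i j)"
    and one: "\<And>i j. i < n \<Longrightarrow> j < n \<Longrightarrow> (\<Sum>a<c. p a i j) = (if i = j then 1 else 0)"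
    and zero: "\<And>a i j. a < c \<Longrightarrow> i < n \<Longrightarrow> j < n \<Longrightarrow> (\<Sum>k<n. p a i k * complex_of_real (lam k) * p a k j) = 0"
    and c: "c > 0"
  shows "card {i. i < n \<and> lam i > 0} \<le> (c - 1) * card {i. i < n \<and> lam i < 0}"
proof (rule ccontr)
  let ?pos = "{i. i < n \<and> lam i > 0}" and ?neg = "{i. i < n \<and> lam i < 0}"
  assume less: "\<not> ?thesis"
  \<comment> \<open>Coordinates of \<open>z\<close> to be killed, and differences \<open>y\<^sub>a - y\<^sub>0\<close> to be killed at negative indices.\<close>
  define R where "R = Inl ` ({..<n} - ?pos) \<union> Inr ` ({1..<c} \<times> ?neg)"
  define r where "r b j = (case b of Inl i \<Rightarrow> if j = i then 1 else 0 | Inr (a, i) \<Rightarrow> p a i j - p 0 i j)"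
    for b j
  have "card (Inl ` ({..<n} - ?pos) :: (nat + nat \<times> nat) set) = card ({..<n} - ?pos)"
    "card (Inr ` ({1..<c} \<times> ?neg) :: (nat + nat \<times> nat) set) = (c - 1) * card ?neg"
    by (simp_all add: card_image card_cartesian_product)
  then have "card R \<le> card ({..<n} - ?pos) + (c - 1) * card ?neg"
    unfolding R_def using card_Un_le[of "Inl ` ({..<n} - ?pos)" "Inr ` ({1..<c} \<times> ?neg)"] by simp
  also have "card ({..<n} - ?pos) = n - card ?pos"
    by (subst card_Diff_subset) auto
  finally have "card R \<le> n - card ?pos + (c - 1) * card ?neg" .
  moreover have "card ?pos \<le> n" using card_mono[of "{..<n}" ?pos] by fastforce
  ultimately have "card R < n" using less by linarith
  moreover have "finite R" by (auto simp: R_def)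
  ultimately obtain z where z: "\<exists>i<n. z i \<noteq> 0" "\<And>b. b \<in> R \<Longrightarrow> (\<Sum>j<n. r b j * z j) = 0"
    using nontrivial_solution[of R n r] by blast
  define y where "y a i = (\<Sum>j<n. p a i j * z j)" for a i
  have z0: "z i = 0" if "i < n" "\<not> lam i > 0" for i
  proof -
    have "(\<Sum>j<n. r (Inl i) j * z j) = 0" using that by (intro z(2)) (auto simp: R_def)
    moreover have "(\<Sum>j<n. r (Inl i) j * z j) = (\<Sum>j<n. if j = i then z j else 0)"
      by (intro sum.cong refl) (auto simp: r_def)
    ultimately show ?thesis using that by simp
  qed
  have total: "(\<Sum>a<c. y a i) = z i" if "i < n" for i
  proof -
    have "(\<Sum>a<c. y a i) = (\<Sum>k<n. (\<Sum>a<c. p a i k) * z k)"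
      unfolding y_def by (subst sum.swap) (simp add: sum_distrib_right)
    also have "\<dots> = (\<Sum>k<n. if i = k then z k else 0)"
      using one[OF that] by (intro sum.cong refl) auto
    finally show ?thesis using that by simp
  qed
  have neg0: "y a i = 0" if "a < c" "i < n" "lam i < 0" for a i
  proof -
    have eq: "y b i = y 0 i" if "b < c" for b
    proof (cases "b = 0")
      case False
      have "(\<Sum>j<n. r (Inr (b, i)) j * z j) = 0"
        using that False \<open>i < n\<close> \<open>lam i < 0\<close> by (intro z(2)) (auto simp: R_def)
      then show ?thesis by (simp add: r_def y_def left_diff_distrib sum_subtractf)
    qed simp
    have "(\<Sum>b<c. y b i) = (\<Sum>b<c. y 0 i)"
      by (rule sum.cong[OF refl], rule eq) simp
    moreover have "(\<Sum>b<c. y b i) = 0" using total z0 that by simp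
    ultimately have "y 0 i = 0" using c by simp
    then show ?thesis using eq[OF that(1)] by metis
  qed
  have pos0: "y a i = 0" if a: "a < c" and i: "i < n" "lam i > 0" for a i
  proof -
    have "(\<Sum>k<n. complex_of_real (lam k) * (y a k * cnj (y a k)))
        = (\<Sum>k<n. \<Sum>l<n. \<Sum>j<n. cnj (z j) * (p a j k * complex_of_real (lam k) * p a k l) * z l)"
    proof (intro sum.cong refl)
      fix k assume "k \<in> {..<n}"
      then have cnj_y: "cnj (y a k) = (\<Sum>j<n. p a j k * cnj (z j))"
        unfolding y_def cnj_sum using herm[OF a, of k] by (intro sum.cong) auto
      have "y a k * cnj (y a k) = (\<Sum>l<n. \<Sum>j<n. (p a k l * z l) * (p a j k * cnj (z j)))"
        unfolding cnj_y by (subst y_def) (rule sum_product)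
      then show "complex_of_real (lam k) * (y a k * cnj (y a k))
          = (\<Sum>l<n. \<Sum>j<n. cnj (z j) * (p a j k * complex_of_real (lam k) * p a k l) * z l)"
        by (simp add: sum_distrib_left mult_ac)
    qed
    also have "\<dots> = (\<Sum>l<n. \<Sum>k<n. \<Sum>j<n. cnj (z j) * (p a j k * complex_of_real (lam k) * p a k l) * z l)"
      by (rule sum.swap)
    also have "\<dots> = (\<Sum>l<n. \<Sum>j<n. \<Sum>k<n. cnj (z j) * (p a j k * complex_of_real (lam k) * p a k l) * z l)"
      by (intro sum.cong refl sum.swap)
    also have "\<dots> = (\<Sum>l<n. \<Sum>j<n. cnj (z j) * (\<Sum>k<n. p a j k * complex_of_real (lam k) * p a k l) * z l)"
      by (simp add: sum_distrib_left sum_distrib_right)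
    also have "\<dots> = 0" using zero[OF a] by simp
    finally have "(\<Sum>k<n. complex_of_real (lam k) * (y a k * cnj (y a k))) = 0" .
    moreover have "(\<Sum>k<n. complex_of_real (lam k) * (y a k * cnj (y a k)))
        = (\<Sum>k<n. complex_of_real (lam k * (cmod (y a k))\<^sup>2))"
      by (simp only: of_real_mult complex_norm_square)
    ultimately have "(\<Sum>k<n. complex_of_real (lam k * (cmod (y a k))\<^sup>2)) = 0" by simp
    then have "(\<Sum>k<n. lam k * (cmod (y a k))\<^sup>2) = 0"
      by (simp only: of_real_sum[symmetric] of_real_eq_0_iff)
    moreover have "\<forall>k\<in>{..<n}. lam k * (cmod (y a k))\<^sup>2 \<ge> 0"
    proof
      fix k assume "k \<in> {..<n}"
      then show "lam k * (cmod (y a k))\<^sup>2 \<ge> 0"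
        using neg0[OF a, of k] by (cases "lam k < 0") simp_all
    qed
    ultimately have "lam i * (cmod (y a i))\<^sup>2 = 0"
      using i sum_nonneg_eq_0_iff[of "{..<n}" "\<lambda>k. lam k * (cmod (y a k))\<^sup>2"] by blast
    then show ?thesis using i by simp
  qed
  have "z i = 0" if "i < n" for i
  proof (cases "lam i > 0")
    case True
    then show ?thesis using total[OF that] pos0 that by simp
  qed (use z0 that in auto)
  then show False using z(1) by auto
qed

section \<open>Kronecker products\<close>

text \<open>
  Index \<open>h\<close> of a tensor product stands for the pair \<open>(h div k, h mod k)\<close>.
\<close>

lemma sum_div_mod:
  fixes f :: "nat \<Rightarrow> nat \<Rightarrow> 'a :: comm_monoid_add"
  shows "(\<Sum>h<n * k. f (h div k) (h mod k)) = (\<Sum>a<n. \<Sum>b<k. f a b)"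
proof -
  have "(\<Sum>h<n * k. f (h div k) (h mod k)) = (\<Sum>m<n. \<Sum>h\<in>{m * k..<m * k + k}. f (h div k) (h mod k))"
    by (rule sum.nat_group[symmetric])
  also have "\<dots> = (\<Sum>m<n. \<Sum>b<k. f m b)"
  proof (rule sum.cong[OF refl])
    fix m
    have "(\<Sum>h\<in>{m * k..<m * k + k}. f (h div k) (h mod k)) = (\<Sum>b\<in>{0..<k}. f ((b + m * k) div k) ((b + m * k) mod k))"
      using sum.shift_bounds_nat_ivl[of "\<lambda>h. f (h div k) (h mod k)" 0 "m * k" k] by (simp add: add.commute)
    also have "\<dots> = (\<Sum>b<k. f m b)"
      unfolding atLeast0LessThan by (intro sum.cong refl) auto
    finally show "(\<Sum>h\<in>{m * k..<m * k + k}. f (h div k) (h mod k)) = (\<Sum>b<k. f m b)" .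
  qed
  finally show ?thesis .
qed

lemma kron_carrier [simp]:
  "X \<in> carrier_mat m n \<Longrightarrow> Y \<in> carrier_mat p q \<Longrightarrow> kron X Y \<in> carrier_mat (m * p) (n * q)"
  by (auto simp: kron_def)

lemma kron_index:
  assumes "X \<in> carrier_mat m n" "Y \<in> carrier_mat p q" "i < m * p" "j < n * q"
  shows "kron X Y $$ (i, j) = X $$ (i div p, j div q) * Y $$ (i mod p, j mod q)"
  using assms by (simp add: kron_def)

lemma div_mod_less:
  assumes "i < m * (p :: nat)"
  shows "i div p < m" "i mod p < p"
  using assms by (auto simp: less_mult_imp_div_less intro!: mod_less_divisor gr0I)

lemma kron_mult:
  assumes X: "X \<in> carrier_mat m n" "X' \<in> carrier_mat n l" and Y: "Y \<in> carrier_mat p q" "Y' \<in> carrier_mat q r"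
  shows "kron X Y * kron X' Y' = kron (X * X') (Y * Y')"
proof (rule eq_matI)
  note c = kron_carrier[OF X(1) Y(1)] kron_carrier[OF X(2) Y(2)]
    kron_carrier[OF mult_carrier_mat[OF X] mult_carrier_mat[OF Y]]
  fix i j assume "i < dim_row (kron (X * X') (Y * Y'))" "j < dim_col (kron (X * X') (Y * Y'))"
  then have ij: "i < m * p" "j < l * r" using c(3) by auto
  note dm = div_mod_less[OF ij(1)] div_mod_less[OF ij(2)]
  have "(kron X Y * kron X' Y') $$ (i, j) = (\<Sum>h<n * q. kron X Y $$ (i, h) * kron X' Y' $$ (h, j))"
    by (rule mat_mult_index[OF c(1,2) ij])
  also have "\<dots> = (\<Sum>h<n * q. (X $$ (i div p, h div q) * X' $$ (h div q, j div r)) *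
      (Y $$ (i mod p, h mod q) * Y' $$ (h mod q, j mod r)))"
    by (intro sum.cong refl) (use ij in \<open>auto simp: kron_index[OF X(1) Y(1)] kron_index[OF X(2) Y(2)]\<close>)
  also have "\<dots> = (\<Sum>a<n. \<Sum>b<q. (X $$ (i div p, a) * X' $$ (a, j div r)) * (Y $$ (i mod p, b) * Y' $$ (b, j mod r)))"
    by (rule sum_div_mod)
  also have "\<dots> = (X * X') $$ (i div p, j div r) * (Y * Y') $$ (i mod p, j mod r)"
    unfolding mat_mult_index[OF X dm(1,3)] mat_mult_index[OF Y dm(2,4)] by (rule sum_product[symmetric])
  also have "\<dots> = kron (X * X') (Y * Y') $$ (i, j)"
    by (rule kron_index[symmetric, OF mult_carrier_mat[OF X] mult_carrier_mat[OF Y] ij])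
  finally show "(kron X Y * kron X' Y') $$ (i, j) = kron (X * X') (Y * Y') $$ (i, j)" .
qed (use X Y in \<open>auto simp: kron_def\<close>)

lemma kron_adjoint: "mat_adjoint (kron X Y) = kron (mat_adjoint X) (mat_adjoint Y)"
proof (rule eq_matI)
  fix i j assume "i < dim_row (kron (mat_adjoint X) (mat_adjoint Y))" "j < dim_col (kron (mat_adjoint X) (mat_adjoint Y))"
  then have "i < dim_col X * dim_col Y" "j < dim_row X * dim_row Y" by (auto simp: kron_def)
  with div_mod_less[OF this(1)] div_mod_less[OF this(2)]
  show "mat_adjoint (kron X Y) $$ (i, j) = kron (mat_adjoint X) (mat_adjoint Y) $$ (i, j)"
    by (simp add: kron_def)
qed (auto simp: kron_def)

lemma kron_diag_one:
  "kron (diag_matrix n f) (1\<^sub>m k) = diag_matrix (n * k) (\<lambda>i. f (i div k))"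
proof (rule eq_matI)
  fix i j assume "i < dim_row (diag_matrix (n * k) (\<lambda>i. f (i div k)))" "j < dim_col (diag_matrix (n * k) (\<lambda>i. f (i div k)))"
  then have ij: "i < n * k" "j < n * k" by (auto simp: diag_matrix_def)
  have "i = j \<longleftrightarrow> i div k = j div k \<and> i mod k = j mod k"
    by (metis div_mult_mod_eq)
  then show "kron (diag_matrix n f) (1\<^sub>m k) $$ (i, j) = diag_matrix (n * k) (\<lambda>i. f (i div k)) $$ (i, j)"
    using ij div_mod_less[OF ij(1)] div_mod_less[OF ij(2)] by (auto simp: kron_def diag_matrix_def)
qed (auto simp: kron_def diag_matrix_def)

lemma kron_one_one: "kron (1\<^sub>m n) (1\<^sub>m k) = 1\<^sub>m (n * k)"
proof -
  have "1\<^sub>m m = diag_matrix m (\<lambda>_. 1)" for m by (rule eq_matI) (auto simp: diag_matrix_def)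
  then show ?thesis using kron_diag_one[of n "\<lambda>_. 1" k] by simp
qed

lemma sesq_kron_one:
  assumes T: "T \<in> carrier_mat d d"
  shows "sesq (d * k) (kron T (1\<^sub>m k)) u w = (\<Sum>t<k. sesq d T (\<lambda>i. u (i * k + t)) (\<lambda>i. w (i * k + t)))"
proof -
  have "sesq (d * k) (kron T (1\<^sub>m k)) u w
     = (\<Sum>i<d * k. \<Sum>j<d * k. cnj (u (i div k * k + i mod k)) * (T $$ (i div k, j div k) * (if i mod k = j mod k then 1 else 0))
         * w (j div k * k + j mod k))"
    unfolding sesq_def
    by (intro sum.cong refl) (auto simp: kron_index[OF T one_carrier_mat] div_mod_less)
  also have "\<dots> = (\<Sum>a<d. \<Sum>s<k. \<Sum>b<d. \<Sum>t<k. cnj (u (a * k + s)) * (T $$ (a, b) * (if s = t then 1 else 0)) * w (b * k + t))"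
    by (subst sum_div_mod[of "\<lambda>a s. \<Sum>j<d * k. cnj (u (a * k + s)) * (T $$ (a, j div k) * (if s = j mod k then 1 else 0)) * w (j div k * k + j mod k)"])
      (intro sum.cong refl sum_div_mod[of "\<lambda>b t. cnj (u _) * (T $$ (_, b) * (if _ = t then 1 else 0)) * w (b * k + t)"])
  also have "\<dots> = (\<Sum>a<d. \<Sum>s<k. \<Sum>b<d. cnj (u (a * k + s)) * T $$ (a, b) * w (b * k + s))"
  proof (intro sum.cong refl)
    fix a s b assume s: "s \<in> {..<k}"
    have "(\<Sum>t<k. cnj (u (a * k + s)) * (T $$ (a, b) * (if s = t then 1 else 0)) * w (b * k + t))
        = (\<Sum>t<k. if s = t then cnj (u (a * k + s)) * T $$ (a, b) * w (b * k + t) else 0)"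
      by (intro sum.cong) auto
    then show "(\<Sum>t<k. cnj (u (a * k + s)) * (T $$ (a, b) * (if s = t then 1 else 0)) * w (b * k + t))
        = cnj (u (a * k + s)) * T $$ (a, b) * w (b * k + s)" using s by simp
  qed
  also have "\<dots> = (\<Sum>s<k. \<Sum>a<d. \<Sum>b<d. cnj (u (a * k + s)) * T $$ (a, b) * w (b * k + s))"
    by (rule sum.swap)
  finally show ?thesis by (simp add: sesq_def)
qed

lemma (in diagonalized) diagonalized_kron:
  "diagonalized (n * k) (kron T (1\<^sub>m k)) (kron V (1\<^sub>m k)) (\<lambda>i. lam (i div k))"
proof
  show "kron T (1\<^sub>m k) \<in> carrier_mat (n * k) (n * k)" "kron V (1\<^sub>m k) \<in> carrier_mat (n * k) (n * k)"
    using T V by simp_all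
  show "mat_adjoint (kron V (1\<^sub>m k)) * kron V (1\<^sub>m k) = 1\<^sub>m (n * k)"
    by (simp add: kron_adjoint kron_mult[of _ n n _ n _ k k _ k] unitary kron_one_one)
  show "mat_adjoint (kron V (1\<^sub>m k)) * kron T (1\<^sub>m k) * kron V (1\<^sub>m k)
      = diag_matrix (n * k) (\<lambda>i. complex_of_real (lam (i div k)))"
    by (simp add: kron_adjoint kron_mult[of _ n n _ n _ k k _ k] diagonal kron_diag_one
      mult_carrier_mat[of _ n n _ n])
qed

section \<open>Projections summing to one\<close>

locale projection_partition =
  fixes n c :: nat and P :: "nat \<Rightarrow> complex mat"
  assumes P [simp]: "\<And>a. a < c \<Longrightarrow> P a \<in> carrier_mat n n"
    and P_adjoint: "\<And>a. a < c \<Longrightarrow> mat_adjoint (P a) = P a"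
    and P_idem: "\<And>a. a < c \<Longrightarrow> P a * P a = P a"
    and P_sum: "\<And>i j. i < n \<Longrightarrow> j < n \<Longrightarrow> (\<Sum>a<c. P a $$ (i, j)) = (if i = j then 1 else 0)"
begin

lemma c_pos: "n > 0 \<Longrightarrow> c > 0"
  using P_sum[of 0 0] by (cases c) auto

lemma sesq_sum_commuting:
  assumes E: "E \<in> carrier_mat n n"
  shows "(\<Sum>a<c. sesq n (E * P a) w w) = sesq n E w w"
proof -
  have "(\<Sum>a<c. sesq n (E * P a) w w)
      = (\<Sum>a<c. \<Sum>i<n. \<Sum>j<n. cnj (w i) * (\<Sum>h<n. E $$ (i, h) * P a $$ (h, j)) * w j)"
    unfolding sesq_def
    by (intro sum.cong refl) (simp add: mat_mult_index[OF E P] del: index_mult_mat(1))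
  also have "\<dots> = (\<Sum>i<n. \<Sum>a<c. \<Sum>j<n. cnj (w i) * (\<Sum>h<n. E $$ (i, h) * P a $$ (h, j)) * w j)"
    by (rule sum.swap)
  also have "\<dots> = (\<Sum>i<n. \<Sum>j<n. \<Sum>a<c. cnj (w i) * (\<Sum>h<n. E $$ (i, h) * P a $$ (h, j)) * w j)"
    by (intro sum.cong refl sum.swap)
  also have "\<dots> = (\<Sum>i<n. \<Sum>j<n. cnj (w i) * E $$ (i, j) * w j)"
  proof (intro sum.cong refl)
    fix i j assume "j \<in> {..<n}"
    then have j: "j < n" by simp
    have "(\<Sum>a<c. \<Sum>h<n. E $$ (i, h) * P a $$ (h, j)) = (\<Sum>h<n. E $$ (i, h) * (\<Sum>a<c. P a $$ (h, j)))"
      by (subst sum.swap) (simp add: sum_distrib_left)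
    also have "\<dots> = (\<Sum>h<n. if h = j then E $$ (i, h) else 0)"
      by (intro sum.cong refl) (use P_sum j in auto)
    also have "\<dots> = E $$ (i, j)" using j by simp
    finally show "(\<Sum>a<c. cnj (w i) * (\<Sum>h<n. E $$ (i, h) * P a $$ (h, j)) * w j) = cnj (w i) * E $$ (i, j) * w j"
      by (simp only: sum_distrib_left[symmetric] sum_distrib_right[symmetric])
  qed
  finally show ?thesis by (simp add: sesq_def)
qed

text \<open>
  On the commuting part \<open>E\<close> pinching acts as the identity and the part \<open>H\<close> is pinched away, so the pinching
  of \<open>E + H\<close> is \<open>E\<close>.
\<close>

lemma pinched_form_bound:
  assumes E: "E \<in> carrier_mat n n" "\<And>a. a < c \<Longrightarrow> E * P a = P a * E"
    and H: "H \<in> carrier_mat n n" "\<And>a. a < c \<Longrightarrow> P a * H * P a = 0\<^sub>m n n"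
    and psd: "\<And>u. Re (sesq n (E + H) u u) \<ge> 0"
  shows "Re (sesq n (E + H) w w) \<le> real c * Re (sesq n E w w)"
proof -
  have compress: "P a * (E + H) * P a = E * P a" if a: "a < c" for a
  proof -
    have "P a * (E + H) * P a = P a * E * P a + P a * H * P a"
      using P[OF a] E H
      by (simp add: mult_add_distrib_mat[of _ n n _ n] add_mult_distrib_mat[of _ n n _ _ n] mult_carrier_mat[of _ n n _ n])
    also have "P a * E * P a = E * (P a * P a)"
      using P[OF a] E(1) by (simp add: E(2)[OF a, symmetric] assoc_mult_mat[of _ n n _ n _ n])
    finally show ?thesis
      using H(2)[OF a] P_idem[OF a] P[OF a] E by simp
  qed
  have "Re (sesq n (E + H) w w) \<le> real c * (\<Sum>a<c. Re (sesq n (P a * (E + H) * P a) w w))"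
    by (rule pinching_inequality) (use E H psd P_adjoint P_sum in auto)
  also have "(\<Sum>a<c. Re (sesq n (P a * (E + H) * P a) w w)) = Re (\<Sum>a<c. sesq n (E * P a) w w)"
    using compress by simp
  also have "\<dots> = Re (sesq n E w w)" using sesq_sum_commuting[OF E(1)] by simp
  finally show ?thesis .
qed

end

text \<open>
  The projections are rotated into the eigenbasis of \<open>H\<close>; there \<open>p a\<close> are the entries of the \<open>a\<close>-th
  projection, and the hypotheses become conditions on the diagonal matrix of eigenvalues.
\<close>

locale pinched_to_zero = projection_partition n c P + diagonalized n H V lam
  for n c P H V lam +
  assumes pinched: "\<And>a. a < c \<Longrightarrow> P a * H * P a = 0\<^sub>m n n" and n_pos: "n > 0"
begin

definition p :: "nat \<Rightarrow> nat \<Rightarrow> nat \<Rightarrow> complex" where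
  "p a i j = (mat_adjoint V * P a * V) $$ (i, j)"

abbreviation Lam :: "complex mat" where
  "Lam \<equiv> diag_matrix n (\<lambda>i. complex_of_real (lam i))"

lemma rotate_mult:
  assumes X: "X \<in> carrier_mat n n" and Y: "Y \<in> carrier_mat n n"
  shows "(mat_adjoint V * X * V) * (mat_adjoint V * Y * V) = mat_adjoint V * (X * Y) * V"
proof -
  have "(mat_adjoint V * X * V) * (mat_adjoint V * Y * V) = mat_adjoint V * X * (V * mat_adjoint V) * Y * V"
    using X Y by (simp add: assoc_mult_mat[of _ n n _ n _ n] mult_carrier_mat[of _ n n _ n])
  also have "V * mat_adjoint V = 1\<^sub>m n" by (rule unitary_right_inverse[OF V unitary])
  finally show ?thesis
    using X Y by (simp add: assoc_mult_mat[of _ n n _ n _ n] mult_carrier_mat[of _ n n _ n] right_mult_one_mat[of _ n n])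
qed

lemma rotated_carrier [simp]: "a < c \<Longrightarrow> mat_adjoint V * P a * V \<in> carrier_mat n n"
  by (simp add: mult_carrier_mat[of _ n n _ n])

lemma p_herm:
  assumes "a < c" "i < n" "j < n"
  shows "p a j i = cnj (p a i j)"
proof -
  have "mat_adjoint (mat_adjoint V * P a * V) = mat_adjoint V * P a * V"
    using assms P_adjoint by (simp add: mat_adjoint_mult[of _ n n _ n] mult_carrier_mat[of _ n n _ n] assoc_mult_mat[of _ n n _ n _ n])
  then have "p a j i = mat_adjoint (mat_adjoint V * P a * V) $$ (j, i)" by (simp add: p_def)
  then show ?thesis
    using assms carrier_matD[OF rotated_carrier[OF assms(1)]] by (subst (asm) mat_adjoint_index) (auto simp: p_def)
qed

lemma p_idem:
  assumes "a < c" "i < n" "j < n"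
  shows "(\<Sum>k<n. p a i k * p a k j) = p a i j"
proof -
  have "(\<Sum>k<n. p a i k * p a k j) = ((mat_adjoint V * P a * V) * (mat_adjoint V * P a * V)) $$ (i, j)"
    using assms by (simp add: p_def mat_mult_index[of _ n n _ n] del: index_mult_mat(1))
  then show ?thesis using assms by (simp only: rotate_mult[OF P P] P_idem) (simp add: p_def)
qed

lemma p_zero:
  assumes "a < c" "i < n" "j < n"
  shows "(\<Sum>k<n. p a i k * complex_of_real (lam k) * p a k j) = 0"
proof -
  have a: "P a * H \<in> carrier_mat n n" using assms by (simp add: mult_carrier_mat[of _ n n _ n])
  have "(mat_adjoint V * P a * V) * Lam * (mat_adjoint V * P a * V) = mat_adjoint V * (P a * H * P a) * V"
    unfolding diagonal[symmetric] using assms a by (simp add: rotate_mult)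
  also have "\<dots> = 0\<^sub>m n n"
    using assms by (simp add: pinched left_mult_zero_mat[of _ n n] right_mult_zero_mat[of _ n n])
  finally have "((mat_adjoint V * P a * V) * Lam * (mat_adjoint V * P a * V)) $$ (i, j) = 0"
    using assms by simp
  moreover have "((mat_adjoint V * P a * V) * Lam * (mat_adjoint V * P a * V)) $$ (i, j)
      = (\<Sum>k<n. ((mat_adjoint V * P a * V) * Lam) $$ (i, k) * p a k j)"
    unfolding p_def by (rule mat_mult_index) (use assms in \<open>auto intro!: mult_carrier_mat[of _ n n _ n]\<close>)
  moreover have "((mat_adjoint V * P a * V) * Lam) $$ (i, k) = p a i k * complex_of_real (lam k)" if "k < n" for k
  proof -
    have "((mat_adjoint V * P a * V) * Lam) $$ (i, k) = (\<Sum>h<n. p a i h * Lam $$ (h, k))"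
      unfolding p_def by (rule mat_mult_index) (use assms that in auto)
    also have "\<dots> = (\<Sum>h<n. if h = k then p a i h * complex_of_real (lam h) else 0)"
      by (intro sum.cong) (use that in \<open>auto simp: diag_matrix_def\<close>)
    finally show ?thesis using that by simp
  qed
  ultimately show ?thesis by simp
qed

lemma p_sum:
  assumes "i < n" "j < n"
  shows "(\<Sum>a<c. p a i j) = (if i = j then 1 else 0)"
proof -
  have "p a i j = (\<Sum>l<n. (\<Sum>h<n. cnj (V $$ (h, i)) * P a $$ (h, l)) * V $$ (l, j))" if a: "a < c" for a
  proof -
    have "p a i j = (\<Sum>l<n. (mat_adjoint V * P a) $$ (i, l) * V $$ (l, j))"
      unfolding p_def by (rule mat_mult_index) (use a assms in \<open>auto intro!: mult_carrier_mat[of _ n n _ n]\<close>)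
    also have "\<dots> = (\<Sum>l<n. (\<Sum>h<n. mat_adjoint V $$ (i, h) * P a $$ (h, l)) * V $$ (l, j))"
      by (intro sum.cong refl) (subst mat_mult_index[OF mat_adjoint_carrier[OF V] P[OF a]], use assms in auto)
    also have "\<dots> = (\<Sum>l<n. (\<Sum>h<n. cnj (V $$ (h, i)) * P a $$ (h, l)) * V $$ (l, j))"
      using assms carrier_matD[OF V] by (intro sum.cong refl arg_cong2[where f = "(*)"]) auto
    finally show ?thesis .
  qed
  then have "(\<Sum>a<c. p a i j) = (\<Sum>a<c. \<Sum>l<n. (\<Sum>h<n. cnj (V $$ (h, i)) * P a $$ (h, l)) * V $$ (l, j))"
    by simp
  also have "\<dots> = (\<Sum>l<n. \<Sum>a<c. (\<Sum>h<n. cnj (V $$ (h, i)) * P a $$ (h, l)) * V $$ (l, j))"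
    by (rule sum.swap)
  also have "\<dots> = (\<Sum>l<n. cnj (V $$ (l, i)) * V $$ (l, j))"
  proof (intro sum.cong refl)
    fix l assume "l \<in> {..<n}"
    then have l: "l < n" by simp
    have "(\<Sum>a<c. \<Sum>h<n. cnj (V $$ (h, i)) * P a $$ (h, l)) = (\<Sum>h<n. cnj (V $$ (h, i)) * (\<Sum>a<c. P a $$ (h, l)))"
      by (subst sum.swap) (simp add: sum_distrib_left)
    also have "\<dots> = (\<Sum>h<n. if h = l then cnj (V $$ (h, i)) else 0)"
      by (intro sum.cong refl) (use P_sum l in auto)
    also have "\<dots> = cnj (V $$ (l, i))" using l by simp
    finally show "(\<Sum>a<c. (\<Sum>h<n. cnj (V $$ (h, i)) * P a $$ (h, l)) * V $$ (l, j)) = cnj (V $$ (l, i)) * V $$ (l, j)"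
      by (simp only: sum_distrib_right[symmetric])
  qed
  also have "\<dots> = (\<Sum>l<n. mat_adjoint V $$ (i, l) * V $$ (l, j))"
    using assms carrier_matD[OF V] by (intro sum.cong refl) auto
  also have "\<dots> = (mat_adjoint V * V) $$ (i, j)"
    by (rule mat_mult_index[symmetric]) (use assms in auto)
  finally show ?thesis unfolding unitary using assms by simp
qed

definition W :: "nat \<Rightarrow> nat \<Rightarrow> real" where
  "W i j = (\<Sum>a<c. (cmod (p a i j))\<^sup>2)"

lemma cmod_p: "a < c \<Longrightarrow> i < n \<Longrightarrow> j < n \<Longrightarrow> complex_of_real ((cmod (p a i j))\<^sup>2) = p a i j * p a j i"
  by (simp only: complex_norm_square p_herm[symmetric])

lemma W_row:
  assumes i: "i < n"
  shows "(\<Sum>j<n. W i j) = 1" "(\<Sum>j<n. W i j * lam j) = 0" "1 \<le> real c * W i i"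
proof -
  have "complex_of_real (\<Sum>j<n. W i j) = (\<Sum>j<n. \<Sum>a<c. p a i j * p a j i)"
    unfolding W_def of_real_sum by (intro sum.cong refl) (rule cmod_p, use i in auto)
  also have "\<dots> = (\<Sum>a<c. \<Sum>j<n. p a i j * p a j i)" by (rule sum.swap)
  also have "\<dots> = 1" using p_idem[OF _ i i] p_sum[OF i i] by simp
  finally show "(\<Sum>j<n. W i j) = 1" by (simp only: of_real_eq_1_iff)
  have "complex_of_real (\<Sum>j<n. W i j * lam j) = (\<Sum>j<n. \<Sum>a<c. p a i j * complex_of_real (lam j) * p a j i)"
    unfolding W_def of_real_sum of_real_mult sum_distrib_right
    by (intro sum.cong refl, subst cmod_p) (use i in \<open>auto simp: mult_ac\<close>)
  also have "\<dots> = (\<Sum>a<c. \<Sum>j<n. p a i j * complex_of_real (lam j) * p a j i)" by (rule sum.swap)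
  also have "\<dots> = 0" using p_zero[OF _ i i] by simp
  finally show "(\<Sum>j<n. W i j * lam j) = 0" by (simp only: of_real_eq_0_iff)
  have one: "(\<Sum>a<c. Re (p a i i)) = 1"
    using arg_cong[OF p_sum[OF i i], of Re] by simp
  \<comment> \<open>Cauchy--Schwarz for \<open>c\<close> real numbers with sum \<open>1\<close>, written as a sum of squares.\<close>
  have "0 \<le> (\<Sum>a<c. (real c * Re (p a i i) - 1)\<^sup>2)" by (intro sum_nonneg) auto
  also have "\<dots> = (real c)\<^sup>2 * (\<Sum>a<c. (Re (p a i i))\<^sup>2) - 2 * real c * (\<Sum>a<c. Re (p a i i)) + real c"
    by (simp add: power2_diff sum.distrib sum_subtractf sum_distrib_left power_mult_distrib mult_ac)
  finally have "real c * 1 \<le> real c * (real c * (\<Sum>a<c. (Re (p a i i))\<^sup>2))"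
    unfolding one by (simp add: power2_eq_square mult.assoc)
  then have "1 \<le> real c * (\<Sum>a<c. (Re (p a i i))\<^sup>2)"
    using c_pos[OF n_pos] by simp
  also have "\<dots> \<le> real c * W i i"
    unfolding W_def by (intro mult_left_mono sum_mono) (auto simp: cmod_power2)
  finally show "1 \<le> real c * W i i" .
qed

lemma W_sym: "i < n \<Longrightarrow> j < n \<Longrightarrow> W i j = W j i"
  unfolding W_def by (intro sum.cong refl) (metis complex_mod_cnj lessThan_iff p_herm)

text \<open>
  The same weights serve \<open>H\<close> and \<open>- H\<close>, whence both quotients of a pair are bounded.
\<close>

lemma weights: "pinching_weights n (real c) W lam" "pinching_weights n (real c) W (\<lambda>i. - lam i)"
  using W_row W_sym c_pos[OF n_pos]
  by (unfold_locales; force simp: W_def sum_negf intro!: sum_nonneg)+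

lemma square_sums:
  "(\<Sum>i | i < n \<and> lam i > 0. (lam i)\<^sup>2) \<le> (real c - 1) * (\<Sum>i | i < n \<and> lam i < 0. (lam i)\<^sup>2)"
  "(\<Sum>i | i < n \<and> lam i < 0. (lam i)\<^sup>2) \<le> (real c - 1) * (\<Sum>i | i < n \<and> lam i > 0. (lam i)\<^sup>2)"
  using pinching_weights.square_sum_le[OF weights(1)] pinching_weights.square_sum_le[OF weights(2)] by simp_all

lemma inertia:
  "card {i. i < n \<and> lam i > 0} \<le> (c - 1) * card {i. i < n \<and> lam i < 0}"
  "card {i. i < n \<and> lam i < 0} \<le> (c - 1) * card {i. i < n \<and> lam i > 0}"
proof -
  show "card {i. i < n \<and> lam i > 0} \<le> (c - 1) * card {i. i < n \<and> lam i < 0}"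
    by (rule inertia_bound[OF p_herm p_sum p_zero c_pos[OF n_pos]])
  have "card {i. i < n \<and> - lam i > 0} \<le> (c - 1) * card {i. i < n \<and> - lam i < 0}"
    by (rule inertia_bound[OF p_herm p_sum _ c_pos[OF n_pos]]) (simp_all add: p_zero sum_negf)
  then show "card {i. i < n \<and> lam i < 0} \<le> (c - 1) * card {i. i < n \<and> lam i > 0}" by simp
qed

end

section \<open>Traces\<close>

lemma mat_trace_eq: "X \<in> carrier_mat d d \<Longrightarrow> mat_trace X = (\<Sum>i<d. X $$ (i, i))"
  by (simp add: mat_trace_def)

lemma mat_trace_mult:
  assumes "X \<in> carrier_mat d d" "Y \<in> carrier_mat d d"
  shows "mat_trace (X * Y) = (\<Sum>i<d. \<Sum>j<d. X $$ (i, j) * Y $$ (j, i))"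
  using assms by (simp add: mat_trace_eq[of _ d] mult_carrier_mat[of _ d d] mat_mult_index[of _ d d _ d] del: index_mult_mat(1))

lemma mat_trace_comm:
  assumes "X \<in> carrier_mat d d" "Y \<in> carrier_mat d d"
  shows "mat_trace (X * Y) = mat_trace (Y * X)"
  unfolding mat_trace_mult[OF assms] mat_trace_mult[OF assms(2,1)]
  by (subst sum.swap) (simp add: mult.commute)

lemma mat_trace_minus:
  "X \<in> carrier_mat d d \<Longrightarrow> Y \<in> carrier_mat d d \<Longrightarrow> mat_trace (X - Y) = mat_trace X - mat_trace Y"
  by (simp add: mat_trace_eq[of _ d] minus_carrier_mat sum_subtractf)

lemma mat_trace_adjoint: "X \<in> carrier_mat d d \<Longrightarrow> mat_trace (mat_adjoint X) = cnj (mat_trace X)"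
  by (simp add: mat_trace_eq[of _ d])

lemma mat_trace_square_eq_0:
  assumes X: "X \<in> carrier_mat d d" and zero: "mat_trace (mat_adjoint X * X) = 0"
  shows "X = 0\<^sub>m d d"
proof -
  have "mat_trace (mat_adjoint X * X) = (\<Sum>i<d. \<Sum>j<d. complex_of_real ((cmod (X $$ (j, i)))\<^sup>2))"
    unfolding mat_trace_mult[OF mat_adjoint_carrier[OF X] X] complex_norm_square
    using X by (intro sum.cong refl) (simp add: mult.commute)
  then have "complex_of_real (\<Sum>i<d. \<Sum>j<d. (cmod (X $$ (j, i)))\<^sup>2) = 0"
    using zero by (simp only: of_real_sum)
  then have sum0: "(\<Sum>i<d. \<Sum>j<d. (cmod (X $$ (j, i)))\<^sup>2) = 0"
    by (simp only: of_real_eq_0_iff)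
  have inner: "(\<Sum>j<d. (cmod (X $$ (j, i)))\<^sup>2) = 0" if "i < d" for i
    using sum0 that sum_nonneg_eq_0_iff[of "{..<d}" "\<lambda>i. \<Sum>j<d. (cmod (X $$ (j, i)))\<^sup>2"]
    by (simp add: sum_nonneg)
  have "X $$ (j, i) = 0" if "i < d" "j < d" for i j
    using inner[OF that(1)] that(2) sum_nonneg_eq_0_iff[of "{..<d}" "\<lambda>j. (cmod (X $$ (j, i)))\<^sup>2"]
    by simp
  then show ?thesis using X by (intro eq_matI) auto
qed

section \<open>Subspaces of matrices\<close>

lemma restricted_mat_space [simp]: "(mat_space d)\<lparr>carrier := carrier_mat d d\<rparr> = mat_space d"
  by (simp add: module_mat_def)

text \<open>
  Stated for a restricted carrier, because \<open>mat_dim\<close> views a subspace \<open>S\<close> as a vector space of its own,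
  whose sums are formally different from those of the ambient space.
\<close>

lemma mat_finsum:
  assumes G: "abelian_monoid ((mat_space d)\<lparr>carrier := S\<rparr>)" and S: "S \<subseteq> carrier_mat d d"
    and "finite I" "\<And>l. l \<in> I \<Longrightarrow> f l \<in> S"
  shows "finsum ((mat_space d)\<lparr>carrier := S\<rparr>) f I \<in> S \<and>
    (\<forall>i<d. \<forall>j<d. finsum ((mat_space d)\<lparr>carrier := S\<rparr>) f I $$ (i, j) = (\<Sum>l\<in>I. f l $$ (i, j)))"
  using assms(3,4)
proof (induction I)
  interpret G: abelian_monoid "(mat_space d)\<lparr>carrier := S\<rparr>" by (rule G)
  case empty
  show ?case using G.zero_closed by (simp add: module_mat_simps)
next
  interpret G: abelian_monoid "(mat_space d)\<lparr>carrier := S\<rparr>" by (rule G)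
  case (insert l I)
  have "finsum ((mat_space d)\<lparr>carrier := S\<rparr>) f (insert l I)
      = f l + finsum ((mat_space d)\<lparr>carrier := S\<rparr>) f I"
    using insert by (subst G.finsum_insert) (auto simp: module_mat_simps)
  moreover have "f l \<in> carrier_mat d d" "finsum ((mat_space d)\<lparr>carrier := S\<rparr>) f I \<in> carrier_mat d d"
    using insert S by auto
  moreover have "f l + finsum ((mat_space d)\<lparr>carrier := S\<rparr>) f I \<in> S"
    using insert G.a_closed[of "f l" "finsum ((mat_space d)\<lparr>carrier := S\<rparr>) f I"] by (simp add: module_mat_simps)
  ultimately show ?case using insert by auto
qed

lemma mat_sum_upto:
  assumes "\<And>l. l < r \<Longrightarrow> f l \<in> carrier_mat d d"
  shows "mat_sum_upto d r f \<in> carrier_mat d d"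
    and "i < d \<Longrightarrow> j < d \<Longrightarrow> mat_sum_upto d r f $$ (i, j) = (\<Sum>l<r. f l $$ (i, j))"
proof -
  interpret abelian_group "mat_space d" by (rule abelian_group_mat)
  have "abelian_monoid (mat_space d)" ..
  then show "mat_sum_upto d r f \<in> carrier_mat d d"
    "i < d \<Longrightarrow> j < d \<Longrightarrow> mat_sum_upto d r f $$ (i, j) = (\<Sum>l<r. f l $$ (i, j))"
    using mat_finsum[where S = "carrier_mat d d" and d = d and I = "{..<r}" and f = f] assms by auto
qed

definition unit_mat :: "nat \<Rightarrow> nat \<Rightarrow> nat \<Rightarrow> complex mat" where
  "unit_mat d i j = mat d d (\<lambda>(a, b). if a = i \<and> b = j then 1 else 0)"

lemma unit_mat_carrier [simp]: "unit_mat d i j \<in> carrier_mat d d"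
  by (simp add: unit_mat_def)

lemma mat_subspaceD:
  assumes "VectorSpace.subspace class_ring S (mat_space d)"
  shows "S \<subseteq> carrier_mat d d" "X \<in> S \<Longrightarrow> Y \<in> S \<Longrightarrow> X + Y \<in> S" "X \<in> S \<Longrightarrow> s \<cdot>\<^sub>m X \<in> S"
    "X \<in> S \<Longrightarrow> Y \<in> S \<Longrightarrow> X - Y \<in> S"
proof -
  interpret submodule class_ring S "mat_space d" using assms by (simp add: subspace_def)
  show S: "S \<subseteq> carrier_mat d d" using subset by (simp add: module_mat_simps)
  show add: "X + Y \<in> S" if "X \<in> S" "Y \<in> S" for X Y
    using m_closed[OF that] by (simp add: module_mat_simps)
  show smult: "s \<cdot>\<^sub>m X \<in> S" if "X \<in> S" for s X
    using smult_closed[of s X] that by (simp add: module_mat_simps class_ring_simps)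
  show "X - Y \<in> S" if "X \<in> S" "Y \<in> S"
  proof -
    have "X - Y = X + (-1) \<cdot>\<^sub>m Y"
      using subsetD[OF S that(1)] subsetD[OF S that(2)] by (intro eq_matI) auto
    then show ?thesis using add[OF that(1) smult[OF that(2), of "-1"]] by simp
  qed
qed

text \<open>
  The rank of an idempotent is its trace. If \<open>B\<close> is a basis of \<open>S\<close> and \<open>F E\<^sub>i\<^sub>j = \<Sum>\<^sub>b f\<^sub>i\<^sub>j(b) b\<close>, expanding
  \<open>b = F b\<close> in matrix units shows \<open>\<Sum>\<^sub>i\<^sub>j b\<^sub>i\<^sub>j f\<^sub>i\<^sub>j(b') = \<delta>\<^sub>b\<^sub>b'\<close>; the trace is the sum of these for \<open>b = b'\<close>.
\<close>

lemma dim_eq_projection_trace: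
  assumes sub: "VectorSpace.subspace class_ring S (mat_space d)"
    and range: "\<And>X. X \<in> carrier_mat d d \<Longrightarrow> F X \<in> S"
    and fixed: "\<And>X. X \<in> S \<Longrightarrow> F X = X"
    and linear: "\<And>X a b. X \<in> carrier_mat d d \<Longrightarrow> a < d \<Longrightarrow> b < d \<Longrightarrow>
      F X $$ (a, b) = (\<Sum>i<d. \<Sum>j<d. X $$ (i, j) * F (unit_mat d i j) $$ (a, b))"
  shows "of_nat (mat_dim d S) = (\<Sum>i<d. \<Sum>j<d. F (unit_mat d i j) $$ (i, j))"
proof -
  let ?S = "(mat_space d)\<lparr>carrier := S\<rparr>"
  define I where "I = {..<d} \<times> {..<d}"
  define G where "G = (\<lambda>(i, j). F (unit_mat d i j))"
  define entry where "entry X = (\<lambda>ij. X $$ ij)" for X :: "complex mat"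
  interpret V: vectorspace class_ring "mat_space d" by (rule matrix_vs)
  interpret S: vectorspace class_ring ?S by (rule V.subspace_is_vs[OF sub])
  have am: "abelian_monoid ?S" ..
  note SD = mat_subspaceD[OF sub]
  have carr: "carrier ?S = S" by simp
  have I: "finite I" by (simp add: I_def)
  have G: "G ij \<in> S" for ij unfolding G_def by (cases ij) (simp add: range)
  have linear': "X $$ ab = (\<Sum>ij\<in>I. X $$ ij * G ij $$ ab)" if X: "X \<in> S" and ab: "ab \<in> I" for X ab
  proof -
    have "F X $$ ab = (\<Sum>i<d. \<Sum>j<d. X $$ (i, j) * F (unit_mat d i j) $$ ab)"
      using ab linear[of X "fst ab" "snd ab"] SD(1) X by (auto simp: I_def)
    then show ?thesis
      using fixed[OF X] by (simp add: I_def G_def sum.cartesian_product case_prod_unfold)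
  qed
  have "S.fin_dim"
    unfolding S.fin_dim_def
  proof (intro exI conjI)
    show "finite (G ` I)" using I by simp
    show GS: "G ` I \<subseteq> carrier ?S" using G by auto
    have span: "submodule class_ring (S.span (G ` I)) ?S" by (rule S.span_is_submodule[OF GS])
    have "X \<in> S.span (G ` I)" if X: "X \<in> S" for X
    proof -
      have mem: "finsum ?S (\<lambda>ij. X $$ ij \<cdot>\<^sub>m G ij) K \<in> S.span (G ` I)" if "K \<subseteq> I" for K
      proof -
        have "finite K" using that I finite_subset by blast
        then show ?thesis using that
        proof (induction K)
          case empty
          show ?case using submodule.zero_closed[OF span] by simp
        next
          case (insert ij K)
          have sm: "X $$ h \<cdot>\<^sub>m G h \<in> S" for h using SD(3) G by simp
          have "G ij \<in> S.span (G ` I)" using S.in_own_span[OF GS] insert by auto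
          then have "X $$ ij \<cdot>\<^sub>m G ij \<in> S.span (G ` I)"
            using submodule.smult_closed[OF span, of "X $$ ij" "G ij"] by (simp add: module_mat_simps class_ring_simps)
          moreover have "finsum ?S (\<lambda>ij. X $$ ij \<cdot>\<^sub>m G ij) (insert ij K)
              = X $$ ij \<cdot>\<^sub>m G ij + finsum ?S (\<lambda>ij. X $$ ij \<cdot>\<^sub>m G ij) K"
            using insert sm by (subst S.finsum_insert) (auto simp: module_mat_simps)
          ultimately show ?case
            using submodule.m_closed[OF span, of "X $$ ij \<cdot>\<^sub>m G ij" "finsum ?S (\<lambda>ij. X $$ ij \<cdot>\<^sub>m G ij) K"] insert
            by (simp add: module_mat_simps)
        qed
      qed
      have fs: "finsum ?S (\<lambda>ij. X $$ ij \<cdot>\<^sub>m G ij) I \<in> S \<and>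
          (\<forall>a<d. \<forall>b<d. finsum ?S (\<lambda>ij. X $$ ij \<cdot>\<^sub>m G ij) I $$ (a, b) = (\<Sum>ij\<in>I. (X $$ ij \<cdot>\<^sub>m G ij) $$ (a, b)))"
        by (rule mat_finsum[OF am SD(1) I]) (use SD(3) G in auto)
      have "finsum ?S (\<lambda>ij. X $$ ij \<cdot>\<^sub>m G ij) I = X"
      proof (rule eq_matI)
        have X': "X \<in> carrier_mat d d" and f': "finsum ?S (\<lambda>ij. X $$ ij \<cdot>\<^sub>m G ij) I \<in> carrier_mat d d"
          using X fs SD(1) by auto
        then show "dim_row (finsum ?S (\<lambda>ij. X $$ ij \<cdot>\<^sub>m G ij) I) = dim_row X"
          "dim_col (finsum ?S (\<lambda>ij. X $$ ij \<cdot>\<^sub>m G ij) I) = dim_col X" by auto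
        fix a b assume "a < dim_row X" "b < dim_col X"
        then have ab: "a < d" "b < d" using X' by auto
        have "finsum ?S (\<lambda>ij. X $$ ij \<cdot>\<^sub>m G ij) I $$ (a, b) = (\<Sum>ij\<in>I. (X $$ ij \<cdot>\<^sub>m G ij) $$ (a, b))"
          using fs ab by blast
        also have "\<dots> = (\<Sum>ij\<in>I. X $$ ij * G ij $$ (a, b))"
        proof (intro sum.cong refl)
          fix ij
          have "G ij \<in> carrier_mat d d" using G SD(1) by blast
          then show "(X $$ ij \<cdot>\<^sub>m G ij) $$ (a, b) = X $$ ij * G ij $$ (a, b)" using ab by simp
        qed
        also have "\<dots> = X $$ (a, b)" using linear'[OF X, of "(a, b)"] ab by (simp add: I_def)
        finally show "finsum ?S (\<lambda>ij. X $$ ij \<cdot>\<^sub>m G ij) I $$ (a, b) = X $$ (a, b)" .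
      qed
      then show ?thesis using mem[of I] by simp
    qed
    moreover have "S.span (G ` I) \<subseteq> S" using submodule.subset[OF span] by simp
    ultimately show "S.span (G ` I) = carrier ?S" by auto
  qed
  then obtain B where B: "finite B" "S.basis B" using S.finite_basis_exists by blast
  have BS: "B \<subseteq> S" and indep: "\<not> S.lin_dep B" and gen: "S.span B = S"
    using B(2) unfolding S.basis_def by auto
  have dim: "mat_dim d S = card B" unfolding mat_dim_def using S.dim_basis[OF B] .
  have lincomb_index: "S.lincomb f B $$ ab = (\<Sum>b\<in>B. f b * b $$ ab)" if "ab \<in> I" for f ab
  proof -
    have "S.lincomb f B $$ (fst ab, snd ab) = (\<Sum>b\<in>B. (f b \<cdot>\<^sub>m b) $$ (fst ab, snd ab))"
      unfolding S.lincomb_def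
      using mat_finsum[OF am SD(1) B(1), of "\<lambda>b. f b \<cdot>\<^sub>m b"] SD(3) BS that
      by (auto simp: I_def module_mat_simps subset_iff)
    also have "\<dots> = (\<Sum>b\<in>B. f b * b $$ (fst ab, snd ab))"
    proof (intro sum.cong refl)
      fix b assume "b \<in> B"
      then have "b \<in> carrier_mat d d" using BS SD(1) by blast
      then show "(f b \<cdot>\<^sub>m b) $$ (fst ab, snd ab) = f b * b $$ (fst ab, snd ab)"
        using that by (auto simp: I_def)
    qed
    finally show ?thesis by simp
  qed
  have "\<exists>f. S.lincomb f B = G ij" for ij
    using S.finite_in_span[OF B(1), of "G ij"] BS gen G by auto
  then obtain f where f: "\<And>ij. S.lincomb (f ij) B = G ij" by metis
  have coeff: "(\<Sum>ij\<in>I. b $$ ij * f ij b') = (if b = b' then 1 else 0)" if b: "b \<in> B" "b' \<in> B" for b b'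
  proof -
    define g where "g x = (\<Sum>ij\<in>I. b $$ ij * f ij x) - (if b = x then 1 else 0)" for x
    have "S.lincomb g B = 0\<^sub>m d d"
    proof (rule eq_matI)
      have "S.lincomb g B \<in> S"
        using S.lincomb_closed[of B g] BS by (auto simp: class_ring_simps)
      then have lc: "S.lincomb g B \<in> carrier_mat d d" using SD(1) by blast
      then show "dim_row (S.lincomb g B) = dim_row (0\<^sub>m d d :: complex mat)"
        "dim_col (S.lincomb g B) = dim_col (0\<^sub>m d d :: complex mat)" by auto
      fix i j assume "i < dim_row (0\<^sub>m d d :: complex mat)" "j < dim_col (0\<^sub>m d d :: complex mat)"
      then have ij: "(i, j) \<in> I" by (auto simp: I_def)
      have "b $$ (i, j) = (\<Sum>h\<in>I. b $$ h * G h $$ (i, j))"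
        using linear' b BS ij by blast
      also have "\<dots> = (\<Sum>h\<in>I. b $$ h * (\<Sum>x\<in>B. f h x * x $$ (i, j)))"
        unfolding f[symmetric] lincomb_index[OF ij] ..
      also have "\<dots> = (\<Sum>h\<in>I. \<Sum>x\<in>B. b $$ h * f h x * x $$ (i, j))"
        by (simp add: sum_distrib_left mult.assoc)
      also have "\<dots> = (\<Sum>x\<in>B. \<Sum>h\<in>I. b $$ h * f h x * x $$ (i, j))" by (rule sum.swap)
      also have "\<dots> = (\<Sum>x\<in>B. (\<Sum>h\<in>I. b $$ h * f h x) * x $$ (i, j))"
        by (simp add: sum_distrib_right)
      finally have 1: "b $$ (i, j) = (\<Sum>x\<in>B. (\<Sum>h\<in>I. b $$ h * f h x) * x $$ (i, j))" .
      have "(\<Sum>x\<in>B. (if b = x then 1 else 0) * x $$ (i, j)) = (\<Sum>x\<in>B. if b = x then x $$ (i, j) else 0)"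
        by (intro sum.cong) auto
      also have "\<dots> = b $$ (i, j)" using b B(1) by simp
      finally have 2: "(\<Sum>x\<in>B. (if b = x then 1 else 0) * x $$ (i, j)) = b $$ (i, j)" .
      have "S.lincomb g B $$ (i, j) = 0"
        unfolding lincomb_index[OF ij] g_def left_diff_distrib sum_subtractf 2 1[symmetric] by simp
      then show "S.lincomb g B $$ (i, j) = 0\<^sub>m d d $$ (i, j)" using ij by (simp add: I_def)
    qed
    then have "g b' = 0"
      using S.lin_dep_crit[of B B g b'] indep B(1) b by (auto simp: class_ring_simps module_mat_simps)
    then show ?thesis by (simp add: g_def)
  qed
  have "(\<Sum>i<d. \<Sum>j<d. F (unit_mat d i j) $$ (i, j)) = (\<Sum>ij\<in>I. G ij $$ ij)"
    by (simp add: I_def G_def sum.cartesian_product case_prod_unfold)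
  also have "\<dots> = (\<Sum>ij\<in>I. \<Sum>b\<in>B. f ij b * b $$ ij)"
    by (intro sum.cong refl) (simp add: f[symmetric] lincomb_index)
  also have "\<dots> = (\<Sum>b\<in>B. \<Sum>ij\<in>I. b $$ ij * f ij b)"
    by (subst sum.swap) (simp add: mult.commute)
  also have "\<dots> = of_nat (card B)" using coeff by simp
  finally show ?thesis unfolding dim by simp
qed

section \<open>Orthogonal projections that are bimodule maps\<close>

text \<open>
  The setting of the projection onto a quantum graph, with the left multiplications by \<open>x\<^sub>i\<close> and \<open>y\<^sub>i\<close> replaced
  by arbitrary matrices: symmetry of the tensor and the dimension formula are facts about matrices alone.
\<close>

locale bimodule_projection =
  fixes d r :: nat and S :: "complex mat set" and F :: "complex mat \<Rightarrow> complex mat"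
    and l u :: "nat \<Rightarrow> complex mat"
  assumes sub: "VectorSpace.subspace class_ring S (mat_space d)"
    and adjoint_closed: "\<And>X. X \<in> S \<Longrightarrow> mat_adjoint X \<in> S"
    and proj: "orth_projection d S F"
    and l [simp]: "\<And>i. i < r \<Longrightarrow> l i \<in> carrier_mat d d"
    and u [simp]: "\<And>i. i < r \<Longrightarrow> u i \<in> carrier_mat d d"
    and F_eq: "\<And>X. X \<in> carrier_mat d d \<Longrightarrow> F X = mat_sum_upto d r (\<lambda>i. l i * X * u i)"
begin

lemma S_carrier: "X \<in> S \<Longrightarrow> X \<in> carrier_mat d d"
  using mat_subspaceD(1)[OF sub] by blast

lemma F_in: "X \<in> carrier_mat d d \<Longrightarrow> F X \<in> S"
  using proj by (simp add: orth_projection_def)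

lemma F_carrier: "X \<in> carrier_mat d d \<Longrightarrow> F X \<in> carrier_mat d d"
  by (simp add: F_in S_carrier)

lemma F_orth:
  assumes "X \<in> carrier_mat d d" "Y \<in> S"
  shows "mat_trace (mat_adjoint Y * X) = mat_trace (mat_adjoint Y * F X)"
proof -
  have "mat_trace (mat_adjoint Y * (X - F X)) = 0"
    using proj assms by (simp add: orth_projection_def)
  moreover have "mat_adjoint Y * (X - F X) = mat_adjoint Y * X - mat_adjoint Y * F X"
    using assms F_carrier S_carrier by (intro mult_minus_distrib_mat[of _ d d]) auto
  ultimately show ?thesis
    using assms F_carrier S_carrier
    by (simp add: mat_trace_minus[of _ d] mult_carrier_mat[of _ d d])
qed

lemma F_unique:
  assumes X: "X \<in> carrier_mat d d" and W: "W \<in> S"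
    and orth: "\<And>Y. Y \<in> S \<Longrightarrow> mat_trace (mat_adjoint Y * X) = mat_trace (mat_adjoint Y * W)"
  shows "F X = W"
proof -
  define E where "E = F X - W"
  have E: "E \<in> S" unfolding E_def using F_in[OF X] W by (rule mat_subspaceD(4)[OF sub])
  have "mat_adjoint E * E = mat_adjoint E * F X - mat_adjoint E * W"
    unfolding E_def using S_carrier[OF E] S_carrier[OF W] F_carrier[OF X]
    by (intro mult_minus_distrib_mat[of _ d d]) (auto simp: E_def)
  then have "mat_trace (mat_adjoint E * E) = mat_trace (mat_adjoint E * F X) - mat_trace (mat_adjoint E * W)"
    using S_carrier[OF E] S_carrier[OF W] F_carrier[OF X]
    by (simp add: mat_trace_minus[of _ d] mult_carrier_mat[of _ d d])
  also have "\<dots> = 0" using orth[OF E] F_orth[OF X E] by simp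
  finally have "E = 0\<^sub>m d d" by (intro mat_trace_square_eq_0 S_carrier[OF E])
  have "F X $$ (i, j) = W $$ (i, j)" if "i < d" "j < d" for i j
  proof -
    have "E $$ (i, j) = 0" using \<open>E = 0\<^sub>m d d\<close> that by simp
    then show ?thesis using that S_carrier[OF W] F_carrier[OF X] by (simp add: E_def)
  qed
  then show ?thesis using S_carrier[OF W] F_carrier[OF X] by (intro eq_matI) auto
qed

lemma F_fixed: "X \<in> S \<Longrightarrow> F X = X"
  by (rule F_unique) (auto simp: S_carrier)

text \<open>
  Since \<open>S\<close> is self-adjoint, \<open>(F X)\<^sup>*\<close> has the properties that characterize \<open>F (X\<^sup>*)\<close>.
\<close>

lemma F_adjoint:
  assumes X: "X \<in> carrier_mat d d"
  shows "F (mat_adjoint X) = mat_adjoint (F X)"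
proof (rule F_unique)
  show "mat_adjoint X \<in> carrier_mat d d" using X by simp
  show "mat_adjoint (F X) \<in> S" using F_in[OF X] by (rule adjoint_closed)
  fix Y assume Y: "Y \<in> S"
  have flip: "mat_trace (mat_adjoint Y * mat_adjoint Z) = cnj (mat_trace (mat_adjoint (mat_adjoint Y) * Z))"
    if Z: "Z \<in> carrier_mat d d" for Z
  proof -
    have "mat_trace (mat_adjoint Y * mat_adjoint Z) = mat_trace (mat_adjoint (Z * Y))"
      using Z S_carrier[OF Y] by (simp add: mat_adjoint_mult[of _ d d _ d])
    also have "\<dots> = cnj (mat_trace (Z * Y))"
      using Z S_carrier[OF Y] by (intro mat_trace_adjoint) (auto intro: mult_carrier_mat)
    also have "mat_trace (Z * Y) = mat_trace (Y * Z)"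
      using Z S_carrier[OF Y] by (rule mat_trace_comm)
    finally show ?thesis by simp
  qed
  show "mat_trace (mat_adjoint Y * mat_adjoint X) = mat_trace (mat_adjoint Y * mat_adjoint (F X))"
    unfolding flip[OF X] flip[OF F_carrier[OF X]] F_orth[OF X adjoint_closed[OF Y]] ..
qed

lemma F_selfadjoint:
  assumes X: "X \<in> carrier_mat d d" and Z: "Z \<in> carrier_mat d d"
  shows "mat_trace (Z * F X) = mat_trace (F Z * X)"
proof -
  have half: "mat_trace (F Y * X') = mat_trace (F Y * F X')"
    if "Y \<in> carrier_mat d d" "X' \<in> carrier_mat d d" for X' Y
    using F_orth[OF that(2) adjoint_closed[OF F_in[OF that(1)]]] by simp
  have "mat_trace (Z * F X) = mat_trace (F X * Z)"
    using Z F_carrier[OF X] by (rule mat_trace_comm)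
  also have "\<dots> = mat_trace (F X * F Z)" by (rule half[OF X Z])
  also have "\<dots> = mat_trace (F Z * F X)"
    using F_carrier[OF X] F_carrier[OF Z] by (rule mat_trace_comm)
  also have "\<dots> = mat_trace (F Z * X)" by (rule half[OF Z X, symmetric])
  finally show ?thesis .
qed

text \<open>
  The map of the flipped tensor \<open>\<Sum>\<^sub>i u\<^sub>i \<otimes> l\<^sub>i\<close>.
\<close>

definition F' :: "complex mat \<Rightarrow> complex mat" where
  "F' X = mat_sum_upto d r (\<lambda>i. u i * X * l i)"

lemma sandwich_carrier [simp]:
  assumes "i < r" "X \<in> carrier_mat d d"
  shows "l i * X * u i \<in> carrier_mat d d" "u i * X * l i \<in> carrier_mat d d"
  using l[OF assms(1)] u[OF assms(1)] assms(2) by (meson mult_carrier_mat)+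

lemma F_index:
  assumes "X \<in> carrier_mat d d" "a < d" "b < d"
  shows "F X $$ (a, b) = (\<Sum>i<r. (l i * X * u i) $$ (a, b))"
  unfolding F_eq[OF assms(1)]
  by (rule mat_sum_upto) (use assms in auto)

lemma F'_carrier: "X \<in> carrier_mat d d \<Longrightarrow> F' X \<in> carrier_mat d d"
  unfolding F'_def by (rule mat_sum_upto) auto

lemma F'_index:
  assumes "X \<in> carrier_mat d d" "a < d" "b < d"
  shows "F' X $$ (a, b) = (\<Sum>i<r. (u i * X * l i) $$ (a, b))"
  unfolding F'_def
  by (rule mat_sum_upto) (use assms in auto)

text \<open>
  The symmetry of the tensor behind the adjacency matrix. Cyclicity of the trace moves \<open>F\<close> to the flipped map
  in \<open>tr (Z F(X))\<close>, whereas self-adjointness moves it to \<open>F\<close> itself. As \<open>X\<close> is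
  arbitrary, the two maps agree.
\<close>

lemma F_symmetric:
  assumes Z: "Z \<in> carrier_mat d d"
  shows "F Z = F' Z"
proof -
  have trace: "mat_trace (F' Z * X) = mat_trace (F Z * X)" if X: "X \<in> carrier_mat d d" for X
  proof -
    have "mat_trace (F' Z * X) = (\<Sum>a<d. \<Sum>b<d. \<Sum>i<r. (u i * Z * l i) $$ (a, b) * X $$ (b, a))"
      using F'_carrier[OF Z] X Z by (simp add: mat_trace_mult F'_index sum_distrib_right)
    also have "\<dots> = (\<Sum>a<d. \<Sum>i<r. \<Sum>b<d. (u i * Z * l i) $$ (a, b) * X $$ (b, a))"
      by (intro sum.cong refl sum.swap)
    also have "\<dots> = (\<Sum>i<r. \<Sum>a<d. \<Sum>b<d. (u i * Z * l i) $$ (a, b) * X $$ (b, a))"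
      by (rule sum.swap)
    also have "\<dots> = (\<Sum>i<r. mat_trace (u i * Z * l i * X))"
      using X Z by (intro sum.cong refl mat_trace_mult[symmetric]) auto
    also have "\<dots> = (\<Sum>i<r. mat_trace (Z * (l i * X * u i)))"
    proof (intro sum.cong refl)
      fix i assume "i \<in> {..<r}"
      then have i: "i < r" by simp
      have "mat_trace (u i * Z * l i * X) = mat_trace (u i * (Z * (l i * X)))"
        using i X Z by (simp add: assoc_mult_mat[of _ d d _ d _ d] mult_carrier_mat[of _ d d])
      also have "\<dots> = mat_trace (Z * (l i * X) * u i)"
        using i X Z by (intro mat_trace_comm[of _ d]) (auto intro: mult_carrier_mat[of _ d d])
      finally show "mat_trace (u i * Z * l i * X) = mat_trace (Z * (l i * X * u i))"
        using i X Z by (simp add: assoc_mult_mat[of _ d d _ d _ d] mult_carrier_mat[of _ d d])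
    qed
    also have "\<dots> = (\<Sum>i<r. \<Sum>a<d. \<Sum>b<d. Z $$ (a, b) * (l i * X * u i) $$ (b, a))"
      using X Z by (intro sum.cong refl mat_trace_mult) auto
    also have "\<dots> = (\<Sum>a<d. \<Sum>i<r. \<Sum>b<d. Z $$ (a, b) * (l i * X * u i) $$ (b, a))"
      by (rule sum.swap)
    also have "\<dots> = (\<Sum>a<d. \<Sum>b<d. \<Sum>i<r. Z $$ (a, b) * (l i * X * u i) $$ (b, a))"
      by (intro sum.cong refl sum.swap)
    also have "\<dots> = mat_trace (Z * F X)"
      using F_carrier[OF X] X Z by (simp add: mat_trace_mult F_index sum_distrib_left)
    also have "\<dots> = mat_trace (F Z * X)" by (rule F_selfadjoint[OF X Z])
    finally show ?thesis .
  qed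
  have "F' Z $$ (a, b) = F Z $$ (a, b)" if ab: "a < d" "b < d" for a b
  proof -
    have pick: "mat_trace (Y * unit_mat d b a) = Y $$ (a, b)" if Y: "Y \<in> carrier_mat d d" for Y
    proof -
      have "mat_trace (Y * unit_mat d b a) = (\<Sum>i<d. \<Sum>j<d. if j = b then (if i = a then Y $$ (i, j) else 0) else 0)"
        unfolding mat_trace_mult[OF Y unit_mat_carrier]
        by (intro sum.cong refl) (auto simp: unit_mat_def)
      then show ?thesis using ab by simp
    qed
    show ?thesis using trace[of "unit_mat d b a"] pick F_carrier[OF Z] F'_carrier[OF Z] by simp
  qed
  then show ?thesis using F_carrier[OF Z] F'_carrier[OF Z] by (intro eq_matI) auto
qed

text \<open>
  The trace of \<open>X \<mapsto> l X u\<close> on matrices is \<open>tr l \<cdot> tr u\<close>.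
\<close>

lemma dim_eq: "of_nat (mat_dim d S) = (\<Sum>i<r. mat_trace (l i) * mat_trace (u i))"
proof -
  have triple: "(X * Y * Z) $$ (a, b) = (\<Sum>i<d. \<Sum>j<d. Y $$ (i, j) * (X $$ (a, i) * Z $$ (j, b)))"
    if "X \<in> carrier_mat d d" "Y \<in> carrier_mat d d" "Z \<in> carrier_mat d d" "a < d" "b < d"
    for X Y Z :: "complex mat" and a b
  proof -
    have "(X * Y * Z) $$ (a, b) = (\<Sum>j<d. (X * Y) $$ (a, j) * Z $$ (j, b))"
      by (rule mat_mult_index) (use that in \<open>auto intro: mult_carrier_mat\<close>)
    also have "\<dots> = (\<Sum>j<d. (\<Sum>i<d. X $$ (a, i) * Y $$ (i, j)) * Z $$ (j, b))"
      by (intro sum.cong refl) (subst mat_mult_index[OF that(1,2)], use that in auto)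
    also have "\<dots> = (\<Sum>j<d. \<Sum>i<d. Y $$ (i, j) * (X $$ (a, i) * Z $$ (j, b)))"
      unfolding sum_distrib_right by (intro sum.cong refl) simp
    also have "\<dots> = (\<Sum>i<d. \<Sum>j<d. Y $$ (i, j) * (X $$ (a, i) * Z $$ (j, b)))"
      by (rule sum.swap)
    finally show ?thesis .
  qed
  have unit_entry: "(l h * unit_mat d i j * u h) $$ (a, b) = l h $$ (a, i) * u h $$ (j, b)"
    if "h < r" "a < d" "b < d" "i < d" "j < d" for h a b i j
  proof -
    have "(l h * unit_mat d i j * u h) $$ (a, b)
        = (\<Sum>i'<d. \<Sum>j'<d. if j' = j then (if i' = i then l h $$ (a, i') * u h $$ (j', b) else 0) else 0)"
      unfolding triple[OF l[OF that(1)] unit_mat_carrier u[OF that(1)] that(2,3)]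
      by (intro sum.cong refl) (auto simp: unit_mat_def)
    then show ?thesis using that by simp
  qed
  have "of_nat (mat_dim d S) = (\<Sum>i<d. \<Sum>j<d. F (unit_mat d i j) $$ (i, j))"
  proof (rule dim_eq_projection_trace[OF sub F_in F_fixed])
    fix X :: "complex mat" and a b assume X: "X \<in> carrier_mat d d" and ab: "a < d" "b < d"
    have "F X $$ (a, b) = (\<Sum>h<r. \<Sum>i<d. \<Sum>j<d. X $$ (i, j) * (l h $$ (a, i) * u h $$ (j, b)))"
      using X ab by (simp add: F_index triple)
    also have "\<dots> = (\<Sum>i<d. \<Sum>h<r. \<Sum>j<d. X $$ (i, j) * (l h $$ (a, i) * u h $$ (j, b)))"
      by (rule sum.swap)
    also have "\<dots> = (\<Sum>i<d. \<Sum>j<d. \<Sum>h<r. X $$ (i, j) * (l h $$ (a, i) * u h $$ (j, b)))"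
      by (intro sum.cong refl sum.swap)
    also have "\<dots> = (\<Sum>i<d. \<Sum>j<d. X $$ (i, j) * F (unit_mat d i j) $$ (a, b))"
      using ab by (simp add: F_index unit_entry sum_distrib_left)
    finally show "F X $$ (a, b) = (\<Sum>i<d. \<Sum>j<d. X $$ (i, j) * F (unit_mat d i j) $$ (a, b))" .
  qed
  also have "\<dots> = (\<Sum>i<d. \<Sum>j<d. \<Sum>h<r. l h $$ (i, i) * u h $$ (j, j))"
    by (simp add: F_index unit_entry)
  also have "\<dots> = (\<Sum>i<d. \<Sum>h<r. \<Sum>j<d. l h $$ (i, i) * u h $$ (j, j))"
    by (intro sum.cong refl sum.swap)
  also have "\<dots> = (\<Sum>h<r. \<Sum>i<d. \<Sum>j<d. l h $$ (i, i) * u h $$ (j, j))" by (rule sum.swap)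
  also have "\<dots> = (\<Sum>h<r. mat_trace (l h) * mat_trace (u h))"
    by (intro sum.cong refl) (simp add: mat_trace_eq[of _ d] sum_product)
  finally show ?thesis .
qed

end

section \<open>Coordinates on \<open>L\<^sup>2(M)\<close>\<close>

locale L2_algebra =
  fixes ns :: "nat list"
  assumes nonempty: "ns \<noteq> []" and pos: "\<forall>n\<in>set ns. n > 0"
begin

abbreviation m :: nat where "m \<equiv> alg_size ns"
abbreviation d :: nat where "d \<equiv> alg_dim ns"

text \<open>
  The \<open>r\<close>-th basis vector is \<open>sc\<close> times the matrix unit at \<open>(rix r, cix r)\<close>. As \<open>sc\<close> depends only on the
  block, it cancels in the matrices of multiplication operators, whose entries are then entries of the algebra
  elements themselves.
\<close>

definition rix :: "nat \<Rightarrow> nat" where "rix r = fst (L2_index ns ! r)"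
definition cix :: "nat \<Rightarrow> nat" where "cix r = snd (L2_index ns ! r)"
definition sc :: "nat \<Rightarrow> complex" where
  "sc p = complex_of_real (sqrt (real d / real (ns ! block ns p)))"

lemma d_pos: "d > 0"
proof -
  obtain n ns' where ns: "ns = n # ns'" using nonempty by (cases ns) auto
  then show ?thesis using pos by (simp add: alg_dim_def)
qed

lemma set_L2_index: "set (L2_index ns) = {(p, q). p < m \<and> q < m \<and> block ns p = block ns q}"
  by (auto simp: L2_index_def)

lemma ix:
  assumes "r < d"
  shows "rix r < m" "cix r < m" "block ns (cix r) = block ns (rix r)"
proof -
  have "L2_index ns ! r \<in> set (L2_index ns)" using assms by (simp add: length_L2_index)
  then show "rix r < m" "cix r < m" "block ns (cix r) = block ns (rix r)"
    unfolding set_L2_index rix_def cix_def by auto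
qed

lemma ix_surj:
  assumes "p < m" "q < m" "block ns p = block ns q"
  obtains r where "r < d" "rix r = p" "cix r = q"
proof -
  have "(p, q) \<in> set (L2_index ns)" using assms by (simp add: set_L2_index)
  then show ?thesis using that by (auto simp: in_set_conv_nth length_L2_index rix_def cix_def)
qed

text \<open>
  Basis indices enumerate the pairs of positions within one block.
\<close>

lemma sum_ix:
  fixes f :: "nat \<Rightarrow> nat \<Rightarrow> 'a :: comm_monoid_add"
  shows "(\<Sum>r<d. f (rix r) (cix r)) = (\<Sum>p<m. \<Sum>q<m. if block ns p = block ns q then f p q else 0)"
proof -
  have dist: "distinct (L2_index ns)" by (simp add: L2_index_def distinct_product)
  have "(\<Sum>r<d. f (rix r) (cix r)) = (\<Sum>r<d. case_prod f (L2_index ns ! r))"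
    by (simp add: rix_def cix_def case_prod_unfold)
  also have "\<dots> = (\<Sum>pq\<in>set (L2_index ns). case_prod f pq)"
    using bij_betw_nth[OF dist, of "{..<d}"]
    by (intro sum.reindex_bij_betw) (simp add: length_L2_index)
  also have "set (L2_index ns) = {pq \<in> {..<m} \<times> {..<m}. block ns (fst pq) = block ns (snd pq)}"
    by (auto simp: set_L2_index)
  also have "(\<Sum>pq\<in>\<dots>. case_prod f pq)
      = (\<Sum>pq\<in>{..<m} \<times> {..<m}. if block ns (fst pq) = block ns (snd pq) then case_prod f pq else 0)"
    by (rule sum.inter_filter) simp
  also have "\<dots> = (\<Sum>(p, q)\<in>{..<m} \<times> {..<m}. if block ns p = block ns q then f p q else 0)"
    by (intro sum.cong refl) (simp add: case_prod_unfold)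
  finally show ?thesis by (simp add: sum.cartesian_product)
qed

lemma sum_ix_diag:
  fixes f :: "nat \<Rightarrow> 'a :: comm_monoid_add"
  shows "(\<Sum>r<d. if rix r = cix r then f (rix r) else 0) = (\<Sum>p<m. f p)"
proof -
  have "(\<Sum>r<d. if rix r = cix r then f (rix r) else 0)
      = (\<Sum>p<m. \<Sum>q<m. if block ns p = block ns q then if p = q then f p else 0 else 0)"
    by (rule sum_ix)
  also have "\<dots> = (\<Sum>p<m. \<Sum>q<m. if p = q then f p else 0)"
    by (intro sum.cong refl) auto
  finally show ?thesis by simp
qed

lemma sum_ix_single:
  fixes f :: "nat \<Rightarrow> nat \<Rightarrow> 'a :: comm_monoid_add"
  assumes "p0 < m" "q0 < m"
  shows "(\<Sum>r<d. if rix r = p0 \<and> cix r = q0 then f (rix r) (cix r) else 0)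
    = (if block ns p0 = block ns q0 then f p0 q0 else 0)"
proof -
  have "(\<Sum>r<d. if rix r = p0 \<and> cix r = q0 then f (rix r) (cix r) else 0)
      = (\<Sum>p<m. \<Sum>q<m. if block ns p = block ns q then if p = p0 \<and> q = q0 then f p q else 0 else 0)"
    by (rule sum_ix)
  also have "\<dots> = (\<Sum>p<m. \<Sum>q<m. if q = q0 then if p = p0 then if block ns p0 = block ns q0 then f p0 q0 else 0 else 0 else 0)"
    by (intro sum.cong refl) auto
  finally show ?thesis using assms by simp
qed

lemma card_block:
  assumes "p < m"
  shows "card {q. q < m \<and> block ns p = block ns q} = ns ! block ns p"
proof -
  define L where "L = concat (map (\<lambda>i. replicate (ns ! i) i) [0..<length ns])"
  have len: "length L = m" unfolding L_def by (rule concat_labels_length)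
  have "count_list (concat (map (\<lambda>i. replicate (ns ! i) i) [0..<k])) j = (if j < k then ns ! j else 0)" for j k
    by (induction k) (auto simp: count_list_eq_length_filter less_Suc_eq)
  then have "ns ! block ns p = count_list L (block ns p)"
    using block_less[OF assms] by (simp add: L_def)
  also have "\<dots> = card {q. q < m \<and> block ns p = block ns q}"
    unfolding count_list_eq_length_filter length_filter_conv_card len
    by (simp add: block_def L_def)
  finally show ?thesis by simp
qed

lemma sum_block: "(\<Sum>q<m. if block ns p = block ns q then x else 0) = of_nat (ns ! block ns p) * (x :: complex)"
  if "p < m"
proof -
  have "(\<Sum>q<m. if block ns p = block ns q then x else 0) = (\<Sum>q\<in>{q\<in>{..<m}. block ns p = block ns q}. x)"
    by (rule sum.inter_filter[symmetric]) simp
  also have "{q\<in>{..<m}. block ns p = block ns q} = {q. q < m \<and> block ns p = block ns q}" by auto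
  finally show ?thesis by (simp add: card_block[OF that])
qed

lemma block_pos: "p < m \<Longrightarrow> ns ! block ns p > 0"
  using pos block_less[of p ns] by auto

lemma sc_nonzero: "p < m \<Longrightarrow> sc p \<noteq> 0"
  using block_pos[of p] d_pos by (simp add: sc_def)

lemma sc_square: "p < m \<Longrightarrow> 1 / (sc p * sc p) = of_nat (ns ! block ns p) / of_nat d"
  using block_pos[of p] d_pos unfolding sc_def by (simp flip: of_real_mult)

lemma cnj_sc [simp]: "cnj (sc p) = sc p"
  by (simp add: sc_def)

lemma sc_block: "block ns p = block ns q \<Longrightarrow> sc p = sc q"
  by (simp add: sc_def)

lemma psi_eq: "psi ns x = (\<Sum>p<m. x $$ (p, p) / (sc p * sc p))"
proof -
  have "(\<Sum>p<m. x $$ (p, p) / (sc p * sc p)) = (\<Sum>p<m. of_nat (ns ! block ns p) * x $$ (p, p) / of_nat d)"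
  proof (intro sum.cong refl)
    fix p assume "p \<in> {..<m}"
    then have "x $$ (p, p) * (1 / (sc p * sc p)) = x $$ (p, p) * (of_nat (ns ! block ns p) / of_nat d)"
      by (simp only: sc_square lessThan_iff)
    then show "x $$ (p, p) / (sc p * sc p) = of_nat (ns ! block ns p) * x $$ (p, p) / of_nat d"
      by (simp add: mult.commute)
  qed
  then show ?thesis by (simp add: psi_def sum_divide_distrib)
qed

lemma sum_weights: "(\<Sum>p<m. 1 / (sc p * sc p)) = 1"
proof -
  have "of_nat d = (\<Sum>r<d. 1 :: complex)" by simp
  also have "\<dots> = (\<Sum>p<m. \<Sum>q<m. if block ns p = block ns q then 1 else 0)" by (rule sum_ix)
  also have "\<dots> = (\<Sum>p<m. of_nat (ns ! block ns p))" by (intro sum.cong refl) (simp add: sum_block)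
  finally have "(\<Sum>p<m. of_nat (ns ! block ns p)) = (of_nat d :: complex)" by (rule sym)
  then have "(\<Sum>p<m. of_nat (ns ! block ns p) / of_nat d) = (1 :: complex)"
    using d_pos by (simp add: sum_divide_distrib[symmetric])
  then show ?thesis by (simp add: sc_square)
qed

lemma L2_basis_index:
  assumes "i < m" "j < m"
  shows "L2_basis ns r $$ (i, j) = (if i = rix r \<and> j = cix r then sc (rix r) else 0)"
  using assms by (auto simp: L2_basis_def rix_def cix_def sc_def prod_eq_iff)

lemma L2_basis_carrier [simp]: "L2_basis ns r \<in> carrier_mat m m"
  by (simp add: L2_basis_def)

lemma alg_carrier: "x \<in> alg ns \<Longrightarrow> x \<in> carrier_mat m m"
  by (simp add: alg_def)

lemma mult_basis_index:
  assumes "x \<in> carrier_mat m m" "s < d" "i < m" "j < m"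
  shows "(x * L2_basis ns s) $$ (i, j) = (if j = cix s then x $$ (i, rix s) * sc (rix s) else 0)"
proof -
  have "(x * L2_basis ns s) $$ (i, j) = (\<Sum>t<m. x $$ (i, t) * L2_basis ns s $$ (t, j))"
    by (rule mat_mult_index[OF assms(1) L2_basis_carrier assms(3,4)])
  also have "\<dots> = (\<Sum>t<m. if t = rix s then if j = cix s then x $$ (i, rix s) * sc (rix s) else 0 else 0)"
    by (intro sum.cong refl) (use assms in \<open>auto simp: L2_basis_index\<close>)
  finally show ?thesis using ix[OF assms(2)] by simp
qed

lemma basis_mult_index:
  assumes "x \<in> carrier_mat m m" "s < d" "i < m" "j < m"
  shows "(L2_basis ns s * x) $$ (i, j) = (if i = rix s then sc (rix s) * x $$ (cix s, j) else 0)"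
proof -
  have "(L2_basis ns s * x) $$ (i, j) = (\<Sum>t<m. L2_basis ns s $$ (i, t) * x $$ (t, j))"
    by (rule mat_mult_index[OF L2_basis_carrier assms(1) assms(3,4)])
  also have "\<dots> = (\<Sum>t<m. if t = cix s then if i = rix s then sc (rix s) * x $$ (cix s, j) else 0 else 0)"
    by (intro sum.cong refl) (use assms in \<open>auto simp: L2_basis_index\<close>)
  finally show ?thesis using ix[OF assms(2)] by simp
qed

lemma coordinate:
  assumes z: "z \<in> carrier_mat m m" and r: "r < d"
  shows "L2_inner ns z (L2_basis ns r) = z $$ (rix r, cix r) / sc (rix r)"
proof -
  have "(mat_adjoint (L2_basis ns r) * z) $$ (t, t) = (if t = cix r then sc (rix r) * z $$ (rix r, cix r) else 0)"
    if t: "t < m" for t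
  proof -
    have "(mat_adjoint (L2_basis ns r) * z) $$ (t, t) = (\<Sum>u<m. mat_adjoint (L2_basis ns r) $$ (t, u) * z $$ (u, t))"
      by (rule mat_mult_index[OF mat_adjoint_carrier[OF L2_basis_carrier] z t t])
    also have "\<dots> = (\<Sum>u<m. cnj (L2_basis ns r $$ (u, t)) * z $$ (u, t))"
      using t carrier_matD[OF L2_basis_carrier] by (intro sum.cong refl) auto
    also have "\<dots> = (\<Sum>u<m. if u = rix r then if t = cix r then sc (rix r) * z $$ (rix r, cix r) else 0 else 0)"
      by (intro sum.cong refl) (use t in \<open>auto simp: L2_basis_index\<close>)
    finally show ?thesis using ix[OF r] by simp
  qed
  then have "L2_inner ns z (L2_basis ns r)
      = (\<Sum>t<m. (if t = cix r then sc (rix r) * z $$ (rix r, cix r) else 0) / (sc t * sc t))"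
    unfolding L2_inner_def psi_eq by (intro sum.cong refl) auto
  also have "\<dots> = (\<Sum>t<m. if t = cix r then sc (rix r) * z $$ (rix r, cix r) / (sc t * sc t) else 0)"
    by (intro sum.cong refl) auto
  also have "\<dots> = sc (rix r) * z $$ (rix r, cix r) / (sc (rix r) * sc (rix r))"
    using ix[OF r] sc_block[of "cix r" "rix r"] by simp
  finally show ?thesis using sc_nonzero[OF ix(1)[OF r]] by simp
qed

lemma L2_op_index:
  assumes "f (L2_basis ns s) \<in> carrier_mat m m" "r < d" "s < d"
  shows "L2_op ns f $$ (r, s) = f (L2_basis ns s) $$ (rix r, cix r) / sc (rix r)"
  using assms by (simp add: L2_op_def coordinate)

lemma L2_op_carrier [simp]: "L2_op ns f \<in> carrier_mat d d"
  by (simp add: L2_op_def)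

lemma left_mult_carrier [simp]: "left_mult ns x \<in> carrier_mat d d"
  by (simp add: left_mult_def)

lemma left_mult_index:
  assumes x: "x \<in> carrier_mat m m" and rs: "r < d" "s < d"
  shows "left_mult ns x $$ (r, s) = (if cix r = cix s then x $$ (rix r, rix s) else 0)"
proof -
  have "left_mult ns x $$ (r, s) = (if cix r = cix s then x $$ (rix r, rix s) * sc (rix s) else 0) / sc (rix r)"
    unfolding left_mult_def using x rs ix[OF rs(1)]
    by (subst L2_op_index) (auto simp: mult_basis_index mult_carrier_mat[of _ m m])
  moreover have "sc (rix s) = sc (rix r)" if "cix r = cix s"
    using ix(3)[OF rs(1)] ix(3)[OF rs(2)] that by (intro sc_block) simp
  ultimately show ?thesis using sc_nonzero[OF ix(1)[OF rs(1)]] by auto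
qed

lemma right_mult_index:
  assumes x: "x \<in> carrier_mat m m" and rs: "r < d" "s < d"
  shows "L2_op ns (\<lambda>z. z * x) $$ (r, s) = (if rix r = rix s then x $$ (cix s, cix r) else 0)"
  using x rs ix[OF rs(1)] sc_nonzero[OF ix(1)[OF rs(1)]]
  by (subst L2_op_index) (auto simp: basis_mult_index mult_carrier_mat[of _ m m])

text \<open>
  In coordinates either product reduces to a single index, valid under the same condition on blocks.
\<close>

lemma right_left_commute:
  assumes a: "a \<in> carrier_mat m m" and x: "x \<in> carrier_mat m m"
  shows "L2_op ns (\<lambda>z. z * a) * left_mult ns x = left_mult ns x * L2_op ns (\<lambda>z. z * a)"
proof (rule eq_matI)
  let ?R = "L2_op ns (\<lambda>z. z * a)"
  fix r s assume "r < dim_row (left_mult ns x * ?R)" "s < dim_col (left_mult ns x * ?R)"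
  then have rs: "r < d" "s < d"
    using carrier_matD[OF left_mult_carrier] carrier_matD[OF L2_op_carrier] by auto
  note i = ix[OF rs(1)] ix[OF rs(2)]
  have "(?R * left_mult ns x) $$ (r, s) = (\<Sum>t<d. ?R $$ (r, t) * left_mult ns x $$ (t, s))"
    by (rule mat_mult_index[OF L2_op_carrier left_mult_carrier rs])
  also have "\<dots> = (\<Sum>t<d. if rix t = rix r \<and> cix t = cix s then a $$ (cix t, cix r) * x $$ (rix t, rix s) else 0)"
    by (intro sum.cong refl) (use rs in \<open>auto simp: right_mult_index[OF a] left_mult_index[OF x]\<close>)
  also have "\<dots> = (if block ns (rix r) = block ns (cix s) then a $$ (cix s, cix r) * x $$ (rix r, rix s) else 0)"
    by (rule sum_ix_single[OF i(1,5), of "\<lambda>p q. a $$ (q, cix r) * x $$ (p, rix s)"])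
  finally have 1: "(?R * left_mult ns x) $$ (r, s)
      = (if block ns (rix r) = block ns (rix s) then a $$ (cix s, cix r) * x $$ (rix r, rix s) else 0)"
    using i by simp
  have "(left_mult ns x * ?R) $$ (r, s) = (\<Sum>t<d. left_mult ns x $$ (r, t) * ?R $$ (t, s))"
    by (rule mat_mult_index[OF left_mult_carrier L2_op_carrier rs])
  also have "\<dots> = (\<Sum>t<d. if rix t = rix s \<and> cix t = cix r then a $$ (cix s, cix t) * x $$ (rix r, rix t) else 0)"
    by (intro sum.cong refl) (use rs in \<open>auto simp: right_mult_index[OF a] left_mult_index[OF x]\<close>)
  also have "\<dots> = (if block ns (rix s) = block ns (cix r) then a $$ (cix s, cix r) * x $$ (rix r, rix s) else 0)"
    by (rule sum_ix_single[OF i(4,2), of "\<lambda>p q. a $$ (cix s, q) * x $$ (rix r, p)"])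
  finally have 2: "(left_mult ns x * ?R) $$ (r, s)
      = (if block ns (rix r) = block ns (rix s) then a $$ (cix s, cix r) * x $$ (rix r, rix s) else 0)"
    using i by (metis (no_types))
  show "(?R * left_mult ns x) $$ (r, s) = (left_mult ns x * ?R) $$ (r, s)" unfolding 1 2 ..
qed (simp_all add: L2_op_def left_mult_def)

text \<open>
  The coordinate vector of the unit of the algebra.
\<close>

definition one_vec :: "nat \<Rightarrow> complex" where
  "one_vec r = (if rix r = cix r then 1 / sc (rix r) else 0)"

lemma cnj_one_vec [simp]: "cnj (one_vec r) = one_vec r"
  by (simp add: one_vec_def)

lemma one_vec_norm: "sesq d (1\<^sub>m d) one_vec one_vec = 1"
proof -
  have "sesq d (1\<^sub>m d) one_vec one_vec = (\<Sum>r<d. if rix r = cix r then 1 / (sc (rix r) * sc (rix r)) else 0)"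
    unfolding sesq_one by (intro sum.cong refl) (simp add: one_vec_def)
  also have "\<dots> = (\<Sum>p<m. 1 / (sc p * sc p))"
    by (rule sum_ix_diag[of "\<lambda>p. 1 / (sc p * sc p)"])
  finally show ?thesis using sum_weights by simp
qed

lemma left_mult_one_vec:
  assumes x: "x \<in> carrier_mat m m" and r: "r < d"
  shows "(\<Sum>s<d. left_mult ns x $$ (r, s) * one_vec s) = x $$ (rix r, cix r) / sc (rix r)"
    "(\<Sum>s<d. one_vec s * left_mult ns x $$ (s, r)) = x $$ (cix r, rix r) / sc (rix r)"
proof -
  note i = ix[OF r]
  have "(\<Sum>s<d. left_mult ns x $$ (r, s) * one_vec s)
      = (\<Sum>s<d. if rix s = cix r \<and> cix s = cix r then x $$ (rix r, rix s) / sc (rix s) else 0)"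
    by (intro sum.cong refl) (use r in \<open>auto simp: left_mult_index[OF x] one_vec_def\<close>)
  also have "\<dots> = x $$ (rix r, cix r) / sc (cix r)"
    by (subst sum_ix_single[OF i(2,2), of "\<lambda>p q. x $$ (rix r, p) / sc p"]) simp
  also have "sc (cix r) = sc (rix r)" using i by (intro sc_block) simp
  finally show "(\<Sum>s<d. left_mult ns x $$ (r, s) * one_vec s) = x $$ (rix r, cix r) / sc (rix r)" .
  have "(\<Sum>s<d. one_vec s * left_mult ns x $$ (s, r))
      = (\<Sum>s<d. if rix s = cix r \<and> cix s = cix r then x $$ (rix s, rix r) / sc (rix s) else 0)"
    by (intro sum.cong refl) (use r in \<open>auto simp: left_mult_index[OF x] one_vec_def\<close>)
  also have "\<dots> = x $$ (cix r, rix r) / sc (cix r)"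
    by (subst sum_ix_single[OF i(2,2), of "\<lambda>p q. x $$ (p, rix r) / sc p"]) simp
  also have "sc (cix r) = sc (rix r)" using i by (intro sc_block) simp
  finally show "(\<Sum>s<d. one_vec s * left_mult ns x $$ (s, r)) = x $$ (cix r, rix r) / sc (rix r)" .
qed

lemma one_vec_psi:
  "(\<Sum>r<d. one_vec r * (x $$ (rix r, cix r) / sc (rix r))) = psi ns x"
  "(\<Sum>r<d. one_vec r * (x $$ (cix r, rix r) / sc (rix r))) = psi ns x"
proof -
  have "(\<Sum>r<d. one_vec r * (x $$ (rix r, cix r) / sc (rix r)))
      = (\<Sum>r<d. if rix r = cix r then x $$ (rix r, rix r) / (sc (rix r) * sc (rix r)) else 0)"
    by (intro sum.cong refl) (simp add: one_vec_def)
  moreover have "(\<Sum>r<d. one_vec r * (x $$ (cix r, rix r) / sc (rix r)))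
      = (\<Sum>r<d. if rix r = cix r then x $$ (rix r, rix r) / (sc (rix r) * sc (rix r)) else 0)"
    by (intro sum.cong refl) (simp add: one_vec_def)
  moreover have "(\<Sum>r<d. if rix r = cix r then x $$ (rix r, rix r) / (sc (rix r) * sc (rix r)) else 0) = psi ns x"
    unfolding psi_eq by (rule sum_ix_diag[of "\<lambda>p. x $$ (p, p) / (sc p * sc p)"])
  ultimately show "(\<Sum>r<d. one_vec r * (x $$ (rix r, cix r) / sc (rix r))) = psi ns x"
    "(\<Sum>r<d. one_vec r * (x $$ (cix r, rix r) / sc (rix r))) = psi ns x" by simp_all
qed

lemma psi_mult_basis:
  assumes x: "x \<in> carrier_mat m m" and s: "s < d"
  shows "psi ns (x * L2_basis ns s) = x $$ (cix s, rix s) / sc (rix s)"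
proof -
  note i = ix[OF s]
  have "psi ns (x * L2_basis ns s) = (\<Sum>p<m. if p = cix s then x $$ (p, rix s) * sc (rix s) / (sc p * sc p) else 0)"
    unfolding psi_eq by (intro sum.cong refl) (auto simp: mult_basis_index[OF x s])
  also have "\<dots> = x $$ (cix s, rix s) * sc (rix s) / (sc (rix s) * sc (rix s))"
    using i sc_block[OF i(3)] by simp
  finally show ?thesis using sc_nonzero[OF i(1)] by simp
qed

text \<open>
  Diagonal position \<open>p\<close> is counted once for each position in its block, which produces the weights of \<open>\<psi>\<close>.
\<close>

lemma trace_left_mult:
  assumes x: "x \<in> carrier_mat m m"
  shows "mat_trace (left_mult ns x) = of_nat d * psi ns x"
proof -
  have "mat_trace (left_mult ns x) = (\<Sum>r<d. x $$ (rix r, rix r))"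
    by (simp add: mat_trace_eq[OF left_mult_carrier] left_mult_index[OF x])
  also have "\<dots> = (\<Sum>p<m. \<Sum>q<m. if block ns p = block ns q then x $$ (p, p) else 0)"
    by (rule sum_ix)
  also have "\<dots> = (\<Sum>p<m. of_nat (ns ! block ns p) * x $$ (p, p))"
    by (intro sum.cong refl) (simp add: sum_block)
  also have "\<dots> = of_nat d * psi ns x" using d_pos by (simp add: psi_def)
  finally show ?thesis .
qed

text \<open>
  The rank-one operator \<open>\<bar>1\<rangle>\<langle>1\<bar>\<close>.
\<close>

definition one_proj :: "complex mat" where
  "one_proj = mat d d (\<lambda>(r, s). one_vec r * one_vec s)"

lemma one_proj_carrier [simp]: "one_proj \<in> carrier_mat d d"
  by (simp add: one_proj_def)

lemma one_proj_adjoint: "mat_adjoint one_proj = one_proj"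
  by (rule eq_matI) (auto simp: one_proj_def mult.commute)

lemma sandwich_one_proj:
  assumes x: "x \<in> carrier_mat m m" and y: "y \<in> carrier_mat m m" and rs: "r < d" "s < d"
  shows "(left_mult ns y * one_proj * left_mult ns x) $$ (r, s)
    = (y $$ (rix r, cix r) / sc (rix r)) * (x $$ (cix s, rix s) / sc (rix s))"
proof -
  have in1: "(left_mult ns y * one_proj) $$ (r, t) = (y $$ (rix r, cix r) / sc (rix r)) * one_vec t" if t: "t < d" for t
  proof -
    have "(left_mult ns y * one_proj) $$ (r, t) = (\<Sum>h<d. left_mult ns y $$ (r, h) * one_proj $$ (h, t))"
      by (rule mat_mult_index[OF left_mult_carrier one_proj_carrier rs(1) t])
    also have "\<dots> = (\<Sum>h<d. left_mult ns y $$ (r, h) * one_vec h) * one_vec t"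
      unfolding sum_distrib_right using t by (intro sum.cong refl) (simp add: one_proj_def)
    finally show ?thesis unfolding left_mult_one_vec(1)[OF y rs(1)] .
  qed
  have "(left_mult ns y * one_proj * left_mult ns x) $$ (r, s)
      = (\<Sum>t<d. (left_mult ns y * one_proj) $$ (r, t) * left_mult ns x $$ (t, s))"
    by (rule mat_mult_index[OF mult_carrier_mat[OF left_mult_carrier one_proj_carrier] left_mult_carrier rs])
  also have "\<dots> = (y $$ (rix r, cix r) / sc (rix r)) * (\<Sum>t<d. one_vec t * left_mult ns x $$ (t, s))"
    unfolding sum_distrib_left by (intro sum.cong refl) (simp add: in1)
  finally show ?thesis unfolding left_mult_one_vec(2)[OF x rs(2)] .
qed

end

section \<open>The adjacency and degree matrices\<close>

locale quantum_adjacency_data = L2_algebra ns + bimodule_projection "alg_dim ns" r S F "\<lambda>i. left_mult ns (x i)" "\<lambda>i. left_mult ns (y i)"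
  for ns r S F and x y :: "nat \<Rightarrow> complex mat" +
  fixes A :: "complex mat \<Rightarrow> complex mat"
  assumes x_alg: "\<And>i. i < r \<Longrightarrow> x i \<in> alg ns" and y_alg: "\<And>i. i < r \<Longrightarrow> y i \<in> alg ns"
    and A_eq: "\<And>z. z \<in> alg ns \<Longrightarrow> A z = of_nat (alg_dim ns) \<cdot>\<^sub>m
           mat_sum_upto (alg_size ns) r (\<lambda>i. psi ns (x i * z) \<cdot>\<^sub>m y i)"
begin

abbreviation Adj :: "complex mat" where "Adj \<equiv> adjacency_matrix ns A"
abbreviation Deg :: "complex mat" where "Deg \<equiv> degree_matrix ns A"
abbreviation deg :: "complex mat" where "deg \<equiv> A (alg_one ns)"

lemma xy_carrier [simp]: "i < r \<Longrightarrow> x i \<in> carrier_mat m m" "i < r \<Longrightarrow> y i \<in> carrier_mat m m"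
  using x_alg y_alg alg_carrier by auto

lemma A_carrier: "z \<in> alg ns \<Longrightarrow> A z \<in> carrier_mat m m"
  unfolding A_eq by (intro smult_carrier_mat mat_sum_upto) auto

lemma A_index:
  assumes "z \<in> alg ns" "i < m" "j < m"
  shows "A z $$ (i, j) = of_nat d * (\<Sum>k<r. psi ns (x k * z) * y k $$ (i, j))"
proof -
  have c: "mat_sum_upto m r (\<lambda>i. psi ns (x i * z) \<cdot>\<^sub>m y i) \<in> carrier_mat m m"
    by (rule mat_sum_upto) simp
  have "(psi ns (x k * z) \<cdot>\<^sub>m y k) $$ (i, j) = psi ns (x k * z) * y k $$ (i, j)" if "k < r" for k
    using carrier_matD[OF xy_carrier(2)[OF that]] assms by simp
  then have "mat_sum_upto m r (\<lambda>i. psi ns (x i * z) \<cdot>\<^sub>m y i) $$ (i, j) = (\<Sum>k<r. psi ns (x k * z) * y k $$ (i, j))"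
    using assms by (subst mat_sum_upto) auto
  then show ?thesis unfolding A_eq[OF assms(1)] using c assms by simp
qed

lemma Adj_carrier [simp]: "Adj \<in> carrier_mat d d" by (simp add: adjacency_matrix_def)
lemma Deg_carrier [simp]: "Deg \<in> carrier_mat d d" by (simp add: degree_matrix_def)

text \<open>
  By definition \<open>A\<close> is \<open>\<delta>\<^sup>2\<close> times the flipped map applied to \<open>\<bar>1\<rangle>\<langle>1\<bar>\<close>, so by symmetry it is \<open>\<delta>\<^sup>2 F(\<bar>1\<rangle>\<langle>1\<bar>)\<close>.
  Consequently \<open>A\<close> lies in \<open>S\<close> and is self-adjoint.
\<close>

lemma Adj_eq: "Adj = of_nat d \<cdot>\<^sub>m F one_proj"
proof (rule eq_matI)
  have F: "F one_proj \<in> carrier_mat d d" by (simp add: F_carrier)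
  then show "dim_row Adj = dim_row (of_nat d \<cdot>\<^sub>m F one_proj)" "dim_col Adj = dim_col (of_nat d \<cdot>\<^sub>m F one_proj)"
    using carrier_matD[OF Adj_carrier] by auto
  fix a b assume "a < dim_row (of_nat d \<cdot>\<^sub>m F one_proj)" "b < dim_col (of_nat d \<cdot>\<^sub>m F one_proj)"
  then have ab: "a < d" "b < d" using F by auto
  have basis: "L2_basis ns b \<in> alg ns" by (rule L2_basis_in_alg[OF ab(2)])
  have "Adj $$ (a, b) = A (L2_basis ns b) $$ (rix a, cix a) / sc (rix a)"
    unfolding adjacency_matrix_def by (rule L2_op_index[where f = A, OF A_carrier[OF basis] ab])
  also have "\<dots> = of_nat d * (\<Sum>k<r. psi ns (x k * L2_basis ns b) * y k $$ (rix a, cix a)) / sc (rix a)"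
    using ix[OF ab(1)] by (simp add: A_index[OF basis])
  also have "\<dots> = of_nat d * (\<Sum>k<r. (y k $$ (rix a, cix a) / sc (rix a)) * (x k $$ (cix b, rix b) / sc (rix b)))"
    using ab by (simp add: psi_mult_basis sum_divide_distrib sum_distrib_left mult_ac)
  also have "\<dots> = of_nat d * F' one_proj $$ (a, b)"
    using ab by (simp add: F'_index sandwich_one_proj)
  also have "\<dots> = (of_nat d \<cdot>\<^sub>m F one_proj) $$ (a, b)"
    using F ab by (simp add: F_symmetric)
  finally show "Adj $$ (a, b) = (of_nat d \<cdot>\<^sub>m F one_proj) $$ (a, b)" .
qed

lemma Adj_in: "Adj \<in> S"
  unfolding Adj_eq by (intro mat_subspaceD(3)[OF sub] F_in one_proj_carrier)

lemma Adj_adjoint: "mat_adjoint Adj = Adj"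
proof -
  have "mat_adjoint (of_nat d \<cdot>\<^sub>m F one_proj) = of_nat d \<cdot>\<^sub>m mat_adjoint (F one_proj)"
    by (rule eq_matI) auto
  then show ?thesis
    unfolding Adj_eq using F_adjoint[OF one_proj_carrier] one_proj_adjoint by simp
qed

lemma Adj_index:
  assumes "a < d" "b < d"
  shows "Adj $$ (a, b) = of_nat d * (\<Sum>k<r. (y k $$ (rix a, cix a) / sc (rix a)) * (x k $$ (cix b, rix b) / sc (rix b)))"
    "Adj $$ (a, b) = of_nat d * (\<Sum>k<r. (x k $$ (rix a, cix a) / sc (rix a)) * (y k $$ (cix b, rix b) / sc (rix b)))"
proof -
  have F: "F one_proj \<in> carrier_mat d d" by (simp add: F_carrier)
  then have 1: "Adj $$ (a, b) = of_nat d * F one_proj $$ (a, b)" unfolding Adj_eq using assms by simp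
  show "Adj $$ (a, b) = of_nat d * (\<Sum>k<r. (y k $$ (rix a, cix a) / sc (rix a)) * (x k $$ (cix b, rix b) / sc (rix b)))"
    unfolding 1 F_symmetric[OF one_proj_carrier] using assms by (simp add: F'_index sandwich_one_proj)
  show "Adj $$ (a, b) = of_nat d * (\<Sum>k<r. (x k $$ (rix a, cix a) / sc (rix a)) * (y k $$ (cix b, rix b) / sc (rix b)))"
    unfolding 1 using assms by (simp add: F_index sandwich_one_proj)
qed

lemma one_in_alg: "alg_one ns \<in> alg ns"
  by (auto simp: alg_one_def alg_def)

lemma deg_carrier [simp]: "deg \<in> carrier_mat m m"
  by (rule A_carrier[OF one_in_alg])

lemma deg_index:
  assumes "i < m" "j < m"
  shows "deg $$ (i, j) = of_nat d * (\<Sum>k<r. psi ns (x k) * y k $$ (i, j))"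
proof -
  have "x k * alg_one ns = x k" if "k < r" for k
    unfolding alg_one_def by (rule right_mult_one_mat[OF xy_carrier(1)[OF that]])
  then show ?thesis unfolding A_index[OF one_in_alg assms] by simp
qed

text \<open>
  Both expressions for the entries of \<open>A\<close>, from the projection and from its flip, are summed against the
  unit vector. This yields the element \<open>A 1\<close> once directly and once transposed.
\<close>

lemma Adj_one_vec:
  assumes a: "a < d"
  shows "(\<Sum>b<d. Adj $$ (a, b) * one_vec b) = deg $$ (rix a, cix a) / sc (rix a)"
    "(\<Sum>b<d. one_vec b * Adj $$ (b, a)) = deg $$ (cix a, rix a) / sc (rix a)"
proof -
  have "(\<Sum>b<d. Adj $$ (a, b) * one_vec b)
     = (\<Sum>b<d. \<Sum>k<r. of_nat d * (y k $$ (rix a, cix a) / sc (rix a)) * (one_vec b * (x k $$ (cix b, rix b) / sc (rix b))))"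
    using a by (intro sum.cong refl) (simp add: Adj_index(1) sum_distrib_left sum_distrib_right mult_ac)
  also have "\<dots> = (\<Sum>k<r. \<Sum>b<d. of_nat d * (y k $$ (rix a, cix a) / sc (rix a)) * (one_vec b * (x k $$ (cix b, rix b) / sc (rix b))))"
    by (rule sum.swap)
  also have "\<dots> = (\<Sum>k<r. of_nat d * (y k $$ (rix a, cix a) / sc (rix a)) * psi ns (x k))"
    unfolding sum_distrib_left[symmetric] one_vec_psi(2) ..
  also have "\<dots> = deg $$ (rix a, cix a) / sc (rix a)"
    using ix[OF a] by (simp add: deg_index sum_distrib_left sum_divide_distrib mult_ac)
  finally show "(\<Sum>b<d. Adj $$ (a, b) * one_vec b) = deg $$ (rix a, cix a) / sc (rix a)" .
  have "(\<Sum>b<d. one_vec b * Adj $$ (b, a))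
     = (\<Sum>b<d. \<Sum>k<r. of_nat d * (y k $$ (cix a, rix a) / sc (rix a)) * (one_vec b * (x k $$ (rix b, cix b) / sc (rix b))))"
    using a by (intro sum.cong refl) (simp add: Adj_index(2) sum_distrib_left sum_distrib_right mult_ac)
  also have "\<dots> = (\<Sum>k<r. \<Sum>b<d. of_nat d * (y k $$ (cix a, rix a) / sc (rix a)) * (one_vec b * (x k $$ (rix b, cix b) / sc (rix b))))"
    by (rule sum.swap)
  also have "\<dots> = (\<Sum>k<r. of_nat d * (y k $$ (cix a, rix a) / sc (rix a)) * psi ns (x k))"
    unfolding sum_distrib_left[symmetric] one_vec_psi(1) ..
  also have "\<dots> = deg $$ (cix a, rix a) / sc (rix a)"
    using ix[OF a] by (simp add: deg_index sum_distrib_left sum_divide_distrib mult_ac)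
  finally show "(\<Sum>b<d. one_vec b * Adj $$ (b, a)) = deg $$ (cix a, rix a) / sc (rix a)" .
qed

text \<open>
  Let \<open>v\<close> be the real coordinate vector of the unit. Since \<open>A\<close> is self-adjoint, conjugating \<open>A v\<close> gives
  \<open>v\<^sup>T A\<close>, whose coordinates are those of the transpose of \<open>A 1\<close>.
\<close>

lemma deg_hermitian:
  assumes "p < m" "q < m" "block ns p = block ns q"
  shows "deg $$ (q, p) = cnj (deg $$ (p, q))"
proof -
  obtain a where a: "a < d" "rix a = p" "cix a = q" using ix_surj[OF assms] by blast
  have herm: "cnj (Adj $$ (a, b)) = Adj $$ (b, a)" if "b < d" for b
    using arg_cong[OF Adj_adjoint, of "\<lambda>T. T $$ (b, a)"] carrier_matD[OF Adj_carrier] a that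
    by (subst (asm) mat_adjoint_index) auto
  have "cnj (deg $$ (rix a, cix a) / sc (rix a)) = (\<Sum>b<d. one_vec b * Adj $$ (b, a))"
    unfolding Adj_one_vec(1)[OF a(1), symmetric] using herm by (simp add: mult.commute)
  also have "\<dots> = deg $$ (cix a, rix a) / sc (rix a)" by (rule Adj_one_vec(2)[OF a(1)])
  finally show ?thesis using a sc_nonzero[OF assms(1)] by simp
qed

lemma Deg_eq: "Deg = L2_op ns (\<lambda>z. z * deg)"
  by (simp add: degree_matrix_def degree_op_def[abs_def])

lemma Deg_index:
  "a < d \<Longrightarrow> b < d \<Longrightarrow> Deg $$ (a, b) = (if rix a = rix b then deg $$ (cix b, cix a) else 0)"
  unfolding Deg_eq by (rule right_mult_index) auto

lemma Deg_adjoint: "mat_adjoint Deg = Deg"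
proof (rule eq_matI)
  fix a b assume "a < dim_row Deg" "b < dim_col Deg"
  then have ab: "a < d" "b < d" using carrier_matD[OF Deg_carrier] by auto
  have "cnj (Deg $$ (b, a)) = Deg $$ (a, b)"
    using ab ix[OF ab(1)] ix[OF ab(2)] deg_hermitian[of "cix a" "cix b"] by (auto simp: Deg_index)
  then show "mat_adjoint Deg $$ (a, b) = Deg $$ (a, b)"
    using ab carrier_matD[OF Deg_carrier] by (subst mat_adjoint_index) auto
qed (use carrier_matD[OF Deg_carrier] in auto)

lemma Deg_commute: "z \<in> alg ns \<Longrightarrow> Deg * left_mult ns z = left_mult ns z * Deg"
  unfolding Deg_eq by (intro right_left_commute) (auto simp: alg_carrier)

lemma Adj_form: "sesq d Adj one_vec one_vec = psi ns deg"
proof -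
  have "sesq d Adj one_vec one_vec = (\<Sum>a<d. one_vec a * (\<Sum>b<d. Adj $$ (a, b) * one_vec b))"
    by (simp add: sesq_def sum_distrib_left mult.assoc)
  also have "\<dots> = (\<Sum>a<d. one_vec a * (deg $$ (rix a, cix a) / sc (rix a)))"
    by (intro sum.cong refl) (simp add: Adj_one_vec)
  also have "\<dots> = psi ns deg" by (rule one_vec_psi)
  finally show ?thesis .
qed

lemma Deg_form: "sesq d Deg one_vec one_vec = psi ns deg"
proof -
  have inner: "(\<Sum>b<d. Deg $$ (a, b) * one_vec b) = deg $$ (rix a, cix a) / sc (rix a)" if a: "a < d" for a
  proof -
    note i = ix[OF a]
    have "(\<Sum>b<d. Deg $$ (a, b) * one_vec b)
        = (\<Sum>b<d. if rix b = rix a \<and> cix b = rix a then deg $$ (cix b, cix a) / sc (rix b) else 0)"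
      by (intro sum.cong refl) (use a in \<open>auto simp: Deg_index one_vec_def\<close>)
    also have "\<dots> = deg $$ (rix a, cix a) / sc (rix a)"
      by (subst sum_ix_single[OF i(1,1), of "\<lambda>p q. deg $$ (q, cix a) / sc p"]) simp
    finally show ?thesis .
  qed
  have "sesq d Deg one_vec one_vec = (\<Sum>a<d. one_vec a * (\<Sum>b<d. Deg $$ (a, b) * one_vec b))"
    by (simp add: sesq_def sum_distrib_left mult.assoc)
  also have "\<dots> = (\<Sum>a<d. one_vec a * (deg $$ (rix a, cix a) / sc (rix a)))"
    by (intro sum.cong refl) (simp add: inner)
  also have "\<dots> = psi ns deg" by (rule one_vec_psi)
  finally show ?thesis .
qed

text \<open>
  The analogue of counting edges by degrees: both sides equal \<open>\<delta>\<^sup>4 \<Sum>\<^sub>i \<psi>(x\<^sub>i) \<psi>(y\<^sub>i)\<close>.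
\<close>

lemma dim_S: "of_nat (mat_dim d S) = of_nat d * psi ns deg"
proof -
  have "psi ns deg = (\<Sum>p<m. of_nat d * (\<Sum>k<r. psi ns (x k) * y k $$ (p, p)) / (sc p * sc p))"
    unfolding psi_eq[of deg] by (intro sum.cong refl) (simp add: deg_index)
  also have "\<dots> = (\<Sum>p<m. \<Sum>k<r. of_nat d * (psi ns (x k) * (y k $$ (p, p) / (sc p * sc p))))"
    by (simp add: sum_distrib_left sum_divide_distrib)
  also have "\<dots> = (\<Sum>k<r. \<Sum>p<m. of_nat d * (psi ns (x k) * (y k $$ (p, p) / (sc p * sc p))))"
    by (rule sum.swap)
  also have "\<dots> = (\<Sum>k<r. of_nat d * (psi ns (x k) * psi ns (y k)))"
    unfolding psi_eq[of "y _"] sum_distrib_left ..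
  finally have "of_nat d * psi ns deg = (\<Sum>k<r. (of_nat d * psi ns (x k)) * (of_nat d * psi ns (y k)))"
    by (simp add: sum_distrib_left mult_ac)
  also have "\<dots> = of_nat (mat_dim d S)"
    unfolding dim_eq by (intro sum.cong refl) (simp add: trace_left_mult)
  finally show ?thesis by simp
qed

end

section \<open>Colorings\<close>

text \<open>
  A span lies in every submodule that contains its generators; for the tensor product algebra this reduces
  commutation to elementary tensors.
\<close>

lemma commuting_submodule:
  assumes K: "K \<in> carrier_mat n n"
  shows "submodule class_ring {Z \<in> carrier_mat n n. K * Z = Z * K} (mat_space n)"
proof -
  interpret V: vectorspace class_ring "mat_space n" by (rule matrix_vs)
  have "module class_ring (mat_space n)" ..
  then show ?thesis
  proof (rule submodule.intro)
    show "{Z \<in> carrier_mat n n. K * Z = Z * K} \<subseteq> carrier (mat_space n)" by (auto simp: module_mat_simps)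
    show "\<zero>\<^bsub>mat_space n\<^esub> \<in> {Z \<in> carrier_mat n n. K * Z = Z * K}"
      using K by (simp add: module_mat_simps)
    fix v w assume "v \<in> {Z \<in> carrier_mat n n. K * Z = Z * K}" "w \<in> {Z \<in> carrier_mat n n. K * Z = Z * K}"
    then show "v \<oplus>\<^bsub>mat_space n\<^esub> w \<in> {Z \<in> carrier_mat n n. K * Z = Z * K}"
      using K by (simp add: module_mat_simps mult_add_distrib_mat[of _ n n _ n] add_mult_distrib_mat[of _ n n _ _ n])
  next
    fix s v assume "s \<in> carrier (class_ring :: complex ring)" "v \<in> {Z \<in> carrier_mat n n. K * Z = Z * K}"
    then show "s \<odot>\<^bsub>mat_space n\<^esub> v \<in> {Z \<in> carrier_mat n n. K * Z = Z * K}"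
      using K by (simp add: module_mat_simps mult_smult_distrib[of _ n n _ n] mult_smult_assoc_mat[of _ n n _ n])
  qed
qed

locale colored_algebra = L2_algebra ns for ns +
  fixes S :: "complex mat set" and c k :: nat and N :: "complex mat set" and P :: "nat \<Rightarrow> complex mat"
  assumes S_subspace: "VectorSpace.subspace class_ring S (mat_space (alg_dim ns))"
    and coloring: "is_coloring ns S c k N P"
begin

lemma k_pos: "k > 0"
  using coloring by (simp add: is_coloring_def fin_dim_vN_algebra_def)

lemma N_carrier: "y \<in> N \<Longrightarrow> y \<in> carrier_mat k k"
  using coloring mat_subspaceD(1)[of N k] by (auto simp: is_coloring_def fin_dim_vN_algebra_def)

text \<open>
  If \<open>E\<close> commutes with left multiplications then \<open>E \<otimes> 1\<close> commutes with \<open>M \<otimes> N\<close>; this applies to the degree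
  matrix, a right multiplication.
\<close>

lemma tensor_commute:
  assumes E: "E \<in> carrier_mat d d" and comm: "\<And>x. x \<in> alg ns \<Longrightarrow> E * left_mult ns x = left_mult ns x * E"
    and a: "a < c"
  shows "P a \<in> carrier_mat (d * k) (d * k)" "kron E (1\<^sub>m k) * P a = P a * kron E (1\<^sub>m k)"
proof -
  interpret V: vectorspace class_ring "mat_space (d * k)" by (rule matrix_vs)
  let ?C = "{Z \<in> carrier_mat (d * k) (d * k). kron E (1\<^sub>m k) * Z = Z * kron E (1\<^sub>m k)}"
  have "{kron (left_mult ns x) y | x y. x \<in> alg ns \<and> y \<in> N} \<subseteq> ?C"
  proof
    fix Z assume "Z \<in> {kron (left_mult ns x) y | x y. x \<in> alg ns \<and> y \<in> N}"
    then obtain x y where Z: "Z = kron (left_mult ns x) y" "x \<in> alg ns" "y \<in> N" by blast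
    have y: "y \<in> carrier_mat k k" using N_carrier Z by blast
    have "kron E (1\<^sub>m k) * Z = kron (E * left_mult ns x) (1\<^sub>m k * y)"
      unfolding Z using E y by (intro kron_mult[of _ d d _ d _ k k _ k]) auto
    also have "\<dots> = kron (left_mult ns x * E) (y * 1\<^sub>m k)"
      using comm[OF Z(2)] y by simp
    also have "\<dots> = Z * kron E (1\<^sub>m k)"
      unfolding Z using E y by (intro kron_mult[of _ d d _ d _ k k _ k, symmetric]) auto
    finally show "Z \<in> ?C" unfolding Z using y by simp
  qed
  then have "alg_tensor ns k N \<subseteq> ?C"
    unfolding alg_tensor_def
    by (rule V.span_is_subset) (rule commuting_submodule[OF kron_carrier[OF E one_carrier_mat]])
  moreover have "P a \<in> alg_tensor ns k N" using coloring a by (simp add: is_coloring_def)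
  ultimately show "P a \<in> carrier_mat (d * k) (d * k)" "kron E (1\<^sub>m k) * P a = P a * kron E (1\<^sub>m k)" by auto
qed

lemma P_carrier: "a < c \<Longrightarrow> P a \<in> carrier_mat (d * k) (d * k)"
  by (rule tensor_commute(1)[of "1\<^sub>m d"])
    (auto simp: left_mult_one_mat[OF left_mult_carrier] right_mult_one_mat[OF left_mult_carrier])

sublocale projection_partition "d * k" c P
proof
  show "P a \<in> carrier_mat (d * k) (d * k)" if "a < c" for a by (rule P_carrier[OF that])
  show "mat_adjoint (P a) = P a" "P a * P a = P a" if "a < c" for a
    using coloring that by (simp_all add: is_coloring_def)
  show "(\<Sum>a<c. P a $$ (i, j)) = (if i = j then 1 else 0)" if "i < d * k" "j < d * k" for i j
  proof -
    have "(\<Sum>a<c. P a $$ (i, j)) = mat_sum_upto (d * k) c P $$ (i, j)"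
      using that P_carrier by (intro mat_sum_upto(2)[symmetric])
    also have "mat_sum_upto (d * k) c P = 1\<^sub>m (d * k)" using coloring by (simp add: is_coloring_def)
    finally show ?thesis using that by simp
  qed
qed

lemma dk_pos: "d * k > 0" using d_pos k_pos by simp

lemma c_ge_1: "c \<ge> 1" using c_pos[OF dk_pos] by simp

lemma compress_S: "X \<in> S \<Longrightarrow> a < c \<Longrightarrow> P a * kron X (1\<^sub>m k) * P a = 0\<^sub>m (d * k) (d * k)"
  using coloring by (simp add: is_coloring_def)

lemma S_in_carrier: "X \<in> S \<Longrightarrow> X \<in> carrier_mat d d"
  using mat_subspaceD(1)[OF S_subspace] by blast

text \<open>
  The pinching bound on \<open>\<complex>\<^sup>d \<otimes> \<complex>\<^sup>k\<close> is tested on a vector \<open>w \<otimes> e\<^sub>0\<close>, which returns it to \<open>\<complex>\<^sup>d\<close>.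
\<close>

lemma form_bound:
  assumes E: "E \<in> carrier_mat d d" and comm: "\<And>x. x \<in> alg ns \<Longrightarrow> E * left_mult ns x = left_mult ns x * E"
    and H: "H \<in> S" and psd: "\<And>u. Re (sesq d (E + H) u u) \<ge> 0"
  shows "Re (sesq d (E + H) w w) \<le> real c * Re (sesq d E w w)"
proof -
  have H': "H \<in> carrier_mat d d" by (rule S_in_carrier[OF H])
  have add: "kron (E + H) (1\<^sub>m k) = kron E (1\<^sub>m k) + kron H (1\<^sub>m k)"
    using E H' by (intro eq_matI) (auto simp: kron_def div_mod_less distrib_right)
  \<comment> \<open>\<open>w' = w \<otimes> e\<^sub>0\<close>\<close>
  define w' where "w' i = (if i mod k = 0 then w (i div k) else 0)" for i
  have embed: "sesq (d * k) (kron T (1\<^sub>m k)) w' w' = sesq d T w w" if T: "T \<in> carrier_mat d d" for T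
  proof -
    have "sesq d T (\<lambda>i. w' (i * k + t)) (\<lambda>i. w' (i * k + t)) = (if t = 0 then sesq d T w w else 0)" if "t < k" for t
      using that by (simp add: w'_def sesq_def)
    then have "sesq (d * k) (kron T (1\<^sub>m k)) w' w' = (\<Sum>t<k. if t = 0 then sesq d T w w else 0)"
      unfolding sesq_kron_one[OF T] by (intro sum.cong refl) auto
    then show ?thesis using k_pos by simp
  qed
  have "Re (sesq (d * k) (kron E (1\<^sub>m k) + kron H (1\<^sub>m k)) w' w') \<le> real c * Re (sesq (d * k) (kron E (1\<^sub>m k)) w' w')"
  proof (rule pinched_form_bound)
    show "kron E (1\<^sub>m k) \<in> carrier_mat (d * k) (d * k)" "kron H (1\<^sub>m k) \<in> carrier_mat (d * k) (d * k)"
      using E H' by simp_all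
    show "kron E (1\<^sub>m k) * P a = P a * kron E (1\<^sub>m k)" if "a < c" for a
      using tensor_commute(2)[OF E comm that] .
    show "P a * kron H (1\<^sub>m k) * P a = 0\<^sub>m (d * k) (d * k)" if "a < c" for a
      by (rule compress_S[OF H that])
    show "0 \<le> Re (sesq (d * k) (kron E (1\<^sub>m k) + kron H (1\<^sub>m k)) u u)" for u
      unfolding add[symmetric] sesq_kron_one[OF add_carrier_mat[OF H']] Re_sum
      by (intro sum_nonneg psd)
  qed
  then show ?thesis
    unfolding add[symmetric] embed[OF E] embed[OF add_carrier_mat[OF H']] .
qed

lemma pinched_kron:
  assumes "H \<in> S" "diagonalized d H V lam"
  shows "pinched_to_zero (d * k) c P (kron H (1\<^sub>m k)) (kron V (1\<^sub>m k)) (\<lambda>i. lam (i div k))"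
proof -
  interpret D: diagonalized "d * k" "kron H (1\<^sub>m k)" "kron V (1\<^sub>m k)" "\<lambda>i. lam (i div k)"
    by (rule diagonalized.diagonalized_kron[OF assms(2)])
  show ?thesis by unfold_locales (use compress_S[OF assms(1)] dk_pos in auto)
qed

lemma sum_filter_kron:
  fixes g :: "nat \<Rightarrow> 'a :: comm_semiring_1"
  shows "(\<Sum>i | i < d * k \<and> Q (i div k). g (i div k)) = of_nat k * (\<Sum>i | i < d \<and> Q i. g i)"
proof -
  have filter: "(\<Sum>i | i < n \<and> R i. h i) = (\<Sum>i<n. if R i then h i else 0)" for n R and h :: "nat \<Rightarrow> 'a"
    using sum.inter_filter[of "{..<n}" h R] by simp
  have "(\<Sum>i | i < d * k \<and> Q (i div k). g (i div k)) = (\<Sum>a<d. \<Sum>b<k. if Q a then g a else 0)"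
    unfolding filter by (rule sum_div_mod[of "\<lambda>a _. if Q a then g a else 0"])
  also have "\<dots> = of_nat k * (\<Sum>i | i < d \<and> Q i. g i)"
    unfolding filter by (simp add: sum_distrib_left)
  finally show ?thesis .
qed

lemma square_sum_bounds:
  assumes "H \<in> S" "diagonalized d H V lam"
  shows "pos_square_sum H \<le> (real c - 1) * neg_square_sum H" "neg_square_sum H \<le> (real c - 1) * pos_square_sum H"
proof -
  interpret H: diagonalized d H V lam by (rule assms(2))
  interpret K: pinched_to_zero "d * k" c P "kron H (1\<^sub>m k)" "kron V (1\<^sub>m k)" "\<lambda>i. lam (i div k)"
    by (rule pinched_kron[OF assms])
  have "real k * pos_square_sum H \<le> real k * ((real c - 1) * neg_square_sum H)"
    "real k * neg_square_sum H \<le> real k * ((real c - 1) * pos_square_sum H)"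
    using K.square_sums sum_filter_kron[where Q = "\<lambda>i. lam i > 0" and g = "\<lambda>i. (lam i)\<^sup>2"] sum_filter_kron[where Q = "\<lambda>i. lam i < 0" and g = "\<lambda>i. (lam i)\<^sup>2"]
    by (simp_all add: H.pos_square_sum_eq H.neg_square_sum_eq mult_ac)
  then show "pos_square_sum H \<le> (real c - 1) * neg_square_sum H" "neg_square_sum H \<le> (real c - 1) * pos_square_sum H"
    using k_pos by simp_all
qed

lemma inertia_bounds:
  assumes "H \<in> S" "diagonalized d H V lam"
  shows "real (pos_count H) \<le> (real c - 1) * real (neg_count H)"
    "real (neg_count H) \<le> (real c - 1) * real (pos_count H)"
proof -
  interpret H: diagonalized d H V lam by (rule assms(2))
  interpret K: pinched_to_zero "d * k" c P "kron H (1\<^sub>m k)" "kron V (1\<^sub>m k)" "\<lambda>i. lam (i div k)"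
    by (rule pinched_kron[OF assms])
  have "k * pos_count H \<le> k * ((c - 1) * neg_count H)" "k * neg_count H \<le> k * ((c - 1) * pos_count H)"
    using K.inertia sum_filter_kron[where Q = "\<lambda>i. lam i > 0" and g = "\<lambda>_. 1 :: nat"] sum_filter_kron[where Q = "\<lambda>i. lam i < 0" and g = "\<lambda>_. 1 :: nat"]
    by (simp_all add: H.pos_count_eq H.neg_count_eq mult_ac)
  then have "pos_count H \<le> (c - 1) * neg_count H" "neg_count H \<le> (c - 1) * pos_count H"
    using k_pos by simp_all
  then have "real (pos_count H) \<le> real ((c - 1) * neg_count H)" "real (neg_count H) \<le> real ((c - 1) * pos_count H)"
    by (simp_all only: of_nat_le_iff)
  then show "real (pos_count H) \<le> (real c - 1) * real (neg_count H)"
    "real (neg_count H) \<le> (real c - 1) * real (pos_count H)"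
    using c_ge_1 by (simp_all add: of_nat_diff)
qed

end

section \<open>The eigenvalue bounds\<close>

text \<open>
  This form covers vanishing denominators. If \<open>a > 0\<close>, the third hypothesis forces \<open>b > 0\<close>; if \<open>a = 0\<close>,
  the quotient is \<open>0\<close> for every \<open>b\<close>, including \<open>b = 0\<close>.
\<close>

lemma one_plus_quotient_le:
  fixes a b c :: real
  assumes "0 \<le> a" "1 \<le> c" "a \<le> (c - 1) * b"
  shows "1 + a / b \<le> c"
proof (cases "a = 0")
  case False
  then have "0 < (c - 1) * b" using assms by linarith
  then have "b > 0" using assms(2) by (simp add: zero_less_mult_iff)
  then show ?thesis using assms(3) by (simp add: field_simps)
qed (use assms in auto)

locale colored_quantum_graph = quantum_adjacency_data ns r S F x y A + colored_algebra ns S c k N P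
  for ns r S F x y A c k N P
begin

lemma shifted_commute:
  assumes "z \<in> alg ns"
  shows "(s \<cdot>\<^sub>m 1\<^sub>m d + t \<cdot>\<^sub>m Deg) * left_mult ns z = left_mult ns z * (s \<cdot>\<^sub>m 1\<^sub>m d + t \<cdot>\<^sub>m Deg)"
  using Deg_commute[OF assms]
  by (simp add: add_mult_distrib_mat[of _ d d _ _ d] mult_add_distrib_mat[of _ d d _ d]
      mult_smult_distrib[of _ d d _ d] mult_smult_assoc_mat[of _ d d _ d] left_mult_one_mat[of _ d d] right_mult_one_mat[of _ d d])

text \<open>
  Scalars and \<open>D\<close> survive pinching while \<open>A\<close> does not. The bounds on extreme eigenvalues arise by choosing
  a positive combination of \<open>1\<close>, \<open>D\<close>, \<open>A\<close> and a test vector \<open>w\<close>.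
\<close>

lemma shifted_form_bound:
  assumes psd: "\<And>u. Re (sesq d (complex_of_real s \<cdot>\<^sub>m 1\<^sub>m d + complex_of_real t \<cdot>\<^sub>m Deg + complex_of_real h \<cdot>\<^sub>m Adj) u u) \<ge> 0"
    and unit: "sesq d (1\<^sub>m d) w w = 1"
  shows "s + t * Re (sesq d Deg w w) + h * Re (sesq d Adj w w) \<le> real c * (s + t * Re (sesq d Deg w w))"
proof -
  let ?E = "complex_of_real s \<cdot>\<^sub>m 1\<^sub>m d + complex_of_real t \<cdot>\<^sub>m Deg" and ?H = "complex_of_real h \<cdot>\<^sub>m Adj"
  have "Re (sesq d (?E + ?H) w w) \<le> real c * Re (sesq d ?E w w)"
    by (rule form_bound) (use psd shifted_commute mat_subspaceD(3)[OF sub Adj_in] in auto)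
  then show ?thesis
    using unit by (simp add: sesq_add sesq_smult)
qed

text \<open>
  The positive operators and test vectors are: \<open>A - \<lambda>\<^sub>m\<^sub>i\<^sub>n\<close> at a top eigenvector of \<open>A\<close>; \<open>Q - \<gamma>\<^sub>m\<^sub>i\<^sub>n\<close> at the unit of
  the algebra, where both \<open>D\<close> and \<open>A\<close> take the value \<open>dim S / dim M\<close>; and \<open>\<theta>\<^sub>m\<^sub>a\<^sub>x - L\<close> at a top eigenvector
  of \<open>Q\<close>. The operator \<open>\<lambda>\<^sub>m\<^sub>a\<^sub>x - A\<close> at a bottom eigenvector of \<open>A\<close> serves to determine the signs of the
  extreme eigenvalues.
\<close>

lemma eigenvalue_bounds:
  fixes lmax lmin gmax gmin tmax :: real
  defines "lmax \<equiv> eig_max Adj" and "lmin \<equiv> eig_min Adj"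
    and "gmax \<equiv> eig_max (signless_laplacian ns A)" and "gmin \<equiv> eig_min (signless_laplacian ns A)"
    and "tmax \<equiv> eig_max (laplacian ns A)" and "dS \<equiv> real (mat_dim d S)"
  shows "0 \<le> lmax" "lmax \<le> (real c - 1) * \<bar>lmin\<bar>"
    "dS \<le> (real c - 1) * (dS - real d * gmin)"
    "lmax \<le> (real c - 1) * (lmax - gmax + tmax)"
proof -
  obtain VA lam where dA: "diagonalized d Adj VA lam"
    using hermitian_diagonalized[OF Adj_carrier Adj_adjoint] by blast
  have Q: "signless_laplacian ns A \<in> carrier_mat d d" and L: "laplacian ns A \<in> carrier_mat d d"
    unfolding signless_laplacian_def laplacian_def by (auto intro: minus_carrier_mat)
  have adj_ix: "cnj (T $$ (j, i)) = T $$ (i, j)" if "T \<in> carrier_mat d d" "mat_adjoint T = T" "i < d" "j < d" for T i j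
    using that mat_adjoint_index[of i T j] by auto
  have "mat_adjoint (signless_laplacian ns A) = signless_laplacian ns A"
    using carrier_matD[OF Q] carrier_matD[OF Adj_carrier] carrier_matD[OF Deg_carrier]
    by (intro eq_matI) (auto simp: signless_laplacian_def adj_ix[OF Adj_carrier Adj_adjoint] adj_ix[OF Deg_carrier Deg_adjoint])
  then obtain VQ mu where dQ: "diagonalized d (signless_laplacian ns A) VQ mu"
    using hermitian_diagonalized[OF Q] by blast
  have "mat_adjoint (laplacian ns A) = laplacian ns A"
    using carrier_matD[OF L] carrier_matD[OF Adj_carrier] carrier_matD[OF Deg_carrier]
    by (intro eq_matI) (auto simp: laplacian_def adj_ix[OF Adj_carrier Adj_adjoint] adj_ix[OF Deg_carrier Deg_adjoint])
  then obtain VL nu where dL: "diagonalized d (laplacian ns A) VL nu"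
    using hermitian_diagonalized[OF L] by blast
  interpret A: diagonalized d Adj VA lam by (rule dA)
  interpret Q: diagonalized d "signless_laplacian ns A" VQ mu by (rule dQ)
  interpret L: diagonalized d "laplacian ns A" VL nu by (rule dL)
  have c: "real c \<ge> 1" using c_ge_1 by simp
  have form_Q: "sesq d (signless_laplacian ns A) u u = sesq d Deg u u + sesq d Adj u u" for u
    unfolding signless_laplacian_def by (rule sesq_add) auto
  have form_L: "sesq d (laplacian ns A) u u = sesq d Deg u u - sesq d Adj u u" for u
    unfolding laplacian_def using carrier_matD[OF Adj_carrier] carrier_matD[OF Deg_carrier]
    unfolding sesq_def sum_subtractf[symmetric] by (intro sum.cong refl) (simp add: algebra_simps)
  have expand: "Re (sesq d (complex_of_real s \<cdot>\<^sub>m 1\<^sub>m d + complex_of_real t \<cdot>\<^sub>m Deg + complex_of_real h \<cdot>\<^sub>m Adj) u u)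
      = s * Re (sesq d (1\<^sub>m d) u u) + t * Re (sesq d Deg u u) + h * Re (sesq d Adj u u)" for s t h u
    by (simp add: sesq_add sesq_smult)
  have lower: "0 \<le> s * Re (sesq d (1\<^sub>m d) u u) + t * Re (sesq d T u u)"
    if "diagonalized d T V e" "\<And>i. i < d \<Longrightarrow> 0 \<le> s + t * e i" for s t T V e u
    using diagonalized.sesq_shifted_nonneg[OF that, of u] diagonalized.T[OF that(1)]
    by (simp add: sesq_add sesq_smult)
  obtain i where i: "i < d" "lam i = lmax" using A.eig_max_attained[OF d_pos] lmax_def by auto
  obtain j where j: "j < d" "lam j = lmin" using A.eig_min_attained[OF d_pos] lmin_def by auto
  have up: "lmax \<le> (real c - 1) * (- lmin)"
  proof -
    have "- lmin + 0 * Re (sesq d Deg (\<lambda>h. VA $$ (h, i)) (\<lambda>h. VA $$ (h, i)))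
        + 1 * Re (sesq d Adj (\<lambda>h. VA $$ (h, i)) (\<lambda>h. VA $$ (h, i)))
        \<le> real c * (- lmin + 0 * Re (sesq d Deg (\<lambda>h. VA $$ (h, i)) (\<lambda>h. VA $$ (h, i))))"
    proof (rule shifted_form_bound)
      show "0 \<le> Re (sesq d (complex_of_real (- lmin) \<cdot>\<^sub>m 1\<^sub>m d + complex_of_real 0 \<cdot>\<^sub>m Deg + complex_of_real 1 \<cdot>\<^sub>m Adj) u u)" for u
        unfolding expand using lower[OF dA, of "- lmin" 1 u] A.eig_min_le by (simp add: lmin_def)
    qed (rule A.eigenvector_form[OF i(1)])
    then show ?thesis
      unfolding A.eigenvector_form[OF i(1)] i(2) by (simp add: algebra_simps)
  qed
  have down: "- lmin \<le> (real c - 1) * lmax"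
  proof -
    have "lmax + 0 * Re (sesq d Deg (\<lambda>h. VA $$ (h, j)) (\<lambda>h. VA $$ (h, j)))
        + (-1) * Re (sesq d Adj (\<lambda>h. VA $$ (h, j)) (\<lambda>h. VA $$ (h, j)))
        \<le> real c * (lmax + 0 * Re (sesq d Deg (\<lambda>h. VA $$ (h, j)) (\<lambda>h. VA $$ (h, j))))"
    proof (rule shifted_form_bound)
      show "0 \<le> Re (sesq d (complex_of_real lmax \<cdot>\<^sub>m 1\<^sub>m d + complex_of_real 0 \<cdot>\<^sub>m Deg + complex_of_real (-1) \<cdot>\<^sub>m Adj) u u)" for u
        unfolding expand using lower[OF dA, of lmax "-1" u] A.eig_max_ge by (simp add: lmax_def)
    qed (rule A.eigenvector_form[OF j(1)])
    then show ?thesis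
      unfolding A.eigenvector_form[OF j(1)] j(2) by (simp add: algebra_simps)
  qed
  have le: "lmin \<le> lmax" using A.eig_max_ge[OF j(1)] j(2) by (simp add: lmax_def)
  show nonneg: "0 \<le> lmax"
  proof (rule ccontr)
    assume "\<not> 0 \<le> lmax"
    then have "(real c - 1) * lmax \<le> 0" using c by (simp add: mult_nonneg_nonpos)
    then show False using down le \<open>\<not> 0 \<le> lmax\<close> by linarith
  qed
  have "lmin \<le> 0"
  proof (rule ccontr)
    assume "\<not> lmin \<le> 0"
    then have "(real c - 1) * (- lmin) \<le> 0" using c by (simp add: mult_nonneg_nonpos)
    then show False using up le \<open>\<not> lmin \<le> 0\<close> by linarith
  qed
  then show "lmax \<le> (real c - 1) * \<bar>lmin\<bar>" using up by simp
  define ps where "ps = Re (psi ns deg)"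
  have dS: "dS = real d * ps"
    using arg_cong[OF dim_S, of Re] by (simp add: dS_def ps_def)
  have "- gmin + 1 * Re (sesq d Deg one_vec one_vec) + 1 * Re (sesq d Adj one_vec one_vec)
      \<le> real c * (- gmin + 1 * Re (sesq d Deg one_vec one_vec))"
  proof (rule shifted_form_bound[OF _ one_vec_norm])
    show "0 \<le> Re (sesq d (complex_of_real (- gmin) \<cdot>\<^sub>m 1\<^sub>m d + complex_of_real 1 \<cdot>\<^sub>m Deg + complex_of_real 1 \<cdot>\<^sub>m Adj) u u)" for u
      unfolding expand using lower[OF dQ, of "- gmin" 1 u] Q.eig_min_le by (simp add: form_Q gmin_def)
  qed
  then have "ps \<le> (real c - 1) * (ps - gmin)"
    unfolding Adj_form Deg_form ps_def[symmetric] by (simp add: algebra_simps)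
  then have "real d * ps \<le> real d * ((real c - 1) * (ps - gmin))" by (intro mult_left_mono) auto
  then show "dS \<le> (real c - 1) * (dS - real d * gmin)" unfolding dS by (simp add: algebra_simps)
  obtain l where l: "l < d" "mu l = gmax" using Q.eig_max_attained[OF d_pos] gmax_def by auto
  define w where "w = (\<lambda>h. VQ $$ (h, l))"
  have unit: "sesq d (1\<^sub>m d) w w = 1" unfolding w_def by (rule Q.eigenvector_form[OF l(1)])
  define de where "de = Re (sesq d Deg w w)"
  define al where "al = Re (sesq d Adj w w)"
  have sum: "de + al = gmax"
    using arg_cong[OF form_Q[of w], of Re] Q.eigenvector_form(1)[OF l(1)] l(2)
    by (simp add: de_def al_def w_def)
  have "al \<le> lmax"
    using lower[OF dA, of lmax "-1" w] A.eig_max_ge unit by (simp add: lmax_def al_def)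
  have "tmax + (-1) * de + 1 * al \<le> real c * (tmax + (-1) * de)"
    unfolding de_def al_def
  proof (rule shifted_form_bound[OF _ unit])
    show "0 \<le> Re (sesq d (complex_of_real tmax \<cdot>\<^sub>m 1\<^sub>m d + complex_of_real (-1) \<cdot>\<^sub>m Deg + complex_of_real 1 \<cdot>\<^sub>m Adj) u u)" for u
      unfolding expand using lower[OF dL, of tmax "-1" u] L.eig_max_ge by (simp add: form_L tmax_def)
  qed
  \<comment> \<open>Here \<open>D = Q - A\<close> is substituted, with \<open>w\<^sup>* Q w = \<gamma>\<^sub>m\<^sub>a\<^sub>x\<close>.\<close>
  then have bound: "(real c - 1) * gmax - (real c - 2) * al \<le> (real c - 1) * tmax"
    unfolding sum[symmetric] by (simp add: algebra_simps)
  \<comment> \<open>Estimating \<open>w\<^sup>* A w\<close> by \<open>\<lambda>\<^sub>m\<^sub>a\<^sub>x\<close> requires \<open>c \<ge> 2\<close>; with a single color \<open>\<lambda>\<^sub>m\<^sub>a\<^sub>x \<le> 0\<close> already.\<close>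
  show "lmax \<le> (real c - 1) * (lmax - gmax + tmax)"
  proof (cases "c = 1")
    case True
    then show ?thesis using up by simp
  next
    case False
    then have "real c - 2 \<ge> 0" using c_ge_1 by simp
    then have "(real c - 2) * al \<le> (real c - 2) * lmax" using \<open>al \<le> lmax\<close> by (rule mult_left_mono[rotated])
    then show ?thesis using bound by (simp add: algebra_simps)
  qed
qed

theorem spectral_bounds:
  shows "1 + Max {eig_max Adj / \<bar>eig_min Adj\<bar>,
      real (mat_dim d S) / (real (mat_dim d S) - real d * eig_min (signless_laplacian ns A)),
      pos_square_sum Adj / neg_square_sum Adj, neg_square_sum Adj / pos_square_sum Adj,
      real (pos_count Adj) / real (neg_count Adj), real (neg_count Adj) / real (pos_count Adj),
      eig_max Adj / (eig_max Adj - eig_max (signless_laplacian ns A) + eig_max (laplacian ns A))} \<le> real c"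
    (is "1 + Max ?B \<le> _")
proof -
  obtain V lam where dA: "diagonalized d Adj V lam"
    using hermitian_diagonalized[OF Adj_carrier Adj_adjoint] by blast
  have c: "1 \<le> real c" using c_ge_1 by simp
  have nonneg: "0 \<le> pos_square_sum Adj" "0 \<le> neg_square_sum Adj"
    unfolding pos_square_sum_def neg_square_sum_def by (auto intro!: sum_nonneg)
  note bounds = eigenvalue_bounds square_sum_bounds[OF Adj_in dA] inertia_bounds[OF Adj_in dA]
  have "\<forall>q\<in>?B. 1 + q \<le> real c"
    using one_plus_quotient_le[OF bounds(1) c bounds(2)] one_plus_quotient_le[OF _ c bounds(3)]
      one_plus_quotient_le[OF bounds(1) c bounds(4)] one_plus_quotient_le[OF nonneg(1) c bounds(5)]
      one_plus_quotient_le[OF nonneg(2) c bounds(6)] one_plus_quotient_le[OF _ c bounds(7)]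
      one_plus_quotient_le[OF _ c bounds(8)]
    by simp
  moreover have "Max ?B \<in> ?B" by (rule Max_in) auto
  ultimately show ?thesis by blast
qed

end

theorem theorem1p1:
  fixes ns :: "nat list"
    and S :: "complex mat set"
    and A :: "complex mat \<Rightarrow> complex mat"
  assumes "ns \<noteq> []" and "\<forall>n\<in>set ns. n > 0"
    and "quantum_graph ns S"
    and "irreflexive ns S"
    and "quantum_adjacency ns S A"
  shows "let lambda_max = eig_max (adjacency_matrix ns A);
             lambda_min = eig_min (adjacency_matrix ns A);
             s_pos = pos_square_sum (adjacency_matrix ns A);
             s_neg = neg_square_sum (adjacency_matrix ns A);
             n_pos = real (pos_count (adjacency_matrix ns A));
             n_neg = real (neg_count (adjacency_matrix ns A));
             gamma_max = eig_max (signless_laplacian ns A);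
             gamma_min = eig_min (signless_laplacian ns A);
             theta_max = eig_max (laplacian ns A);
             dim_M = real (alg_dim ns);
             dim_S = real (mat_dim (alg_dim ns) S)
         in ereal (1 + Max {lambda_max / \<bar>lambda_min\<bar>,
                            dim_S / (dim_S - dim_M * gamma_min),
                            s_pos / s_neg, s_neg / s_pos,
                            n_pos / n_neg, n_neg / n_pos,
                            lambda_max / (lambda_max - gamma_max + theta_max)})
              \<le> ereal_of_enat (quantum_chromatic_number ns S) \<and>
            quantum_chromatic_number ns S \<le> chromatic_number ns S"
proof -
  let ?M = "Max {eig_max (adjacency_matrix ns A) / \<bar>eig_min (adjacency_matrix ns A)\<bar>,
      real (mat_dim (alg_dim ns) S) / (real (mat_dim (alg_dim ns) S) - real (alg_dim ns) * eig_min (signless_laplacian ns A)),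
      pos_square_sum (adjacency_matrix ns A) / neg_square_sum (adjacency_matrix ns A),
      neg_square_sum (adjacency_matrix ns A) / pos_square_sum (adjacency_matrix ns A),
      real (pos_count (adjacency_matrix ns A)) / real (neg_count (adjacency_matrix ns A)),
      real (neg_count (adjacency_matrix ns A)) / real (pos_count (adjacency_matrix ns A)),
      eig_max (adjacency_matrix ns A) / (eig_max (adjacency_matrix ns A) - eig_max (signless_laplacian ns A) + eig_max (laplacian ns A))}"
  obtain F r x y where F: "orth_projection (alg_dim ns) S F"
    and xy: "\<forall>i<r. x i \<in> alg ns \<and> y i \<in> alg ns"
    and F_eq: "\<forall>X\<in>carrier_mat (alg_dim ns) (alg_dim ns).
           F X = mat_sum_upto (alg_dim ns) r (\<lambda>i. left_mult ns (x i) * X * left_mult ns (y i))"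
    and A_eq: "\<forall>z\<in>alg ns. A z = of_nat (alg_dim ns) \<cdot>\<^sub>m
           mat_sum_upto (alg_size ns) r (\<lambda>i. psi ns (x i * z) \<cdot>\<^sub>m y i)"
    using assms(5) unfolding quantum_adjacency_def by (elim exE conjE) (rule that)
  have sub: "VectorSpace.subspace class_ring S (mat_space (alg_dim ns))" and adj: "\<forall>X\<in>S. mat_adjoint X \<in> S"
    using assms(3) by (auto simp: quantum_graph_def)
  interpret L2_algebra ns by unfold_locales (use assms in auto)
  interpret quantum_adjacency_data ns r S F x y A
  proof (intro quantum_adjacency_data.intro bimodule_projection.intro quantum_adjacency_data_axioms.intro)
    show "L2_algebra ns" by (rule L2_algebra_axioms)
    show "VectorSpace.subspace class_ring S (mat_space (alg_dim ns))" by (rule sub)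
    show "orth_projection (alg_dim ns) S F" by (rule F)
    show "mat_adjoint X \<in> S" if "X \<in> S" for X using adj that by blast
    show "left_mult ns (x i) \<in> carrier_mat (alg_dim ns) (alg_dim ns)"
      "left_mult ns (y i) \<in> carrier_mat (alg_dim ns) (alg_dim ns)" for i
      by (rule left_mult_carrier)+
    show "F X = mat_sum_upto (alg_dim ns) r (\<lambda>i. left_mult ns (x i) * X * left_mult ns (y i))"
      if "X \<in> carrier_mat (alg_dim ns) (alg_dim ns)" for X
      using F_eq that by blast
    show "x i \<in> alg ns" "y i \<in> alg ns" if "i < r" for i using xy that by blast+
    show "A z = of_nat (alg_dim ns) \<cdot>\<^sub>m mat_sum_upto (alg_size ns) r (\<lambda>i. psi ns (x i * z) \<cdot>\<^sub>m y i)"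
      if "z \<in> alg ns" for z
      using A_eq that by blast
  qed
  have bound: "1 + ?M \<le> real c" if colorable: "quantum_colorable ns S c" for c
  proof -
    obtain k N P where col: "is_coloring ns S c k N P" using colorable by (auto simp: quantum_colorable_def)
    interpret colored_quantum_graph ns r S F x y A c k N P
      by (intro colored_quantum_graph.intro quantum_adjacency_data_axioms colored_algebra.intro
        L2_algebra_axioms colored_algebra_axioms.intro sub col)
    show ?thesis by (rule spectral_bounds)
  qed
  have "ereal (1 + ?M) \<le> ereal_of_enat (quantum_chromatic_number ns S)"
  proof (cases "\<exists>c. quantum_colorable ns S c")
    case True
    define X where "X = enat ` {c. quantum_colorable ns S c}"
    from True obtain e where e: "e \<in> X" unfolding X_def by blast
    have "Inf X \<in> X" using LeastI[of "\<lambda>x. x \<in> X", OF e] e by (auto simp: Inf_enat_def)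
    then have "quantum_chromatic_number ns S \<in> enat ` {c. quantum_colorable ns S c}"
      by (simp only: quantum_chromatic_number_def X_def)
    then obtain c where c: "quantum_colorable ns S c" "quantum_chromatic_number ns S = enat c" by blast
    show ?thesis unfolding c(2) ereal_of_enat_simps ereal_less_eq(3) by (rule bound[OF c(1)])
  next
    case False
    then have "quantum_chromatic_number ns S = \<infinity>"
      by (simp add: quantum_chromatic_number_def Inf_enat_def)
    then show ?thesis by (simp add: ereal_of_enat_simps)
  qed
  moreover have "quantum_chromatic_number ns S \<le> chromatic_number ns S"
    unfolding quantum_chromatic_number_def chromatic_number_def
    by (rule INF_superset_mono) (unfold quantum_colorable_def classically_colorable_def, blast, rule order_refl)
  ultimately show ?thesis unfolding Let_def by blast
qed

end
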